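(* Let $g\ge2$ and let $\rho_1:\pi_1(\Sigma_g)\rightarrow\mathsf{SL}_2(\mathbb{R})$ be a discrete faithful representation realizing $(\mathbb{H}^2_{\mathbb{R}},d_{\mathbb{H}^2})$ as a model space for $\pi_1(\Sigma_g)$. There exist $\varepsilon>0$ and a continuous family of $1$-Anosov representations $\{\rho_{s,t}:\pi_1(\Sigma_g)\rightarrow\mathsf{SL}_4(\mathbb{R})\}_{(s,t)\in\mathcal{O}}$, $\mathcal{O}:=\mathbb{R}\times(-\varepsilon,\varepsilon)$, such that for all $(s,t)\in\mathcal{O}$ with $s\ne0$ and $t\neq0$: (i) the image of the $(\rho_1,\rho_{s,t})$-equivariant Anosov limit map $\xi_{s,t}^1:(\partial_\infty\mathbb{H}^2_{\mathbb{R}},d_{\mathrm{v}})\rightarrow(\mathbb{P}(\mathbb{R}^4),d_{\mathbb{P}})$ of $\rho_{s,t}$ is spanning, i.e. $\langle\xi_{s,t}^1(\partial_\infty\mathbb{H}^2_{\mathbb{R}})\rangle=\mathbb{R}^4$; (ii) $\alpha_{\xi_{s,t}^1}(d_{\mathrm{v}},d_{\mathbb{P}})=\frac12$ and $\xi_{s,t}^1$ is not $\frac12$-H\"older.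
   Context: $\Sigma_g$ is the closed topological surface of genus $g$. $d_{\mathbb{H}^2}$ is the standard hyperbolic Riemannian distance on the real hyperbolic plane $\mathbb{H}^2_{\mathbb{R}}$ (curvature $-1$), and $\partial_\infty\mathbb{H}^2_{\mathbb{R}}$ carries the visual metric $d_{\mathrm{v}}(x,y)=e^{-(x\cdot y)_{x_0}}$, where $x_0\in\mathbb{H}^2_{\mathbb{R}}$ is a fixed basepoint and the Gromov product is $(x\cdot y)_{x_0}=\frac12(d(x,x_0)+d(y,x_0)-d(x,y))$ for points of $\mathbb{H}_{\mathbb{R}}^2$ and $(x\cdot y)_{x_0}=\sup\{\liminf_{m,n}(x_m\cdot y_n)_{x_0}:x_m\to x,\,y_n\to y\}$ for boundary points. "Realizing $\mathbb{H}^2_{\mathbb{R}}$ as a model space" means that $\pi_1(\Sigma_g)$ acts on $\mathbb{H}^2_{\mathbb{R}}$ via $\rho_1$ isometrically, properly discontinuously and cocompactly; this identifies $\partial_\infty\pi_1(\Sigma_g)$ with $\partial_\infty\mathbb{H}^2_{\mathbb{R}}$. A representation $\rho:\pi_1(\Sigma_g)\to\mathsf{GL}_d(\mathbb{R})$ is $1$-Anosov if there are $R,\epsilon>0$ with $\sigma_1(\rho(\gamma))/\sigma_2(\rho(\gamma))\ge e^{\epsilon\, d_{\mathbb{H}^2}(\rho_1(\gamma)x_0,x_0)-R}$ for all $\gamma$ ($\sigma_1\ge\sigma_2\ge\cdots$ the singular values). Its Anosov limit map is the unique continuous equivariant map $\partial_\infty\mathbb{H}^2_{\mathbb{R}}\to\mathbb{P}(\mathbb{R}^d)$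 sending the attracting fixed point of $\rho_1(\gamma)$ to the attracting fixed point of $\rho(\gamma)$ for every infinite order $\gamma$. $d_{\mathbb{P}}([v_1],[v_2])=\cos^{-1}\big(|\langle v_1,v_2\rangle|/(\|v_1\|\|v_2\|)\big)$. A map $f:(Z,\mathsf{d})\to(Z',\mathsf{d}')$ is $\alpha$-H\"older if there is $C>0$ with $\mathsf{d}'(f(x),f(y))\le C\,\mathsf{d}(x,y)^\alpha$ for all $x,y\in Z$; the H\"older exponent is $\alpha_f(\mathsf{d},\mathsf{d}')=\sup\{\alpha>0: f\text{ is }\alpha\text{-H\"older}\}$. *)

theory Defs
  imports
    "HOL-Analysis.Analysis"
    "HOL-Algebra.Group"
    "HOL-Computational_Algebra.Polynomial"
    "HOL-Library.Multiset"
begin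

section \<open>Surface groups\<close>

text \<open>
  A letter \<open>(x, e)\<close> stands for the generator \<open>x\<close> if \<open>e\<close> is \<open>False\<close> and for its formal
  inverse if \<open>e\<close> is \<open>True\<close>.
\<close>

type_synonym 'x word = "('x \<times> bool) list"

definition words_over :: "'x set \<Rightarrow> 'x word set" where
  "words_over S = lists (S \<times> UNIV)"

inductive presentation_eq :: "'x set \<Rightarrow> 'x word set \<Rightarrow> 'x word \<Rightarrow> 'x word \<Rightarrow> bool"
  for S :: "'x set" and R :: "'x word set" where
  refl: "u \<in> words_over S \<Longrightarrow> presentation_eq S R u u"
| sym: "presentation_eq S R u v \<Longrightarrow> presentation_eq S R v u"
| trans: "presentation_eq S R u v \<Longrightarrow> presentation_eq S R v w \<Longrightarrow> presentation_eq S R u w"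
| cancel: "u \<in> words_over S \<Longrightarrow> v \<in> words_over S \<Longrightarrow> x \<in> S \<Longrightarrow>
    presentation_eq S R (u @ [(x, e), (x, \<not> e)] @ v) (u @ v)"
| relator: "u \<in> words_over S \<Longrightarrow> v \<in> words_over S \<Longrightarrow> r \<in> R \<Longrightarrow> r \<in> words_over S \<Longrightarrow>
    presentation_eq S R (u @ r @ v) (u @ v)"

definition presentation_rel :: "'x set \<Rightarrow> 'x word set \<Rightarrow> ('x word \<times> 'x word) set" where
  "presentation_rel S R = {(u, v). presentation_eq S R u v}"

definition presented_group :: "'x set \<Rightarrow> 'x word set \<Rightarrow> 'x word set monoid" where
  "presented_group S R =
    \<lparr>carrier = words_over S // presentation_rel S R,
     monoid.mult = (\<lambda>X Y. \<Union>u\<in>X. \<Union>v\<in>Y. presentation_rel S R `` {u @ v}),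
     one = presentation_rel S R `` {[]}\<rparr>"

datatype surface_gen = GenA nat | GenB nat

definition surface_gens :: "nat \<Rightarrow> surface_gen set" where
  "surface_gens g = GenA ` {..<g} \<union> GenB ` {..<g}"

definition surface_relator :: "nat \<Rightarrow> surface_gen word" where
  "surface_relator g = concat (map (\<lambda>i.
     [(GenA i, False), (GenB i, False), (GenA i, True), (GenB i, True)]) [0..<g])"

text \<open>
  The fundamental group of the closed orientable surface of genus \<open>g\<close>, i.e. of the \<open>4g\<close>-gon with
  boundary edges glued according to the relator:
  \<open>\<langle>a\<^sub>1, b\<^sub>1, \<dots>, a\<^sub>g, b\<^sub>g | [a\<^sub>1, b\<^sub>1] \<cdots> [a\<^sub>g, b\<^sub>g] = 1\<rangle>\<close>.
\<close>

definition surface_group :: "nat \<Rightarrow> surface_gen word set monoid" where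
  "surface_group g = presented_group (surface_gens g) {surface_relator g}"

lemma presentation_eq_words:
  "presentation_eq S R u v \<Longrightarrow> u \<in> words_over S \<and> v \<in> words_over S"
  by (induction rule: presentation_eq.induct) (auto simp: words_over_def)

lemma presentation_eq_append_right:
  "presentation_eq S R u v \<Longrightarrow> w \<in> words_over S \<Longrightarrow> presentation_eq S R (u @ w) (v @ w)"
proof (induction rule: presentation_eq.induct)
  case (cancel u v x e)
  then show ?case
    using presentation_eq.cancel[of u S "v @ w" x R e] by (simp add: words_over_def)
next
  case (relator u v r)
  then show ?case
    using presentation_eq.relator[of u S "v @ w" r R] by (simp add: words_over_def)
next
  case (refl u)
  then show ?case by (intro presentation_eq.refl) (simp add: words_over_def)
next
  case (sym u v)
  then show ?case by (simp add: presentation_eq.sym[OF sym.IH])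
next
  case (trans u v w')
  then show ?case using presentation_eq.trans[OF trans.IH] by simp
qed

lemma presentation_eq_append_left:
  "presentation_eq S R u v \<Longrightarrow> w \<in> words_over S \<Longrightarrow> presentation_eq S R (w @ u) (w @ v)"
proof (induction rule: presentation_eq.induct)
  case (cancel u v x e)
  then show ?case
    using presentation_eq.cancel[of "w @ u" S v x R e] by (simp add: words_over_def)
next
  case (relator u v r)
  then show ?case
    using presentation_eq.relator[of "w @ u" S v r R] by (simp add: words_over_def)
next
  case (refl u)
  then show ?case by (intro presentation_eq.refl) (simp add: words_over_def)
next
  case (sym u v)
  then show ?case by (simp add: presentation_eq.sym[OF sym.IH])
next
  case (trans u v w')
  then show ?case using presentation_eq.trans[OF trans.IH] by simp
qed

lemma equiv_presentation_rel: "equiv (words_over S) (presentation_rel S R)"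
proof (rule equivI)
  show "presentation_rel S R \<subseteq> words_over S \<times> words_over S"
    by (auto simp: presentation_rel_def dest: presentation_eq_words)
  show "refl_on (words_over S) (presentation_rel S R)"
    by (auto simp: refl_on_def presentation_rel_def intro: presentation_eq.refl)
  show "Relation.sym (presentation_rel S R)"
    unfolding presentation_rel_def by (rule symI) (simp add: presentation_eq.sym)
  show "Relation.trans (presentation_rel S R)"
    unfolding presentation_rel_def by (rule transI) (simp, rule presentation_eq.trans)
qed

lemma presented_group_mult_class:
  assumes "u \<in> words_over S" "v \<in> words_over S"
  shows "presentation_rel S R `` {u} \<otimes>\<^bsub>presented_group S R\<^esub> presentation_rel S R `` {v}
    = presentation_rel S R `` {u @ v}"
proof -
  let ?r = "presentation_rel S R"
  have "?r `` {u' @ v'} = ?r `` {u @ v}" if "(u, u') \<in> ?r" "(v, v') \<in> ?r" for u' v'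
  proof -
    have eq: "presentation_eq S R u u'" "presentation_eq S R v v'"
      using that by (simp_all add: presentation_rel_def)
    then have "u' \<in> words_over S" by (blast dest: presentation_eq_words)
    then have "presentation_eq S R (u @ v) (u' @ v')"
      by (intro presentation_eq.trans[OF presentation_eq_append_right[OF eq(1) assms(2)]]
          presentation_eq_append_left[OF eq(2)])
    then have "(u @ v, u' @ v') \<in> ?r" by (simp add: presentation_rel_def)
    then show ?thesis
      by (rule equiv_class_eq[OF equiv_presentation_rel, symmetric])
  qed
  then have "(\<Union>u'\<in>?r `` {u}. \<Union>v'\<in>?r `` {v}. ?r `` {u' @ v'})
      = (\<Union>u'\<in>?r `` {u}. \<Union>v'\<in>?r `` {v}. ?r `` {u @ v})"
    by (intro SUP_cong) auto
  moreover have "u \<in> ?r `` {u}" "v \<in> ?r `` {v}"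
    by (intro equiv_class_self[OF equiv_presentation_rel] assms)+
  ultimately show ?thesis
    unfolding presented_group_def by auto
qed

lemma presented_group_inverse_word:
  assumes "u \<in> words_over S"
  shows "presentation_eq S R (rev (map (\<lambda>(x, e). (x, \<not> e)) u) @ u) []"
  using assms
proof (induction u)
  case Nil
  then show ?case by (auto intro: presentation_eq.refl)
next
  case (Cons a u)
  obtain x e where a: "a = (x, e)" by force
  let ?w = "rev (map (\<lambda>(x, e). (x, \<not> e)) u)"
  have u: "u \<in> words_over S" and x: "x \<in> S" using Cons.prems a by (auto simp: words_over_def)
  then have "?w \<in> words_over S" by (auto simp: words_over_def in_lists_conv_set)
  then have "presentation_eq S R (?w @ [(x, \<not> e), (x, \<not> \<not> e)] @ u) (?w @ u)"
    using u x by (intro presentation_eq.cancel)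
  then show ?case
    using presentation_eq.trans[OF _ Cons.IH[OF u]] a by simp
qed

lemma group_presented_group: "group (presented_group S R)"
proof (rule groupI)
  let ?r = "presentation_rel S R" and ?G = "presented_group S R"
  have W: "[] \<in> words_over S" "\<And>u v. u \<in> words_over S \<Longrightarrow> v \<in> words_over S \<Longrightarrow> u @ v \<in> words_over S"
    by (auto simp: words_over_def)
  have C: "\<exists>u\<in>words_over S. X = ?r `` {u}" if "X \<in> carrier ?G" for X
    using that unfolding presented_group_def by (simp, elim quotientE) blast
  have I: "?r `` {u} \<in> carrier ?G" if "u \<in> words_over S" for u
    using that by (simp add: presented_group_def quotientI)
  have one: "\<one>\<^bsub>?G\<^esub> = ?r `` {[]}" by (simp add: presented_group_def)
  show "\<one>\<^bsub>?G\<^esub> \<in> carrier ?G" using one I W by simp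
  show "X \<otimes>\<^bsub>?G\<^esub> Y \<in> carrier ?G" if "X \<in> carrier ?G" "Y \<in> carrier ?G" for X Y
    using C[OF that(1)] C[OF that(2)] by (auto simp: presented_group_mult_class I W)
  show "X \<otimes>\<^bsub>?G\<^esub> Y \<otimes>\<^bsub>?G\<^esub> Z = X \<otimes>\<^bsub>?G\<^esub> (Y \<otimes>\<^bsub>?G\<^esub> Z)"
    if "X \<in> carrier ?G" "Y \<in> carrier ?G" "Z \<in> carrier ?G" for X Y Z
    using C[OF that(1)] C[OF that(2)] C[OF that(3)]
    by (auto simp: presented_group_mult_class W)
  show "\<one>\<^bsub>?G\<^esub> \<otimes>\<^bsub>?G\<^esub> X = X" if "X \<in> carrier ?G" for X
    using C[OF that] by (auto simp: one presented_group_mult_class W)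
  show "\<exists>Y\<in>carrier ?G. Y \<otimes>\<^bsub>?G\<^esub> X = \<one>\<^bsub>?G\<^esub>" if X: "X \<in> carrier ?G" for X
  proof -
    obtain u where u: "u \<in> words_over S" "X = ?r `` {u}" using C[OF X] by auto
    let ?w = "rev (map (\<lambda>(x, e). (x, \<not> e)) u)"
    have w: "?w \<in> words_over S" using u(1) by (auto simp: words_over_def in_lists_conv_set)
    have "(?w @ u, []) \<in> ?r"
      using presented_group_inverse_word[OF u(1)] by (simp add: presentation_rel_def)
    then have "?r `` {?w @ u} = ?r `` {[]}"
      by (rule equiv_class_eq[OF equiv_presentation_rel])
    then have "?r `` {?w} \<otimes>\<^bsub>?G\<^esub> X = \<one>\<^bsub>?G\<^esub>"
      using u w by (simp add: one presented_group_mult_class)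
    then show ?thesis using I[OF w] by blast
  qed
qed

section \<open>Linear groups and singular values\<close>

definition GL :: "(real^'n^'n) monoid" where
  "GL = \<lparr>carrier = {A. invertible A}, monoid.mult = (**), one = mat 1\<rparr>"

definition SL :: "(real^'n^'n) monoid" where
  "SL = \<lparr>carrier = {A. det A = 1}, monoid.mult = (**), one = mat 1\<rparr>"

definition charpoly :: "real^'n^'n \<Rightarrow> real poly" where
  "charpoly A = det (\<chi> i j. (if i = j then [:0, 1:] else 0) - [:A $ i $ j:])"

text \<open>
  Square roots of the eigenvalues of \<open>A\<^sup>T A\<close>, with multiplicity, in decreasing order;
  \<open>singular_value k A\<close> is \<open>\<sigma>\<^sub>k(A)\<close>, counted from \<open>k = 1\<close>.
\<close>

definition singular_values :: "real^'n^'n \<Rightarrow> real list" where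
  "singular_values A =
    rev (sorted_list_of_multiset (image_mset sqrt (proots (charpoly (transpose A ** A)))))"

definition singular_value :: "nat \<Rightarrow> real^'n^'n \<Rightarrow> real" where
  "singular_value k A = singular_values A ! (k - 1)"

section \<open>The hyperbolic plane and its boundary at infinity\<close>

text \<open>Upper half-plane model.\<close>

definition hyp_plane :: "complex set" where
  "hyp_plane = {z. Im z > 0}"

definition hyp_dist :: "complex \<Rightarrow> complex \<Rightarrow> real" where
  "hyp_dist z w = arcosh (1 + (cmod (z - w))\<^sup>2 / (2 * Im z * Im w))"

datatype hyp_boundary = Finite_Pt real | Infinite_Pt

definition moebius :: "real^2^2 \<Rightarrow> complex \<Rightarrow> complex" where
  "moebius A z = (of_real (A $ 1 $ 1) * z + of_real (A $ 1 $ 2)) /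
                 (of_real (A $ 2 $ 1) * z + of_real (A $ 2 $ 2))"

fun moebius_boundary :: "real^2^2 \<Rightarrow> hyp_boundary \<Rightarrow> hyp_boundary" where
  "moebius_boundary A (Finite_Pt x) =
    (if A $ 2 $ 1 * x + A $ 2 $ 2 = 0 then Infinite_Pt
     else Finite_Pt ((A $ 1 $ 1 * x + A $ 1 $ 2) / (A $ 2 $ 1 * x + A $ 2 $ 2)))"
| "moebius_boundary A Infinite_Pt =
    (if A $ 2 $ 1 = 0 then Infinite_Pt else Finite_Pt (A $ 1 $ 1 / A $ 2 $ 1))"

fun tends_to_boundary :: "(nat \<Rightarrow> complex) \<Rightarrow> hyp_boundary \<Rightarrow> bool" where
  "tends_to_boundary z (Finite_Pt x) \<longleftrightarrow> z \<longlonglongrightarrow> of_real x"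
| "tends_to_boundary z Infinite_Pt \<longleftrightarrow> filterlim z at_infinity sequentially"

definition gromov_product :: "complex \<Rightarrow> complex \<Rightarrow> complex \<Rightarrow> real" where
  "gromov_product x0 x y = (hyp_dist x x0 + hyp_dist y x0 - hyp_dist x y) / 2"

text \<open>Extended-real valued, since \<open>(x \<cdot> x) = \<infinity>\<close> for boundary points.\<close>

definition gromov_product_boundary ::
    "complex \<Rightarrow> hyp_boundary \<Rightarrow> hyp_boundary \<Rightarrow> ereal" where
  "gromov_product_boundary x0 x y = Sup
    {Liminf (sequentially \<times>\<^sub>F sequentially) (\<lambda>(m, n). ereal (gromov_product x0 (xs m) (ys n))) | xs ys.
      range xs \<subseteq> hyp_plane \<and> range ys \<subseteq> hyp_plane \<and>
      tends_to_boundary xs x \<and> tends_to_boundary ys y}"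

text \<open>\<open>e\<^bsup>-(x\<cdot>y)\<^esup>\<close> with the convention \<open>e\<^bsup>-\<infinity>\<^esup> = 0\<close>.\<close>

definition visual_dist :: "complex \<Rightarrow> hyp_boundary \<Rightarrow> hyp_boundary \<Rightarrow> real" where
  "visual_dist x0 x y =
    (if gromov_product_boundary x0 x y = \<infinity> then 0
     else exp (- real_of_ereal (gromov_product_boundary x0 x y)))"

text \<open>A discrete faithful representation through which \<open>G\<close> acts on the hyperbolic plane
  isometrically, properly discontinuously and cocompactly.\<close>

definition model_rep :: "('g, 'b) monoid_scheme \<Rightarrow> ('g \<Rightarrow> real^2^2) \<Rightarrow> bool" where
  "model_rep G \<rho>\<^sub>1 \<longleftrightarrow>
     \<rho>\<^sub>1 \<in> hom G SL \<and>
     inj_on \<rho>\<^sub>1 (carrier G) \<and>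
     discrete (\<rho>\<^sub>1 ` carrier G) \<and>
     (\<forall>\<gamma>\<in>carrier G. moebius (\<rho>\<^sub>1 \<gamma>) ` hyp_plane = hyp_plane \<and>
        (\<forall>z\<in>hyp_plane. \<forall>w\<in>hyp_plane.
           hyp_dist (moebius (\<rho>\<^sub>1 \<gamma>) z) (moebius (\<rho>\<^sub>1 \<gamma>) w) = hyp_dist z w)) \<and>
     (\<forall>K. compact K \<and> K \<subseteq> hyp_plane \<longrightarrow>
        finite {\<gamma>\<in>carrier G. moebius (\<rho>\<^sub>1 \<gamma>) ` K \<inter> K \<noteq> {}}) \<and>
     (\<exists>K. compact K \<and> K \<subseteq> hyp_plane \<and> (\<Union>\<gamma>\<in>carrier G. moebius (\<rho>\<^sub>1 \<gamma>) ` K) = hyp_plane)"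

section \<open>Projective space\<close>

text \<open>Points are the lines through the origin, as subsets of the vector space.\<close>

definition proj_space :: "(real^'n) set set" where
  "proj_space = {span {v} | v. v \<noteq> 0}"

definition proj_action :: "real^'n^'n \<Rightarrow> (real^'n) set \<Rightarrow> (real^'n) set" where
  "proj_action A L = (\<lambda>v. A *v v) ` L"

definition proj_dist :: "(real^'n) set \<Rightarrow> (real^'n) set \<Rightarrow> real" where
  "proj_dist L M = (THE r. \<exists>v\<in>L - {0}. \<exists>w\<in>M - {0}. r = arccos (\<bar>v \<bullet> w\<bar> / (norm v * norm w)))"

lemma proj_dist_span:
  fixes v w :: "real^'n"
  assumes "v \<noteq> 0" "w \<noteq> 0"
  shows "proj_dist (span {v}) (span {w}) = arccos (\<bar>v \<bullet> w\<bar> / (norm v * norm w))"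
  unfolding proj_dist_def
proof (rule the_equality)
  show "\<exists>v'\<in>span {v} - {0}. \<exists>w'\<in>span {w} - {0}.
      arccos (\<bar>v \<bullet> w\<bar> / (norm v * norm w)) = arccos (\<bar>v' \<bullet> w'\<bar> / (norm v' * norm w'))"
    using assms by (intro bexI[of _ v] bexI[of _ w]) (auto intro: span_base)
next
  fix r
  assume "\<exists>v'\<in>span {v} - {0}. \<exists>w'\<in>span {w} - {0}. r = arccos (\<bar>v' \<bullet> w'\<bar> / (norm v' * norm w'))"
  then obtain v' w' where vw: "v' \<in> span {v}" "v' \<noteq> 0" "w' \<in> span {w}" "w' \<noteq> 0"
    and r: "r = arccos (\<bar>v' \<bullet> w'\<bar> / (norm v' * norm w'))" by blast
  from vw obtain a b where "v' = a *\<^sub>R v" "w' = b *\<^sub>R w" by (auto simp: span_singleton)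
  then show "r = arccos (\<bar>v \<bullet> w\<bar> / (norm v * norm w))"
    using vw r by (simp add: abs_mult)
qed

section \<open>Anosov representations and their limit maps\<close>

definition one_Anosov :: "complex \<Rightarrow> ('g, 'b) monoid_scheme \<Rightarrow> ('g \<Rightarrow> real^2^2) \<Rightarrow>
    ('g \<Rightarrow> real^'n^'n) \<Rightarrow> bool" where
  "one_Anosov x0 G \<rho>\<^sub>1 \<rho> \<longleftrightarrow>
     \<rho> \<in> hom G GL \<and>
     (\<exists>R>0. \<exists>\<epsilon>>0. \<forall>\<gamma>\<in>carrier G.
        singular_value 1 (\<rho> \<gamma>) / singular_value 2 (\<rho> \<gamma>)
          \<ge> exp (\<epsilon> * hyp_dist (moebius (\<rho>\<^sub>1 \<gamma>) x0) x0 - R))"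

text \<open>A fixed point having a neighbourhood on which the iterates converge to it uniformly.\<close>

definition attracting_fixed_point ::
    "'z set \<Rightarrow> ('z \<Rightarrow> 'z \<Rightarrow> real) \<Rightarrow> ('z \<Rightarrow> 'z) \<Rightarrow> 'z \<Rightarrow> bool" where
  "attracting_fixed_point Z d f x \<longleftrightarrow>
     x \<in> Z \<and> f x = x \<and>
     (\<exists>r>0. \<forall>e>0. \<exists>N. \<forall>n\<ge>N. \<forall>y\<in>Z. d x y < r \<longrightarrow> d x ((f ^^ n) y) < e)"

definition Anosov_limit_map :: "complex \<Rightarrow> ('g, 'b) monoid_scheme \<Rightarrow> ('g \<Rightarrow> real^2^2) \<Rightarrow>
    ('g \<Rightarrow> real^'n^'n) \<Rightarrow> (hyp_boundary \<Rightarrow> (real^'n) set) \<Rightarrow> bool" where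
  "Anosov_limit_map x0 G \<rho>\<^sub>1 \<rho> \<xi> \<longleftrightarrow>
     range \<xi> \<subseteq> proj_space \<and>
     (\<forall>x. \<forall>e>0. \<exists>\<delta>>0. \<forall>y. visual_dist x0 x y < \<delta> \<longrightarrow> proj_dist (\<xi> x) (\<xi> y) < e) \<and>
     (\<forall>\<gamma>\<in>carrier G. \<forall>x. \<xi> (moebius_boundary (\<rho>\<^sub>1 \<gamma>) x) = proj_action (\<rho> \<gamma>) (\<xi> x)) \<and>
     (\<forall>\<gamma>\<in>carrier G. (\<forall>n::nat. n > 0 \<longrightarrow> \<gamma> [^]\<^bsub>G\<^esub> n \<noteq> \<one>\<^bsub>G\<^esub>) \<longrightarrow>
        (\<forall>x. attracting_fixed_point UNIV (visual_dist x0) (moebius_boundary (\<rho>\<^sub>1 \<gamma>)) x \<longrightarrow>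
             attracting_fixed_point proj_space proj_dist (proj_action (\<rho> \<gamma>)) (\<xi> x)))"

section \<open>Hoelder exponents\<close>

definition is_Hoelder ::
    "('z \<Rightarrow> 'z \<Rightarrow> real) \<Rightarrow> ('y \<Rightarrow> 'y \<Rightarrow> real) \<Rightarrow> real \<Rightarrow> ('z \<Rightarrow> 'y) \<Rightarrow> bool" where
  "is_Hoelder d d' \<alpha> f \<longleftrightarrow> (\<exists>C>0. \<forall>x y. d' (f x) (f y) \<le> C * d x y powr \<alpha>)"

text \<open>The supremum is taken in the extended reals, where it is always meaningful.\<close>

definition Hoelder_exponent ::
    "('z \<Rightarrow> 'z \<Rightarrow> real) \<Rightarrow> ('y \<Rightarrow> 'y \<Rightarrow> real) \<Rightarrow> ('z \<Rightarrow> 'y) \<Rightarrow> ereal" where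
  "Hoelder_exponent d d' f = Sup (ereal ` {\<alpha>. \<alpha> > 0 \<and> is_Hoelder d d' \<alpha> f})"

end

theory Submission
  imports Defs
begin

text \<open>
  \<open>\<rho>\<^bsub>s,t\<^esub>\<close> acts on \<open>\<real>\<^sup>2 \<times> \<real> \<times> \<real>\<close> by \<open>(x, y, z) \<mapsto> (\<rho>\<^sub>1 x, y + s a \<cdot> x, z + t c y + s t b \<cdot> x)\<close>, where
  \<open>c\<close> is a homomorphism to \<open>\<real>\<close>, \<open>a\<close> is a cocycle that is not a coboundary and \<open>b\<close> is a primitive of
  the cup product of \<open>c\<close> and \<open>a\<close>. The quotient \<open>\<rho>\<^sub>1\<close> dominates the unipotent block, whence
  \<open>\<sigma>\<^sub>1/\<sigma>\<^sub>2\<close> is of size \<open>exp (d/2)\<close> up to a factor linear in \<open>d\<close>. The limit map is the graph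
  \<open>v \<mapsto> [v : f v : h v]\<close> of homogeneous functions with \<open>f (\<rho>\<^sub>1 v) = f v + a \<cdot> v\<close> and
  \<open>h (\<rho>\<^sub>1 v) = h v + c f v + b \<cdot> v\<close>. Renormalising two directions at distance \<open>\<delta>\<close> to unit size by a
  group element of norm about \<open>\<delta>\<^bsup>-1/2\<^esup>\<close>, on which \<open>c\<close> is \<open>O (ln (1/\<delta>))\<close>, shows that \<open>f\<close> has modulus of
  continuity \<open>\<delta>\<^bsup>1/2\<^esup>\<close> and \<open>h\<close> has modulus \<open>\<delta>\<^bsup>1/2\<^esup> ln (1/\<delta>)\<close>. The logarithm is attained along the
  powers of a hyperbolic element with \<open>c \<noteq> 0\<close>.
\<close>

section \<open>Homomorphisms from presented groups\<close>

text \<open>The obstruction to \<open>b\<close> lies in the second cohomology with coefficients in a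
  plane without invariant vectors, hence vanishes. Concretely, the single relation is solved for the
  image of \<open>GenA 0\<close>, which needs the image of \<open>GenB 0\<close> minus the identity
  to be invertible. This comes from growth: real-valued homomorphisms are logarithmic in the matrix
  norm, so an element on which one of them is nonzero is hyperbolic. The cocompact action enters
  only through two facts about norms: boundedly many elements have bounded norm, and any vector can
  be contracted by any factor r with an element of norm O(1/r). They replace word metrics, produce
  \<open>f\<close> and \<open>h\<close> as limits of renormalised cocycle values, and control their
  moduli of continuity. That \<open>a\<close> is not a coboundary is used as nonlinearity of
  \<open>f\<close>: it makes the curve spanning and gives the logarithm a nonzero coefficient. For
  nonzero s and t all members of the family are conjugate by diagonal matrices, so one pair
  (\<open>f\<close>, \<open>h\<close>) serves them all after rescaling.\<close>

definition word_eval :: "('h, 'm) monoid_scheme \<Rightarrow> ('x \<Rightarrow> 'h) \<Rightarrow> 'x word \<Rightarrow> 'h" where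
  "word_eval H m w = foldr (\<lambda>(x, e) y. (if e then inv\<^bsub>H\<^esub> m x else m x) \<otimes>\<^bsub>H\<^esub> y) w \<one>\<^bsub>H\<^esub>"

lemma word_eval_Nil [simp]: "word_eval H m [] = \<one>\<^bsub>H\<^esub>"
  by (simp add: word_eval_def)

lemma word_eval_Cons:
  "word_eval H m ((x, e) # w) = (if e then inv\<^bsub>H\<^esub> m x else m x) \<otimes>\<^bsub>H\<^esub> word_eval H m w"
  by (simp add: word_eval_def)

lemma word_eval_cong:
  "(\<And>x e. (x, e) \<in> set w \<Longrightarrow> m x = m' x) \<Longrightarrow> word_eval H m w = word_eval H m' w"
  by (induction w) (fastforce simp: word_eval_Cons)+

lemma words_over_simps [simp]:
  "[] \<in> words_over S"
  "(x, e) # w \<in> words_over S \<longleftrightarrow> x \<in> S \<and> w \<in> words_over S"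
  "u @ v \<in> words_over S \<longleftrightarrow> u \<in> words_over S \<and> v \<in> words_over S"
  by (auto simp: words_over_def)

context group
begin

lemma word_eval_closed:
  "m \<in> S \<rightarrow> carrier G \<Longrightarrow> w \<in> words_over S \<Longrightarrow> word_eval G m w \<in> carrier G"
  by (induction w) (auto simp: word_eval_Cons Pi_iff)

lemma word_eval_append:
  assumes "m \<in> S \<rightarrow> carrier G" "u \<in> words_over S" "v \<in> words_over S"
  shows "word_eval G m (u @ v) = word_eval G m u \<otimes> word_eval G m v"
  using assms(2)
proof (induction u)
  case (Cons a u)
  then show ?case
    using assms(1,3) by (cases a) (auto simp: word_eval_Cons m_assoc word_eval_closed Pi_iff)
qed (use assms in \<open>simp add: word_eval_closed\<close>)

lemma presentation_eq_word_eval: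
  assumes "presentation_eq S R u v" "m \<in> S \<rightarrow> carrier G"
    and "\<And>r. r \<in> R \<Longrightarrow> r \<in> words_over S \<Longrightarrow> word_eval G m r = \<one>"
  shows "word_eval G m u = word_eval G m v"
  using assms(1)
proof (induction rule: presentation_eq.induct)
  case (cancel u v x e)
  then have "word_eval G m [(x, e), (x, \<not> e)] = \<one>" "m x \<in> carrier G"
    using assms(2) by (auto simp: word_eval_Cons Pi_def)
  then show ?case
    using cancel assms(2) word_eval_append[OF assms(2), of u "[(x, e), (x, \<not> e)] @ v"]
      word_eval_append[OF assms(2), of "[(x, e), (x, \<not> e)]" v] word_eval_append[OF assms(2), of u v]
    by (simp add: word_eval_closed)
next
  case (relator u v r)
  then show ?case
    using assms(2) assms(3)[of r] word_eval_append[OF assms(2), of u "r @ v"]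
      word_eval_append[OF assms(2), of r v] word_eval_append[OF assms(2), of u v]
    by (simp add: word_eval_closed)
qed auto

end

abbreviation word_class :: "'x set \<Rightarrow> 'x word set \<Rightarrow> 'x word \<Rightarrow> 'x word set" where
  "word_class S R w \<equiv> presentation_rel S R `` {w}"

abbreviation gen_class :: "'x set \<Rightarrow> 'x word set \<Rightarrow> 'x \<Rightarrow> 'x word set" where
  "gen_class S R x \<equiv> word_class S R [(x, False)]"

lemma carrier_presented_group:
  "carrier (presented_group S R) = word_class S R ` words_over S"
  by (auto simp: presented_group_def quotient_def)

lemma word_class_closed: "w \<in> words_over S \<Longrightarrow> word_class S R w \<in> carrier (presented_group S R)"
  by (simp add: carrier_presented_group)

text \<open>The universal property of a presentation. A class is evaluated on a chosen
  representative, and \<open>presentation_eq_word_eval\<close> makes the choice immaterial.\<close>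

lemma presented_group_hom_exists:
  assumes "group H" "m \<in> S \<rightarrow> carrier H"
    and "\<And>r. r \<in> R \<Longrightarrow> r \<in> words_over S \<Longrightarrow> word_eval H m r = \<one>\<^bsub>H\<^esub>"
  obtains \<Phi> where "\<Phi> \<in> hom (presented_group S R) H"
    "\<And>w. w \<in> words_over S \<Longrightarrow> \<Phi> (word_class S R w) = word_eval H m w"
proof -
  interpret H: group H by fact
  define \<Phi> where "\<Phi> X = word_eval H m (SOME w. w \<in> X)" for X
  have eval: "\<Phi> (word_class S R w) = word_eval H m w" if "w \<in> words_over S" for w
  proof -
    have "w \<in> word_class S R w"
      by (rule equiv_class_self[OF equiv_presentation_rel that])
    then have "(SOME w'. w' \<in> word_class S R w) \<in> word_class S R w"
      by (rule someI)
    then have "presentation_eq S R w (SOME w'. w' \<in> word_class S R w)"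
      by (simp add: presentation_rel_def)
    then show ?thesis
      unfolding \<Phi>_def using H.presentation_eq_word_eval[OF _ assms(2,3)] by metis
  qed
  have "\<Phi> \<in> hom (presented_group S R) H"
    by (auto simp: hom_def carrier_presented_group eval H.word_eval_closed[OF assms(2)]
        presented_group_mult_class H.word_eval_append[OF assms(2)])
  then show thesis using eval by (rule that)
qed

lemma presented_group_hom_word_eval:
  assumes "group H" "\<Phi> \<in> hom (presented_group S R) H" "w \<in> words_over S"
  shows "\<Phi> (word_class S R w) = word_eval H (\<lambda>x. \<Phi> (gen_class S R x)) w"
  using assms(3)
proof (induction w)
  case Nil
  have "word_class S R [] = \<one>\<^bsub>presented_group S R\<^esub>" by (simp add: presented_group_def)
  then show ?case
    using hom_one[OF assms(2) group_presented_group assms(1)] by simp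
next
  case (Cons a w)
  interpret P: group "presented_group S R" by (rule group_presented_group)
  interpret H: group H by fact
  interpret group_hom "presented_group S R" H \<Phi>
    by unfold_locales (rule assms(2))
  obtain x e where a: "a = (x, e)" by force
  have x: "x \<in> S" and w: "w \<in> words_over S" using Cons.prems a by auto
  have split: "word_class S R (a # w) = word_class S R [a] \<otimes>\<^bsub>presented_group S R\<^esub> word_class S R w"
    using presented_group_mult_class[of "[a]" S w R] x w a by simp
  have "\<Phi> (word_class S R [(x, True)]) = inv\<^bsub>H\<^esub> \<Phi> (gen_class S R x)"
  proof -
    have "presentation_eq S R ([] @ [(x, False), (x, \<not> False)] @ []) ([] @ [])"
      by (rule presentation_eq.cancel) (use x in auto)
    then have "([(x, False), (x, True)], []) \<in> presentation_rel S R"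
      by (simp add: presentation_rel_def)
    then have "word_class S R [(x, False), (x, True)] = word_class S R []"
      by (rule equiv_class_eq[OF equiv_presentation_rel])
    then have xy: "gen_class S R x \<otimes>\<^bsub>presented_group S R\<^esub> word_class S R [(x, True)]
        = \<one>\<^bsub>presented_group S R\<^esub>"
      using presented_group_mult_class[of "[(x, False)]" S "[(x, True)]" R] x
      by (simp add: presented_group_def)
    have cl: "gen_class S R x \<in> carrier (presented_group S R)"
      "word_class S R [(x, True)] \<in> carrier (presented_group S R)"
      by (rule word_class_closed, simp add: x)+
    have "inv\<^bsub>presented_group S R\<^esub> gen_class S R x = word_class S R [(x, True)]"
      by (rule P.inv_equality[OF P.inv_comm[OF xy cl] cl])
    then show ?thesis using hom_inv[OF cl(1)] by simp
  qed
  then show ?case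
    using split Cons.IH[OF w] a x w by (cases e) (auto simp: word_eval_Cons word_class_closed)
qed

definition real_add :: "real monoid" where
  "real_add = \<lparr>carrier = UNIV, monoid.mult = (+), one = 0\<rparr>"

lemma real_add_simps [simp]:
  "carrier real_add = UNIV" "x \<otimes>\<^bsub>real_add\<^esub> y = x + y" "\<one>\<^bsub>real_add\<^esub> = 0"
  by (simp_all add: real_add_def)

lemma group_real_add: "group real_add"
  by (rule groupI) (auto intro: exI[of _ "- _"])

lemma inv_real_add [simp]: "inv\<^bsub>real_add\<^esub> x = - x"
  by (rule group.inv_equality[OF group_real_add]) auto

lemma surface_gens_iff [simp]:
  "GenA i \<in> surface_gens g \<longleftrightarrow> i < g" "GenB i \<in> surface_gens g \<longleftrightarrow> i < g"
  by (auto simp: surface_gens_def)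

definition commutator_word :: "nat \<Rightarrow> surface_gen word" where
  "commutator_word i = [(GenA i, False), (GenB i, False), (GenA i, True), (GenB i, True)]"

lemma surface_relator_alt: "surface_relator g = concat (map commutator_word [0..<g])"
  unfolding surface_relator_def commutator_word_def ..

text \<open>Every generator has exponent sum zero in a commutator, so counting occurrences of one
  generator respects the relator. Applied to \<open>GenB 0\<close>, this is what certifies that its
  image is hyperbolic.\<close>

lemma exponent_sum_hom:
  obtains c where "c \<in> hom (surface_group g) real_add"
    "\<And>y. y \<in> surface_gens g \<Longrightarrow>
      c (gen_class (surface_gens g) {surface_relator g} y) = (if y = x then 1 else 0)"
proof -
  define m :: "surface_gen \<Rightarrow> real" where "m = (\<lambda>y. if y = x then 1 else 0)"
  have "word_eval real_add m (concat (map commutator_word is)) = 0" for "is"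
    by (induction "is") (auto simp: commutator_word_def word_eval_Cons)
  then have rel: "word_eval real_add m r = \<one>\<^bsub>real_add\<^esub>" if "r \<in> {surface_relator g}" for r
    using that by (simp add: surface_relator_alt)
  obtain c where "c \<in> hom (surface_group g) real_add"
    "\<And>w. w \<in> words_over (surface_gens g) \<Longrightarrow>
      c (word_class (surface_gens g) {surface_relator g} w) = word_eval real_add m w"
    using presented_group_hom_exists[OF group_real_add, of m "surface_gens g" "{surface_relator g}"] rel
    by (auto simp: surface_group_def)
  then show thesis
    by (intro that[of c]) (auto simp: word_eval_Cons m_def)
qed

section \<open>Cocycles over a surface group\<close>

lemma SL_simps [simp]:
  "A \<in> carrier SL \<longleftrightarrow> det A = 1" "A \<otimes>\<^bsub>SL\<^esub> B = A ** B" "\<one>\<^bsub>SL\<^esub> = mat 1"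
  by (simp_all add: SL_def)

lemma group_SL: "group (SL :: (real^'n^'n) monoid)"
proof (rule groupI)
  fix A :: "real^'n^'n" assume A: "A \<in> carrier SL"
  then have "invertible A" by (simp add: invertible_det_nz)
  then obtain B where B: "B ** A = mat 1" by (auto simp: invertible_def)
  then have "det B * det A = 1" by (metis det_mul det_I)
  then show "\<exists>B\<in>carrier SL. B \<otimes>\<^bsub>SL\<^esub> A = \<one>\<^bsub>SL\<^esub>"
    using A B by auto
qed (auto simp: det_mul matrix_mul_assoc)

lemma hom_word_eval:
  assumes "group G" "group H" "h \<in> hom G H" "m \<in> S \<rightarrow> carrier G" "w \<in> words_over S"
  shows "h (word_eval G m w) = word_eval H (\<lambda>x. h (m x)) w"
  using assms(5)
proof (induction w)
  case Nil
  then show ?case using hom_one[OF assms(3,1,2)] by simp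
next
  case (Cons l w)
  interpret G: group G by fact
  interpret group_hom G H h
    using assms by (simp add: group_hom_def group_hom_axioms_def)
  have "word_eval G m w \<in> carrier G" using Cons.prems G.word_eval_closed[OF assms(4), of w] by (cases l) auto
  with Cons show ?case using assms(4) by (cases l) (auto simp: word_eval_Cons Pi_iff)
qed

section \<open>Unipotent extensions of the special linear group and lifts of the surface
  relation\<close>

type_synonym ext = "(real^2^2) \<times> (real^2) \<times> (real^2) \<times> real"

text \<open>The quadruple \<open>(P, a, b, c)\<close> stands for the \<open>4\<times>4\<close> block matrix acting by
  \<open>(x, y, z) \<mapsto> (P x, y + a \<cdot> x, z + c y + b \<cdot> x)\<close> on \<open>\<real>\<^sup>2 \<times> \<real> \<times> \<real>\<close>.\<close>

definition ext_group :: "ext monoid" where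
  "ext_group = \<lparr>carrier = {(P, a, b, c). det P = 1},
     monoid.mult = (\<lambda>(P, a, b, c) (P', a', b', c').
       (P ** P', a' + a v* P', b' + c *\<^sub>R a' + b v* P', c + c')),
     one = (mat 1, 0, 0, 0)\<rparr>"

lemma ext_group_simps [simp]:
  "(P, a, b, c) \<in> carrier ext_group \<longleftrightarrow> det P = 1"
  "(P, a, b, c) \<otimes>\<^bsub>ext_group\<^esub> (P', a', b', c') =
     (P ** P', a' + a v* P', b' + c *\<^sub>R a' + b v* P', c + c')"
  "\<one>\<^bsub>ext_group\<^esub> = (mat 1, 0, 0, 0)"
  by (simp_all add: ext_group_def)

lemma vector_matrix_add_left: "(a + b) v* (A :: real^'n^'m) = a v* A + b v* A"
  by (metis vector_matrix_left_distrib)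

lemma vector_matrix_scaleR: "(k *\<^sub>R a) v* (A :: real^'n^'m) = k *\<^sub>R (a v* A)"
  by (simp add: scaleR_vector_matrix_assoc)

lemma matrix_diff_ldistrib: "(A :: real^'n^'m) ** (B - C) = A ** B - A ** C"
  by (simp add: vec_eq_iff matrix_matrix_mult_def right_diff_distrib sum_subtractf)

lemma matrix_diff_rdistrib: "((A :: real^'n^'m) - B) ** C = A ** C - B ** C"
  by (simp add: vec_eq_iff matrix_matrix_mult_def left_diff_distrib sum_subtractf)

lemma group_ext_group: "group ext_group"
proof (rule groupI)
  fix x assume x: "x \<in> carrier ext_group"
  obtain P a b c where [simp]: "x = (P, a, b, c)" by (cases x) auto
  obtain Q where Q: "det Q = 1" "Q ** P = mat 1"
    using group.l_inv_ex[OF group_SL, of P] x by auto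
  have inv: "(y v* Q) v* P = y" for y
    using Q by (simp add: vector_matrix_mul_assoc)
  show "\<exists>y\<in>carrier ext_group. y \<otimes>\<^bsub>ext_group\<^esub> x = \<one>\<^bsub>ext_group\<^esub>"
    using Q
    by (intro bexI[of _ "(Q, (- a) v* Q, (c *\<^sub>R a - b) v* Q, - c)"]) (simp_all add: inv)
next
  fix x y z assume "x \<in> carrier ext_group" "y \<in> carrier ext_group" "z \<in> carrier ext_group"
  then show "x \<otimes>\<^bsub>ext_group\<^esub> y \<otimes>\<^bsub>ext_group\<^esub> z = x \<otimes>\<^bsub>ext_group\<^esub> (y \<otimes>\<^bsub>ext_group\<^esub> z)"
    by (cases x; cases y; cases z)
      (simp add: matrix_mul_assoc vector_matrix_mul_assoc vector_matrix_add_left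
        vector_matrix_scaleR scaleR_add_left scaleR_add_right add_ac)
qed (auto simp: det_mul)

lemma ext_group_homs:
  "fst \<in> hom ext_group SL" "(\<lambda>x. snd (snd (snd x))) \<in> hom ext_group real_add"
  by (auto simp: hom_def)

text \<open>Turns the relation [X, Y] Z = 1, with X unknown, into the conjugacy equation X Y X^-1 =
  Z^-1 Y, which in \<open>ext_group\<close> reduces to linear algebra.\<close>

lemma (in group) commutator_eq_inv:
  assumes "X \<in> carrier G" "Y \<in> carrier G" "Z \<in> carrier G"
    and "X \<otimes> Y = inv Z \<otimes> Y \<otimes> X"
  shows "X \<otimes> (Y \<otimes> (inv X \<otimes> (inv Y \<otimes> Z))) = \<one>"
proof -
  have cancel: "V \<otimes> (inv V \<otimes> W) = W" if "V \<in> carrier G" "W \<in> carrier G" for V W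
    using that by (simp flip: m_assoc)
  have "X \<otimes> (Y \<otimes> (inv X \<otimes> (inv Y \<otimes> Z))) = X \<otimes> Y \<otimes> (inv X \<otimes> (inv Y \<otimes> Z))"
    using assms(1-3) by (simp add: m_assoc)
  also have "\<dots> = inv Z \<otimes> (Y \<otimes> (X \<otimes> (inv X \<otimes> (inv Y \<otimes> Z))))"
    unfolding assms(4) using assms(1-3) by (simp add: m_assoc)
  finally show ?thesis using assms(1-3) by (simp add: cancel)
qed

lemma vector_matrix_surj:
  fixes A :: "real^'n^'n"
  assumes "det A \<noteq> 0"
  obtains p where "p v* A = y"
proof -
  obtain B where "B ** A = mat 1"
    using assms by (auto simp: invertible_det_nz[symmetric] invertible_def)
  then show thesis by (intro that[of "y v* B"]) (simp add: vector_matrix_mul_assoc)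
qed

text \<open>If \<open>P - 1\<close> is invertible, a unipotent element conjugates \<open>(P, \<alpha>, \<beta>, 0)\<close> into
  \<open>(P, 0, 0, 0)\<close>; this solves the surface relation for the image of the first generator.\<close>

lemma ext_commutator_solvable:
  assumes "det A = 1" "det B = 1" "det (B - mat 1) \<noteq> 0"
    and Z: "Z \<in> carrier ext_group" "snd (snd (snd Z)) = 0"
    and rel: "A ** (B ** (inv\<^bsub>SL\<^esub> A ** (inv\<^bsub>SL\<^esub> B ** fst Z))) = mat 1"
  obtains p q where
    "(A, p, q, 1) \<otimes>\<^bsub>ext_group\<^esub> ((B, 0, 0, 0) \<otimes>\<^bsub>ext_group\<^esub> (inv\<^bsub>ext_group\<^esub> (A, p, q, 1)
      \<otimes>\<^bsub>ext_group\<^esub> (inv\<^bsub>ext_group\<^esub> (B, 0, 0, 0) \<otimes>\<^bsub>ext_group\<^esub> Z))) = \<one>\<^bsub>ext_group\<^esub>"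
proof -
  interpret E: group ext_group by (rule group_ext_group)
  interpret S: group "SL :: (real^2^2) monoid" by (rule group_SL)
  interpret f: group_hom ext_group SL fst
    by (simp add: group_hom_def group_hom_axioms_def ext_group_homs group_ext_group group_SL)
  interpret l: group_hom ext_group real_add "\<lambda>x. snd (snd (snd x))"
    by (simp add: group_hom_def group_hom_axioms_def ext_group_homs group_ext_group group_real_add)
  let ?Y = "(B, 0, 0, 0) :: ext"
  define T where "T = inv\<^bsub>ext_group\<^esub> Z \<otimes>\<^bsub>ext_group\<^esub> ?Y"
  have Tc: "T \<in> carrier ext_group" using Z assms by (simp add: T_def)
  obtain C where C: "C = inv\<^bsub>SL\<^esub> A" by simp
  have AC: "A ** C = mat 1" "C ** A = mat 1" and dC: "det C = 1"
    using S.r_inv[of A] S.l_inv[of A] S.inv_closed[of A] assms C by auto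
  have fZ: "det (fst Z) = 1" using f.hom_closed[OF Z(1)] by simp
  have "fst T = A ** B ** C"
  proof -
    have "A ** B ** C = inv\<^bsub>SL\<^esub> (fst Z) ** B"
    proof -
      have "(A ** B ** C) ** (inv\<^bsub>SL\<^esub> B ** fst Z) = mat 1"
        using rel by (simp add: matrix_mul_assoc C)
      then have "A ** B ** C = inv\<^bsub>SL\<^esub> (inv\<^bsub>SL\<^esub> B ** fst Z)"
        using S.inv_equality[of "A ** B ** C" "inv\<^bsub>SL\<^esub> B ** fst Z"] assms dC fZ S.inv_closed[of B]
        by (simp add: det_mul)
      also have "\<dots> = inv\<^bsub>SL\<^esub> (fst Z) ** B"
        using S.inv_mult_group[of "inv\<^bsub>SL\<^esub> B" "fst Z"] S.inv_closed[of B] S.inv_inv[of B] assms fZ by simp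
      finally show ?thesis .
    qed
    moreover have "fst T = inv\<^bsub>SL\<^esub> (fst Z) ** B"
      using f.hom_mult[of "inv\<^bsub>ext_group\<^esub> Z" ?Y] f.hom_inv[OF Z(1)] Z assms by (simp add: T_def)
    ultimately show ?thesis by simp
  qed
  moreover have "snd (snd (snd T)) = 0"
    using l.hom_mult[of "inv\<^bsub>ext_group\<^esub> Z" ?Y] l.hom_inv[OF Z(1)] Z assms by (simp add: T_def)
  ultimately obtain \<alpha> \<beta> where T: "T = (A ** B ** C, \<alpha>, \<beta>, 0)" by (cases T) auto
  have "A ** B ** C - mat 1 = A ** (B - mat 1) ** C"
    using AC by (simp add: matrix_diff_ldistrib matrix_diff_rdistrib)
  then have nz: "det (A ** B ** C - mat 1) \<noteq> 0" using assms dC by (simp add: det_mul)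
  obtain p q where p: "p v* (A ** B ** C - mat 1) = \<alpha>" and q: "q v* (A ** B ** C - mat 1) = \<beta>"
    using vector_matrix_surj[OF nz] by metis
  have pq: "p v* (A ** B ** C) = p + \<alpha>" "q v* (A ** B ** C) = q + \<beta>"
    using p q by (auto simp: vector_matrix_mult_diff_rdistrib algebra_simps)
  \<comment> \<open>\<open>?X\<close> is \<open>(mat 1, p, q, 0)\<close> times
    \<open>(A, 0, 0, 1)\<close>. The second factor conjugates \<open>(B, 0, 0, 0)\<close> into
    \<open>(A ** B ** C, 0, 0, 0)\<close> and the first one carries the result to \<open>T\<close>.
    Since \<open>T\<close> has last entry 0, the equations for \<open>p\<close> and \<open>q\<close>
    decouple.\<close>
  let ?X = "(A, p v* A, q v* A, 1) :: ext"
  have "A ** B ** C ** A = A ** B" using AC by (simp flip: matrix_mul_assoc)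
  then have "?X \<otimes>\<^bsub>ext_group\<^esub> ?Y = T \<otimes>\<^bsub>ext_group\<^esub> ?X"
    using arg_cong[OF pq(1), of "\<lambda>x. x v* A"] arg_cong[OF pq(2), of "\<lambda>x. x v* A"]
    by (simp add: T vector_matrix_mul_assoc vector_matrix_add_left)
  then have "?X \<otimes>\<^bsub>ext_group\<^esub> ?Y = inv\<^bsub>ext_group\<^esub> Z \<otimes>\<^bsub>ext_group\<^esub> ?Y \<otimes>\<^bsub>ext_group\<^esub> ?X"
    by (simp add: T_def)
  from E.commutator_eq_inv[OF _ _ Z(1) this] show thesis
    using assms by (intro that[of "p v* A" "q v* A"]) simp
qed

text \<open>The functions \<open>a\<close>, \<open>b\<close>, \<open>c\<close> are the entries of a
  homomorphism into \<open>ext_group\<close> that covers \<open>\<rho>\<close>. All generators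
  except \<open>GenA 0\<close> receive prescribed values, and the relation is then solved for
  \<open>GenA 0\<close>. The last three conclusions make \<open>c\<close> nonzero and keep
  \<open>a\<close> from being a coboundary: if \<open>a\<close> were l v* \<rho> - l, its vanishing
  at \<open>GenB 0\<close> would force l = 0, against its value at \<open>GenA 1\<close>.\<close>

lemma surface_cocycle_exists:
  fixes \<rho> :: "surface_gen word set \<Rightarrow> real^2^2"
  defines "cls \<equiv> \<lambda>g. gen_class (surface_gens g) {surface_relator g}"
  assumes "g \<ge> 2" and \<rho>: "\<rho> \<in> hom (surface_group g) SL"
    and hyp: "det (\<rho> (cls g (GenB 0)) - mat 1) \<noteq> 0"
  obtains a b :: "surface_gen word set \<Rightarrow> real^2" and c where
    "c \<in> hom (surface_group g) real_add"
    "\<And>\<gamma> \<delta>. \<gamma> \<in> carrier (surface_group g) \<Longrightarrow> \<delta> \<in> carrier (surface_group g) \<Longrightarrow>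
       a (\<gamma> \<otimes>\<^bsub>surface_group g\<^esub> \<delta>) = a \<delta> + a \<gamma> v* \<rho> \<delta>"
    "\<And>\<gamma> \<delta>. \<gamma> \<in> carrier (surface_group g) \<Longrightarrow> \<delta> \<in> carrier (surface_group g) \<Longrightarrow>
       b (\<gamma> \<otimes>\<^bsub>surface_group g\<^esub> \<delta>) = b \<delta> + c \<gamma> *\<^sub>R a \<delta> + b \<gamma> v* \<rho> \<delta>"
    "c (cls g (GenA 0)) = 1" "a (cls g (GenB 0)) = 0" "a (cls g (GenA 1)) \<noteq> 0"
proof -
  let ?S = "surface_gens g" and ?R = "{surface_relator g}"
  interpret E: group ext_group by (rule group_ext_group)
  interpret S: group "SL :: (real^2^2) monoid" by (rule group_SL)
  define P where "P x = \<rho> (cls g x)" for x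
  define rest where "rest = concat (map commutator_word [1..<g])"
  have cw: "commutator_word i \<in> words_over ?S" if "i < g" for i
    using that by (simp add: commutator_word_def)
  have rest_over: "rest \<in> words_over ?S"
  proof -
    have "concat (map commutator_word is) \<in> words_over ?S" if "set is \<subseteq> {..<g}" for "is"
      using that by (induction "is") (auto simp: cw)
    then show ?thesis unfolding rest_def by force
  qed
  have rel: "surface_relator g = commutator_word 0 @ rest"
    using \<open>g \<ge> 2\<close> by (simp add: surface_relator_alt rest_def upt_conv_Cons[of 0 g])
  have rel_over: "surface_relator g \<in> words_over ?S"
    using rel cw[of 0] rest_over \<open>g \<ge> 2\<close> by simp
  have P: "det (P x) = 1" if "x \<in> ?S" for x
    using \<rho> word_class_closed[of "[(x, False)]" ?S ?R] that
    by (auto simp: hom_def surface_group_def P_def cls_def Pi_iff)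
  have "word_eval SL P (surface_relator g) = mat 1"
  proof -
    have "presentation_eq ?S ?R ([] @ surface_relator g @ []) ([] @ [])"
      by (rule presentation_eq.relator) (use rel_over in auto)
    then have "(surface_relator g, []) \<in> presentation_rel ?S ?R"
      by (simp add: presentation_rel_def)
    then have "word_class ?S ?R (surface_relator g) = word_class ?S ?R []"
      by (rule equiv_class_eq[OF equiv_presentation_rel])
    then show ?thesis
      using presented_group_hom_word_eval[OF group_SL \<rho>[unfolded surface_group_def] rel_over]
        presented_group_hom_word_eval[OF group_SL \<rho>[unfolded surface_group_def], of "[]"]
      by (simp add: P_def[abs_def] cls_def)
  qed
  then have Prel: "P (GenA 0) ** (P (GenB 0) ** (inv\<^bsub>SL\<^esub> P (GenA 0) ** (inv\<^bsub>SL\<^esub> P (GenB 0)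
      ** word_eval SL P rest))) = mat 1"
    unfolding rel by (simp add: commutator_word_def word_eval_Cons)
  \<comment> \<open>The entry for \<open>GenA 0\<close> is a placeholder: \<open>rest\<close> does
    not involve that generator, so \<open>Z\<close> is already the final value of the remaining
    commutators.\<close>
  define m0 :: "surface_gen \<Rightarrow> ext" where
    "m0 x = (P x, if x = GenA 1 then axis 1 1 else 0, 0, 0)" for x
  define Z where "Z = word_eval ext_group m0 rest"
  have m0: "m0 \<in> ?S \<rightarrow> carrier ext_group" using P by (auto simp: m0_def)
  have Zc: "Z \<in> carrier ext_group"
    unfolding Z_def by (rule E.word_eval_closed[OF m0 rest_over])
  have Z1: "fst Z = word_eval SL P rest"
    using hom_word_eval[OF group_ext_group group_SL ext_group_homs(1) m0 rest_over]
    by (simp add: Z_def m0_def[abs_def])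
  have Z4: "snd (snd (snd Z)) = 0"
  proof -
    have "word_eval real_add (\<lambda>x. 0) w = 0" for w :: "surface_gen word"
      by (induction w) (auto simp: word_eval_Cons)
    then show ?thesis
      using hom_word_eval[OF group_ext_group group_real_add ext_group_homs(2) m0 rest_over]
      by (simp add: Z_def m0_def[abs_def])
  qed
  have dets: "det (P (GenA 0)) = 1" "det (P (GenB 0)) = 1" "det (P (GenB 0) - mat 1) \<noteq> 0"
    using P \<open>g \<ge> 2\<close> hyp by (auto simp: P_def)
  obtain p q where pq: "(P (GenA 0), p, q, 1) \<otimes>\<^bsub>ext_group\<^esub> ((P (GenB 0), 0, 0, 0) \<otimes>\<^bsub>ext_group\<^esub>
      (inv\<^bsub>ext_group\<^esub> (P (GenA 0), p, q, 1) \<otimes>\<^bsub>ext_group\<^esub>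
      (inv\<^bsub>ext_group\<^esub> (P (GenB 0), 0, 0, 0) \<otimes>\<^bsub>ext_group\<^esub> Z))) = \<one>\<^bsub>ext_group\<^esub>"
    using ext_commutator_solvable[OF dets Zc Z4 Prel[folded Z1]] by metis
  define m where "m = m0(GenA 0 := (P (GenA 0), p, q, 1))"
  have m: "m \<in> ?S \<rightarrow> carrier ext_group" using m0 dets by (auto simp: m_def)
  have "word_eval ext_group m rest = Z"
    unfolding Z_def by (rule word_eval_cong) (auto simp: m_def rest_def commutator_word_def)
  then have "word_eval ext_group m (surface_relator g) = \<one>\<^bsub>ext_group\<^esub>"
    unfolding rel using pq by (simp add: commutator_word_def word_eval_Cons m_def m0_def)
  then obtain \<Phi> where \<Phi>: "\<Phi> \<in> hom (surface_group g) ext_group"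
    and \<Phi>w: "\<And>w. w \<in> words_over ?S \<Longrightarrow> \<Phi> (word_class ?S ?R w) = word_eval ext_group m w"
    using presented_group_hom_exists[OF group_ext_group m, of ?R]
    by (auto simp: surface_group_def)
  have \<Phi>gen: "\<Phi> (cls g x) = m x" if "x \<in> ?S" for x
    using \<Phi>w[of "[(x, False)]"] m that by (auto simp: cls_def word_eval_Cons Pi_iff simp del: ext_group_simps)
  have fst\<Phi>: "fst (\<Phi> \<gamma>) = \<rho> \<gamma>" if "\<gamma> \<in> carrier (surface_group g)" for \<gamma>
  proof -
    obtain w where w: "w \<in> words_over ?S" "\<gamma> = word_class ?S ?R w"
      using \<open>\<gamma> \<in> _\<close> by (auto simp: surface_group_def carrier_presented_group)
    have "fst (\<Phi> \<gamma>) = word_eval SL (\<lambda>x. fst (m x)) w"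
      using hom_word_eval[OF group_ext_group group_SL ext_group_homs(1) m w(1)] \<Phi>w[OF w(1)] w(2) by simp
    also have "(\<lambda>x. fst (m x)) = P" by (auto simp: m_def m0_def)
    finally show ?thesis
      using presented_group_hom_word_eval[OF group_SL \<rho>[unfolded surface_group_def] w(1)] w(2)
      by (simp add: P_def[abs_def] cls_def)
  qed
  define a b c where "a \<gamma> = fst (snd (\<Phi> \<gamma>))" and "b \<gamma> = fst (snd (snd (\<Phi> \<gamma>)))"
    and "c \<gamma> = snd (snd (snd (\<Phi> \<gamma>)))" for \<gamma>
  have \<Phi>abc: "\<Phi> \<gamma> = (\<rho> \<gamma>, a \<gamma>, b \<gamma>, c \<gamma>)" if "\<gamma> \<in> carrier (surface_group g)" for \<gamma>
    using fst\<Phi>[OF that] by (cases "\<Phi> \<gamma>") (simp add: a_def b_def c_def)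
  have mul: "(\<rho> (\<gamma> \<otimes>\<^bsub>surface_group g\<^esub> \<delta>), a (\<gamma> \<otimes>\<^bsub>surface_group g\<^esub> \<delta>), b (\<gamma> \<otimes>\<^bsub>surface_group g\<^esub> \<delta>),
      c (\<gamma> \<otimes>\<^bsub>surface_group g\<^esub> \<delta>))
      = (\<rho> \<gamma>, a \<gamma>, b \<gamma>, c \<gamma>) \<otimes>\<^bsub>ext_group\<^esub> (\<rho> \<delta>, a \<delta>, b \<delta>, c \<delta>)"
    if "\<gamma> \<in> carrier (surface_group g)" "\<delta> \<in> carrier (surface_group g)" for \<gamma> \<delta>
  proof -
    have "\<gamma> \<otimes>\<^bsub>surface_group g\<^esub> \<delta> \<in> carrier (surface_group g)"
      using that group_presented_group[of ?S ?R]
      by (simp add: surface_group_def group.subgroup_self subgroup.m_closed)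
    then show ?thesis
      using hom_mult[OF \<Phi> that] \<Phi>abc that by metis
  qed
  show thesis
  proof (rule that[of c a b])
    show "c \<in> hom (surface_group g) real_add" using mul by (auto simp: hom_def)
    show "c (cls g (GenA 0)) = 1" "a (cls g (GenB 0)) = 0" "a (cls g (GenA 1)) \<noteq> 0"
      using \<open>g \<ge> 2\<close> \<Phi>gen by (auto simp: a_def c_def m_def m0_def axis_eq_0_iff)
  next
    fix \<gamma> \<delta> assume "\<gamma> \<in> carrier (surface_group g)" "\<delta> \<in> carrier (surface_group g)"
    from mul[OF this]
    show "a (\<gamma> \<otimes>\<^bsub>surface_group g\<^esub> \<delta>) = a \<delta> + a \<gamma> v* \<rho> \<delta>"
      "b (\<gamma> \<otimes>\<^bsub>surface_group g\<^esub> \<delta>) = b \<delta> + c \<gamma> *\<^sub>R a \<delta> + b \<gamma> v* \<rho> \<delta>"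
      by simp_all
  qed
qed

section \<open>The hyperbolic plane and its visual metric\<close>

lemma norm_matrix_vector_mult_le: "norm (A *v x) \<le> norm A * norm x"
  for A :: "real^'n^'m"
proof (rule power2_le_imp_le)
  have sq: "(norm y)\<^sup>2 = (\<Sum>i\<in>UNIV. (norm (y $ i))\<^sup>2)" for y :: "('a::real_normed_vector)^'k"
    by (simp add: norm_vec_def L2_set_def sum_nonneg)
  have "(norm (A *v x))\<^sup>2 = (\<Sum>i\<in>UNIV. (A $ i \<bullet> x)\<^sup>2)"
    by (simp add: sq matrix_vector_mul_component)
  also have "\<dots> \<le> (\<Sum>i\<in>UNIV. (norm (A $ i))\<^sup>2 * (norm x)\<^sup>2)"
    by (intro sum_mono) (metis Cauchy_Schwarz_ineq2 abs_ge_zero power2_abs power_mono power_mult_distrib)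
  also have "\<dots> = (norm A * norm x)\<^sup>2"
    by (simp add: power_mult_distrib sq[of A] sum_distrib_right)
  finally show "(norm (A *v x))\<^sup>2 \<le> (norm A * norm x)\<^sup>2" .
qed simp

lemma norm_mat2_sq: "(norm (A :: real^2^2))\<^sup>2 = (A$1$1)\<^sup>2 + (A$1$2)\<^sup>2 + (A$2$1)\<^sup>2 + (A$2$2)\<^sup>2"
  by (simp add: norm_vec_def L2_set_def sum_2)

lemma norm_vec2_sq: "(norm (v :: real^2))\<^sup>2 = (v$1)\<^sup>2 + (v$2)\<^sup>2"
  by (simp add: norm_vec_def L2_set_def sum_2)

lemma norm_transpose: "norm (transpose A) = norm A" for A :: "real^'n^'m"
proof -
  have "(\<Sum>i\<in>UNIV. \<Sum>j\<in>UNIV. (A $ j $ i)\<^sup>2) = (\<Sum>i\<in>UNIV. \<Sum>j\<in>UNIV. (A $ i $ j)\<^sup>2)"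
    by (rule sum.swap)
  then show ?thesis by (simp add: norm_vec_def L2_set_def sum_nonneg transpose_def)
qed

lemma norm_matrix_mult_le: "norm (A ** B) \<le> norm A * norm B"
  for A :: "real^'n^'m" and B :: "real^'k^'n"
proof (rule power2_le_imp_le)
  have sq: "(norm y)\<^sup>2 = (\<Sum>i\<in>UNIV. (norm (y $ i))\<^sup>2)" for y :: "('a::real_normed_vector)^'l"
    by (simp add: norm_vec_def L2_set_def sum_nonneg)
  have row: "(A ** B) $ i = transpose B *v (A $ i)" for i
    by (simp add: vec_eq_iff matrix_matrix_mult_def matrix_vector_mult_def transpose_def mult.commute)
  have "(norm (A ** B))\<^sup>2 \<le> (\<Sum>i\<in>UNIV. (norm B * norm (A $ i))\<^sup>2)"
    unfolding sq[of "A ** B"] row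
    by (intro sum_mono power_mono) (use norm_matrix_vector_mult_le[of "transpose B"] in \<open>auto simp: norm_transpose\<close>)
  also have "\<dots> = (norm A * norm B)\<^sup>2"
    by (simp add: power_mult_distrib sq[of A] sum_distrib_left mult.commute)
  finally show "(norm (A ** B))\<^sup>2 \<le> (norm A * norm B)\<^sup>2" .
qed simp

lemma abs_matrix_entry_le_norm: "\<bar>A$i$j\<bar> \<le> norm A" for A :: "real^'n^'m"
  by (metis Finite_Cartesian_Product.norm_nth_le order_trans real_norm_def)

text \<open>With A = |z - w| and B = |z - cnj w| one has B^2 - A^2 = 4 Im z Im w, so the radicand in
  \<open>arcosh\<close> is a perfect square.\<close>

lemma exp_hyp_dist:
  assumes "z \<in> hyp_plane" "w \<in> hyp_plane"
  shows "exp (hyp_dist z w) = (cmod (z - w) + cmod (z - cnj w))\<^sup>2 / (4 * Im z * Im w)"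
proof -
  define A B Y where "A = cmod (z - w)" and "B = cmod (z - cnj w)" and "Y = 4 * Im z * Im w"
  have Y: "Y > 0" using assms by (simp add: Y_def hyp_plane_def)
  have AB: "B\<^sup>2 - A\<^sup>2 = Y"
    unfolding A_def B_def Y_def cmod_power2 by (simp add: power2_eq_square algebra_simps)
  define u where "u = 1 + A\<^sup>2 / (2 * Im z * Im w)"
  have u: "u = (A\<^sup>2 + B\<^sup>2) / Y"
  proof -
    have "A\<^sup>2 / (2 * Im z * Im w) = 2 * A\<^sup>2 / Y" by (simp add: Y_def)
    moreover have "A\<^sup>2 + B\<^sup>2 = 2 * A\<^sup>2 + Y" using AB by simp
    ultimately show ?thesis using Y by (simp add: u_def add_divide_distrib)
  qed
  have u1: "u \<ge> 1" using assms by (simp add: u_def hyp_plane_def)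
  have "u\<^sup>2 - 1 = ((A\<^sup>2 + B\<^sup>2)\<^sup>2 - Y\<^sup>2) / Y\<^sup>2"
    using Y by (simp add: u power_divide diff_divide_distrib)
  also have "(A\<^sup>2 + B\<^sup>2)\<^sup>2 - Y\<^sup>2 = (2 * A * B)\<^sup>2"
    unfolding AB[symmetric] by algebra
  finally have "sqrt (u\<^sup>2 - 1) = 2 * A * B / Y"
    using Y by (simp add: real_sqrt_divide A_def B_def)
  moreover have "exp (arcosh u) = u + sqrt (u\<^sup>2 - 1)"
    using u1 by (simp add: arcosh_real_def add_pos_nonneg)
  moreover have "hyp_dist z w = arcosh u" by (simp add: hyp_dist_def u_def A_def)
  ultimately have "exp (hyp_dist z w) = (A + B)\<^sup>2 / Y"
    by (simp add: u power2_sum add_divide_distrib)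
  then show ?thesis by (simp add: A_def B_def Y_def)
qed

text \<open>Closed form of exp of minus the Gromov product. The heights Im z and Im w have
  cancelled, so the expression still makes sense on the real line and the boundary values are plain
  limits.\<close>

definition gromov_exp :: "complex \<Rightarrow> complex \<Rightarrow> complex \<Rightarrow> real" where
  "gromov_exp x0 z w = 2 * Im x0 * (cmod (z - w) + cmod (z - cnj w)) /
     ((cmod (z - x0) + cmod (z - cnj x0)) * (cmod (w - x0) + cmod (w - cnj x0)))"

lemma gromov_exp_commute: "gromov_exp x0 z w = gromov_exp x0 w z"
proof -
  have "cmod (z - cnj w) = cmod (w - cnj z)"
    by (metis complex_cnj_cnj complex_cnj_diff complex_mod_cnj norm_minus_commute)
  then show ?thesis by (simp add: gromov_exp_def norm_minus_commute mult.commute)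
qed

lemma exp_gromov_product:
  assumes "x0 \<in> hyp_plane" "z \<in> hyp_plane" "w \<in> hyp_plane"
  shows "exp (- gromov_product x0 z w) = gromov_exp x0 z w"
proof -
  have half: "exp (hyp_dist p q / 2) = (cmod (p - q) + cmod (p - cnj q)) / (2 * sqrt (Im p) * sqrt (Im q))"
    if "p \<in> hyp_plane" "q \<in> hyp_plane" for p q
  proof -
    have "exp (hyp_dist p q / 2) = sqrt (exp (hyp_dist p q))"
      by (rule real_sqrt_unique[symmetric]) (simp_all add: power2_eq_square flip: exp_add)
    then show ?thesis
      using that by (simp add: exp_hyp_dist real_sqrt_divide real_sqrt_mult)
  qed
  define N M M' where "N = cmod (z - w) + cmod (z - cnj w)" and "M = cmod (z - x0) + cmod (z - cnj x0)"
    and "M' = cmod (w - x0) + cmod (w - cnj x0)"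
  have "z \<noteq> cnj x0" "w \<noteq> cnj x0" using assms by (auto simp: hyp_plane_def)
  then have M: "M > 0" "M' > 0" by (simp_all add: M_def M'_def add_nonneg_pos)
  define p q r where "p = sqrt (Im z)" and "q = sqrt (Im w)" and "r = sqrt (Im x0)"
  have im: "p > 0" "q > 0" "r > 0"
    using assms by (simp_all add: hyp_plane_def p_def q_def r_def)
  have "- gromov_product x0 z w = hyp_dist z w / 2 - hyp_dist z x0 / 2 - hyp_dist w x0 / 2"
    by (simp add: gromov_product_def field_simps)
  then have "exp (- gromov_product x0 z w)
      = exp (hyp_dist z w / 2) / exp (hyp_dist z x0 / 2) / exp (hyp_dist w x0 / 2)"
    by (simp only: exp_diff)
  also have "\<dots> = N / (2 * p * q) / (M / (2 * p * r)) / (M' / (2 * q * r))"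
    using assms by (simp add: half N_def M_def M'_def p_def q_def r_def)
  also have "\<dots> = 2 * (r * r) * N / (M * M')"
    using M im by (simp add: divide_simps)
  also have "r * r = Im x0" using assms by (simp add: r_def hyp_plane_def)
  also have "2 * Im x0 * N / (M * M') = gromov_exp x0 z w"
    by (simp add: gromov_exp_def N_def M_def M'_def)
  finally show ?thesis .
qed

section \<open>Boundary points in homogeneous coordinates and the limit of the Gromov
  product\<close>

definition det2 :: "real^2 \<Rightarrow> real^2 \<Rightarrow> real" where
  "det2 v w = v$1 * w$2 - v$2 * w$1"

fun boundary_vec :: "hyp_boundary \<Rightarrow> real^2" where
  "boundary_vec (Finite_Pt x) = vector [x, 1]"
| "boundary_vec Infinite_Pt = vector [1, 0]"

text \<open>The modulus of the determinant of v and (x0, 1). It is the norm on the plane invariant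
  under the stabiliser of x0, Euclidean for x0 = \<open>\<i>\<close>; with respect to it the visual
  metric becomes a chordal metric.\<close>

definition based_norm :: "complex \<Rightarrow> real^2 \<Rightarrow> real" where
  "based_norm x0 v = cmod (of_real (v$1) - of_real (v$2) * x0)"

text \<open>\<open>tends_to_boundary\<close> over an arbitrary filter, because the Gromov product is
  a limit along the product filter in two independent indices.\<close>

fun filter_to_boundary :: "('i \<Rightarrow> complex) \<Rightarrow> hyp_boundary \<Rightarrow> 'i filter \<Rightarrow> bool" where
  "filter_to_boundary z (Finite_Pt x) F \<longleftrightarrow> (z \<longlongrightarrow> of_real x) F"
| "filter_to_boundary z Infinite_Pt F \<longleftrightarrow> filterlim z at_infinity F"

lemma norm_ratio_at_infinity:
  fixes w p :: "'i \<Rightarrow> complex"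
  assumes "filterlim w at_infinity F" "(p \<longlongrightarrow> l) F"
  shows "((\<lambda>i. cmod (p i - w i) / cmod (w i)) \<longlongrightarrow> 1) F"
proof -
  have inv: "((\<lambda>i. inverse (cmod (w i))) \<longlongrightarrow> 0) F"
    using tendsto_compose_filtermap assms(1)
    by (intro tendsto_inverse_0_at_top filterlim_at_infinity_imp_norm_at_top)
  have "((\<lambda>i. cmod (p i) * inverse (cmod (w i))) \<longlongrightarrow> cmod l * 0) F"
    by (intro tendsto_intros assms inv)
  then have lim: "((\<lambda>i. cmod (p i) / cmod (w i)) \<longlongrightarrow> 0) F" by (simp add: divide_inverse)
  have "((\<lambda>i. cmod (p i - w i) / cmod (w i) - 1) \<longlongrightarrow> 0) F"
  proof (rule Lim_null_comparison[OF _ lim])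
    have "eventually (\<lambda>i. w i \<noteq> 0) F"
      using assms(1) by (auto simp: filterlim_at_infinity[of 0] dest!: spec[of _ 1] elim: eventually_mono)
    then show "\<forall>\<^sub>F i in F. norm (cmod (p i - w i) / cmod (w i) - 1) \<le> cmod (p i) / cmod (w i)"
    proof eventually_elim
      case (elim i)
      have "\<bar>cmod (p i - w i) - cmod (w i)\<bar> \<le> cmod (p i)"
        using norm_triangle_ineq3[of "w i - p i" "w i"] by (simp add: norm_minus_commute)
      moreover have "cmod (p i - w i) / cmod (w i) - 1 = (cmod (p i - w i) - cmod (w i)) / cmod (w i)"
        using elim by (simp add: field_simps)
      ultimately show ?case using elim by (simp add: abs_divide divide_right_mono)
    qed
  qed
  then show ?thesis using LIM_zero_iff by blast
qed

text \<open>For two finite points this is continuity. If one point is infinite, numerator and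
  denominator are divided by the modulus of the diverging variable. If both are, the quotient is
  O(1/|z| + 1/|w|), in agreement with a vanishing \<open>det2\<close>.\<close>

lemma gromov_exp_tendsto:
  assumes "x0 \<in> hyp_plane" "filter_to_boundary z x F" "filter_to_boundary w y F"
  shows "((\<lambda>i. gromov_exp x0 (z i) (w i)) \<longlongrightarrow> Im x0 * \<bar>det2 (boundary_vec x) (boundary_vec y)\<bar> /
    (based_norm x0 (boundary_vec x) * based_norm x0 (boundary_vec y))) F"
proof -
  have cx: "cmod (of_real t - cnj x0) = cmod (of_real t - x0)" for t
    by (metis complex_cnj_complex_of_real complex_cnj_diff complex_mod_cnj)
  have nz: "of_real t - x0 \<noteq> 0" for t using assms(1) by (auto simp: hyp_plane_def)
  have fi: "((\<lambda>i. gromov_exp x0 (z i) (w i)) \<longlongrightarrow> Im x0 / cmod (of_real t - x0)) F"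
    if "(z \<longlongrightarrow> of_real t) F" "filterlim w at_infinity F" for z w t
  proof -
    have wc: "filterlim (\<lambda>i. cnj (w i)) at_infinity F"
      using that(2) by (simp add: filterlim_at_infinity[of 0])
    have ev: "eventually (\<lambda>i. w i \<noteq> 0) F"
      using that(2) by (auto simp: filterlim_at_infinity[of 0] dest!: spec[of _ 1] elim: eventually_mono)
    have "((\<lambda>i. 2 * Im x0 * (cmod (z i - w i) / cmod (w i) + cmod (z i - cnj (w i)) / cmod (cnj (w i))) /
      ((cmod (z i - x0) + cmod (z i - cnj x0)) *
       (cmod (x0 - w i) / cmod (w i) + cmod (cnj x0 - w i) / cmod (w i)))) \<longlongrightarrow>
      2 * Im x0 * (1 + 1) / ((cmod (of_real t - x0) + cmod (of_real t - cnj x0)) * (1 + 1))) F"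
      using nz[of t]
      by (intro tendsto_intros norm_ratio_at_infinity[OF that(2) that(1)]
          norm_ratio_at_infinity[OF wc that(1)] norm_ratio_at_infinity[OF that(2) tendsto_const] that(1))
        (auto simp: cx)
    then have lim: "((\<lambda>i. 2 * Im x0 * (cmod (z i - w i) / cmod (w i) + cmod (z i - cnj (w i)) / cmod (cnj (w i))) /
      ((cmod (z i - x0) + cmod (z i - cnj x0)) *
       (cmod (x0 - w i) / cmod (w i) + cmod (cnj x0 - w i) / cmod (w i)))) \<longlongrightarrow>
       Im x0 / cmod (of_real t - x0)) F"
      by (simp add: cx)
    have "\<forall>\<^sub>F i in F. 2 * Im x0 * (cmod (z i - w i) / cmod (w i) + cmod (z i - cnj (w i)) / cmod (cnj (w i))) /
      ((cmod (z i - x0) + cmod (z i - cnj x0)) *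
       (cmod (x0 - w i) / cmod (w i) + cmod (cnj x0 - w i) / cmod (w i))) = gromov_exp x0 (z i) (w i)"
      using ev
    proof eventually_elim
      case (elim i)
      have "cmod (z i - w i) / cmod (w i) + cmod (z i - cnj (w i)) / cmod (cnj (w i))
          = (cmod (z i - w i) + cmod (z i - cnj (w i))) / cmod (w i)"
        "cmod (x0 - w i) / cmod (w i) + cmod (cnj x0 - w i) / cmod (w i)
          = (cmod (w i - x0) + cmod (w i - cnj x0)) / cmod (w i)"
        by (simp_all add: add_divide_distrib norm_minus_commute)
      then show ?case using elim by (simp add: gromov_exp_def)
    qed
    then show ?thesis using Lim_transform_eventually[OF lim] by simp
  qed
  show ?thesis
  proof (cases x; cases y)
    fix s t assume [simp]: "x = Finite_Pt s" "y = Finite_Pt t"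
    have "((\<lambda>i. gromov_exp x0 (z i) (w i)) \<longlongrightarrow> gromov_exp x0 (of_real s) (of_real t)) F"
      unfolding gromov_exp_def using assms(2,3) nz[of s] nz[of t]
      by (intro tendsto_intros) (auto simp: cx)
    moreover have "cmod (of_real s - of_real t) = \<bar>s - t\<bar>" by (metis norm_of_real of_real_diff)
    ultimately show ?thesis
      by (simp add: gromov_exp_def cx det2_def based_norm_def)
  next
    fix s assume [simp]: "x = Finite_Pt s" "y = Infinite_Pt"
    then show ?thesis using fi[of z s w] assms by (simp add: det2_def based_norm_def)
  next
    fix t assume [simp]: "x = Infinite_Pt" "y = Finite_Pt t"
    then show ?thesis
      using fi[of w t z] assms by (simp add: det2_def based_norm_def gromov_exp_commute[of x0 "z _"])
  next
    assume [simp]: "x = Infinite_Pt" "y = Infinite_Pt"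
    have zw: "filterlim z at_infinity F" "filterlim w at_infinity F" using assms by auto
    have inv: "((\<lambda>i. inverse (cmod (v i))) \<longlongrightarrow> 0) F" if "filterlim v at_infinity F" for v :: "_ \<Rightarrow> complex"
      using that by (intro tendsto_inverse_0_at_top filterlim_at_infinity_imp_norm_at_top)
    have "((\<lambda>i. 16 * Im x0 * (inverse (cmod (z i)) + inverse (cmod (w i)))) \<longlongrightarrow> 16 * Im x0 * (0 + 0)) F"
      by (intro tendsto_intros inv zw)
    then have lim: "((\<lambda>i. 16 * Im x0 * (inverse (cmod (z i)) + inverse (cmod (w i)))) \<longlongrightarrow> 0) F" by simp
    have big: "eventually (\<lambda>i. cmod (v i) \<ge> 2 * cmod x0 + 1) F" if "filterlim v at_infinity F" for v :: "_ \<Rightarrow> complex"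
      using that filterlim_at_infinity[of 0 v F] by (auto dest!: spec[of _ "2 * cmod x0 + 1"] simp: add_nonneg_pos)
    have "((\<lambda>i. gromov_exp x0 (z i) (w i)) \<longlongrightarrow> 0) F"
    proof (rule Lim_null_comparison[OF _ lim])
      show "\<forall>\<^sub>F i in F. norm (gromov_exp x0 (z i) (w i)) \<le> 16 * Im x0 * (inverse (cmod (z i)) + inverse (cmod (w i)))"
        using big[OF zw(1)] big[OF zw(2)]
      proof eventually_elim
        case (elim i)
        \<comment> \<open>Each factor of the denominator is at least half the modulus of its
          variable; these two halves and the two factors 2 above give the constant 16.\<close>
        have low: "cmod v / 2 \<le> cmod (v - x0) + cmod (v - cnj x0)" if "cmod v \<ge> 2 * cmod x0 + 1" for v
          using that norm_triangle_ineq2[of v x0] norm_ge_zero[of "v - cnj x0"] by linarith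
        have up: "cmod (z i - w i) + cmod (z i - cnj (w i)) \<le> 2 * (cmod (z i) + cmod (w i))"
          using norm_triangle_ineq4[of "z i" "w i"] norm_triangle_ineq4[of "z i" "cnj (w i)"] by simp
        have pos: "cmod (z i) > 0" "cmod (w i) > 0" using elim norm_ge_zero[of x0] by linarith+
        have i0: "Im x0 > 0" using assms by (simp add: hyp_plane_def)
        have "gromov_exp x0 (z i) (w i) \<le> 2 * Im x0 * (2 * (cmod (z i) + cmod (w i))) / ((cmod (z i) / 2) * (cmod (w i) / 2))"
          unfolding gromov_exp_def using up low[OF elim(1)] low[OF elim(2)] pos i0
          by (intro frac_le mult_mono mult_left_mono) auto
        also have "\<dots> = 16 * Im x0 * (inverse (cmod (z i)) + inverse (cmod (w i)))"
          using pos by (simp add: field_simps)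
        finally show ?case using i0 by (simp add: gromov_exp_def)
      qed
    qed
    then show ?thesis by (simp add: det2_def)
  qed
qed

lemma boundary_vec_nz [simp]: "boundary_vec x \<noteq> 0"
  by (cases x) (auto simp: vec_eq_iff forall_2)

lemma based_norm_pos: "x0 \<in> hyp_plane \<Longrightarrow> v \<noteq> 0 \<Longrightarrow> based_norm x0 v > 0"
  by (auto simp: based_norm_def hyp_plane_def complex_eq_iff vec_eq_iff forall_2)

lemma det2_boundary_vec: "det2 (boundary_vec x) (boundary_vec y) = 0 \<longleftrightarrow> x = y"
  by (cases x; cases y) (auto simp: det2_def)

lemma gromov_product_tendsto:
  assumes "x0 \<in> hyp_plane" "range xs \<subseteq> hyp_plane" "range ys \<subseteq> hyp_plane"
    and "tends_to_boundary xs x" "tends_to_boundary ys y"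
  defines "D \<equiv> Im x0 * \<bar>det2 (boundary_vec x) (boundary_vec y)\<bar> /
    (based_norm x0 (boundary_vec x) * based_norm x0 (boundary_vec y))"
  shows "((\<lambda>(m, n). ereal (gromov_product x0 (xs m) (ys n))) \<longlongrightarrow>
    (if x = y then \<infinity> else ereal (- ln D))) (sequentially \<times>\<^sub>F sequentially)"
proof -
  let ?F = "sequentially \<times>\<^sub>F sequentially :: (nat \<times> nat) filter"
  have "filter_to_boundary (\<lambda>p. xs (fst p)) x ?F"
    using assms(4) filterlim_compose[OF _ filterlim_fst] by (cases x) auto
  moreover have "filter_to_boundary (\<lambda>p. ys (snd p)) y ?F"
    using assms(5) filterlim_compose[OF _ filterlim_snd] by (cases y) auto
  ultimately have lim: "((\<lambda>p. gromov_exp x0 (xs (fst p)) (ys (snd p))) \<longlongrightarrow> D) ?F"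
    unfolding D_def by (rule gromov_exp_tendsto[OF assms(1)])
  have gp: "gromov_exp x0 (xs m) (ys n) = exp (- gromov_product x0 (xs m) (ys n))" for m n
    using exp_gromov_product[OF assms(1), of "xs m" "ys n"] assms(2,3) by (simp add: image_subset_iff)
  show ?thesis
  proof (cases "x = y")
    case True
    have "D = 0" using True by (simp add: D_def det2_boundary_vec)
    have "((\<lambda>p. ereal (gromov_product x0 (xs (fst p)) (ys (snd p)))) \<longlongrightarrow> \<infinity>) ?F"
      unfolding tendsto_PInfty
    proof
      fix r :: real
      have "eventually (\<lambda>p. gromov_exp x0 (xs (fst p)) (ys (snd p)) < exp (- r)) ?F"
        using order_tendstoD(2)[OF lim, of "exp (- r)"] \<open>D = 0\<close> by simp
      then show "\<forall>\<^sub>F p in ?F. ereal r < ereal (gromov_product x0 (xs (fst p)) (ys (snd p)))"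
        by eventually_elim (simp add: gp)
    qed
    then show ?thesis using True by (simp add: case_prod_unfold)
  next
    case False
    then have "D > 0"
      using assms(1) based_norm_pos[OF assms(1)]
      by (simp add: D_def det2_boundary_vec hyp_plane_def)
    then have "((\<lambda>p. - ln (gromov_exp x0 (xs (fst p)) (ys (snd p)))) \<longlongrightarrow> - ln D) ?F"
      by (intro tendsto_intros lim) simp
    then show ?thesis using False by (simp add: gp case_prod_unfold)
  qed
qed

text \<open>The product converges to the same value along all admissible pairs of sequences, so the
  set under the supremum is a singleton once every boundary point is known to be a limit of points
  of the plane.\<close>

lemma visual_dist_eq:
  assumes "x0 \<in> hyp_plane"
  shows "visual_dist x0 x y = Im x0 * \<bar>det2 (boundary_vec x) (boundary_vec y)\<bar> /
    (based_norm x0 (boundary_vec x) * based_norm x0 (boundary_vec y))" (is "_ = ?D")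
proof -
  let ?F = "sequentially \<times>\<^sub>F sequentially :: (nat \<times> nat) filter"
  let ?L = "if x = y then \<infinity> else ereal (- ln ?D)"
  have ex: "\<exists>zs. range zs \<subseteq> hyp_plane \<and> tends_to_boundary zs p" for p
  proof (cases p)
    case (Finite_Pt t)
    have "(\<lambda>n. of_real t + \<i> * of_real (inverse (real (Suc n)))) \<longlonglongrightarrow> of_real t + \<i> * of_real 0"
      by (intro tendsto_intros LIMSEQ_inverse_real_of_nat)
    then show ?thesis using Finite_Pt
      by (intro exI[of _ "\<lambda>n. of_real t + \<i> * of_real (inverse (real (Suc n)))"]) (auto simp: hyp_plane_def)
  next
    case Infinite_Pt
    have "filterlim (\<lambda>n. \<i> * of_real (real (Suc n))) at_infinity sequentially"
    proof (rule filterlim_norm_at_top_imp_at_infinity)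
      show "filterlim (\<lambda>n. norm (\<i> * of_real (real (Suc n)))) at_top sequentially"
        unfolding norm_mult norm_of_real
        by (simp del: of_nat_Suc) (rule filterlim_compose[OF filterlim_real_sequentially filterlim_Suc])
    qed
    then show ?thesis using Infinite_Pt
      by (intro exI[of _ "\<lambda>n. \<i> * of_real (real (Suc n))"]) (auto simp: hyp_plane_def)
  qed
  have "{Liminf ?F (\<lambda>(m, n). ereal (gromov_product x0 (xs m) (ys n))) | xs ys.
      range xs \<subseteq> hyp_plane \<and> range ys \<subseteq> hyp_plane \<and>
      tends_to_boundary xs x \<and> tends_to_boundary ys y} = {?L}" (is "?S = _")
  proof -
    have nb: "?F \<noteq> bot" by (simp add: prod_filter_eq_bot)
    have eq: "Liminf ?F (\<lambda>(m, n). ereal (gromov_product x0 (xs m) (ys n))) = ?L"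
      if "range xs \<subseteq> hyp_plane" "range ys \<subseteq> hyp_plane" "tends_to_boundary xs x" "tends_to_boundary ys y"
      for xs ys
      by (rule lim_imp_Liminf[OF nb gromov_product_tendsto[OF assms that]])
    then have "?S \<subseteq> {?L}" by blast
    moreover have "?L \<in> ?S"
    proof -
      obtain xs ys where "range xs \<subseteq> hyp_plane" "range ys \<subseteq> hyp_plane"
        "tends_to_boundary xs x" "tends_to_boundary ys y"
        using ex[of x] ex[of y] by metis
      with eq[OF this] show ?thesis by (intro CollectI exI[of _ xs] exI[of _ ys]) simp
    qed
    ultimately show ?thesis by blast
  qed
  then have "gromov_product_boundary x0 x y = ?L"
    unfolding gromov_product_boundary_def by simp
  moreover have "?D > 0" if "x \<noteq> y"
    using that assms based_norm_pos[OF assms] by (simp add: det2_boundary_vec hyp_plane_def)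
  ultimately show ?thesis
    by (auto simp: visual_dist_def det2_boundary_vec)
qed

section \<open>Cocompact lattices in terms of matrix norms\<close>

lemma matrix_vector_2 [simp]:
  "((A :: real^2^2) *v v) $ 1 = A$1$1 * v$1 + A$1$2 * v$2"
  "((A :: real^2^2) *v v) $ 2 = A$2$1 * v$1 + A$2$2 * v$2"
  by (simp_all add: matrix_vector_mult_def sum_2)

lemma matrix_matrix_2 [simp]:
  "((A :: real^2^2) ** B) $ 1 $ 1 = A$1$1 * B$1$1 + A$1$2 * B$2$1"
  "((A :: real^2^2) ** B) $ 1 $ 2 = A$1$1 * B$1$2 + A$1$2 * B$2$2"
  "((A :: real^2^2) ** B) $ 2 $ 1 = A$2$1 * B$1$1 + A$2$2 * B$2$1"
  "((A :: real^2^2) ** B) $ 2 $ 2 = A$2$1 * B$1$2 + A$2$2 * B$2$2"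
  by (simp_all add: matrix_matrix_mult_def sum_2)

lemma det2_mult: "det2 (A *v v) (A *v w) = det A * det2 v w"
  by (simp add: det2_def det_2 algebra_simps)

lemma moebius_denominator_nz:
  fixes A :: "real^2^2"
  assumes "det A = 1" "z \<in> hyp_plane"
  shows "of_real (A$2$1) * z + of_real (A$2$2) \<noteq> (0 :: complex)"
proof
  assume "of_real (A$2$1) * z + of_real (A$2$2) = (0 :: complex)"
  then have "A$2$1 * Im z = 0" "A$2$1 * Re z + A$2$2 = 0" by (auto simp: complex_eq_iff)
  then show False using assms by (auto simp: hyp_plane_def det_2)
qed

lemma Im_moebius:
  assumes "det A = 1" "z \<in> hyp_plane"
  shows "Im (moebius A z) = Im z / (cmod (of_real (A$2$1) * z + of_real (A$2$2)))\<^sup>2"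
proof -
  let ?q = "of_real (A$2$1) * z + of_real (A$2$2)"
  have "moebius A z = (of_real (A$1$1) * z + of_real (A$1$2)) * cnj ?q / of_real ((cmod ?q)\<^sup>2)"
    unfolding moebius_def by (subst complex_div_cnj) simp
  then have "Im (moebius A z) = Im ((of_real (A$1$1) * z + of_real (A$1$2)) * cnj ?q) / (cmod ?q)\<^sup>2"
    by (simp only: Im_divide_of_real)
  also have "Im ((of_real (A$1$1) * z + of_real (A$1$2)) * cnj ?q) = det A * Im z"
    by (simp add: det_2 algebra_simps)
  finally show ?thesis using assms by simp
qed

lemma moebius_mult:
  assumes "det B = 1" "z \<in> hyp_plane"
  shows "moebius (A ** B) z = moebius A (moebius B z)"
proof -
  let ?q = "of_real (B$2$1) * z + of_real (B$2$2) :: complex"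
  have q: "?q \<noteq> 0" by (rule moebius_denominator_nz[OF assms])
  define w where "w = moebius B z"
  have w: "w * ?q = of_real (B$1$1) * z + of_real (B$1$2)" using q by (simp add: w_def moebius_def)
  have "of_real ((A ** B)$i$1) * z + of_real ((A ** B)$i$2) = (of_real (A$i$1) * w + of_real (A$i$2)) * ?q"
    if "i = 1 \<or> i = 2" for i
    using that by (auto simp: distrib_right mult.assoc w) (simp_all add: algebra_simps)
  note eq = this[OF disjI1[OF HOL.refl]] this[OF disjI2[OF HOL.refl]]
  show ?thesis
    unfolding moebius_def[of "A ** B"] eq using q by (simp add: moebius_def[of A] flip: w_def)
qed

lemma moebius_closed: "det A = 1 \<Longrightarrow> z \<in> hyp_plane \<Longrightarrow> moebius A z \<in> hyp_plane"
  using Im_moebius[of A z] moebius_denominator_nz[of A z] by (simp add: hyp_plane_def)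

text \<open>This is the identity norm A ^ 2 = 2 cosh d(\<open>\<i>\<close>, A \<open>\<i>\<close>)
  with the height cleared. It translates compactness in the half-plane into bounded matrix norm and
  back.\<close>

lemma norm_sq_moebius_i:
  assumes "det A = 1"
  shows "(norm A)\<^sup>2 * Im (moebius A \<i>) = 1 + (cmod (moebius A \<i>))\<^sup>2"
proof -
  have i: "\<i> \<in> hyp_plane" by (simp add: hyp_plane_def)
  let ?q = "of_real (A$2$1) * \<i> + of_real (A$2$2)"
  have q: "(cmod ?q)\<^sup>2 = (A$2$1)\<^sup>2 + (A$2$2)\<^sup>2" by (simp add: cmod_power2)
  have nz: "(A$2$1)\<^sup>2 + (A$2$2)\<^sup>2 \<noteq> 0" using moebius_denominator_nz[OF assms i] by (simp flip: q)
  have p: "(cmod (moebius A \<i>))\<^sup>2 = ((A$1$1)\<^sup>2 + (A$1$2)\<^sup>2) / ((A$2$1)\<^sup>2 + (A$2$2)\<^sup>2)"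
    unfolding moebius_def norm_divide power_divide q by (simp add: cmod_power2)
  show ?thesis
    unfolding Im_moebius[OF assms i] q p norm_mat2_sq using nz by (simp add: field_simps)
qed

text \<open>The denominator q of the Moebius map cancels against the height Im x0 / |q|^2 of the
  image point, leaving only expressions linear in the entries of A.\<close>

lemma exp_hyp_dist_moebius_le:
  assumes "x0 \<in> hyp_plane"
  obtains C where "C > 0" "\<And>A. det A = 1 \<Longrightarrow> exp (hyp_dist (moebius A x0) x0) \<le> C * (norm A)\<^sup>2"
proof -
  define E where "E = (1 + cmod x0)\<^sup>2"
  have "exp (hyp_dist (moebius A x0) x0) \<le> (E / Im x0)\<^sup>2 * (norm A)\<^sup>2" if d: "det A = 1" for A
  proof -
    define q where "q = of_real (A$2$1) * x0 + of_real (A$2$2)"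
    have q: "q \<noteq> 0" using moebius_denominator_nz[OF d assms] by (simp add: q_def)
    have le: "cmod (of_real (A$i$1) * x0 + of_real (A$i$2)) \<le> norm A * (1 + cmod x0)" for i
    proof -
      have "cmod (of_real (A$i$1) * x0 + of_real (A$i$2)) \<le> \<bar>A$i$1\<bar> * cmod x0 + \<bar>A$i$2\<bar>"
        using norm_triangle_ineq[of "of_real (A$i$1) * x0" "of_real (A$i$2)"] by (simp add: norm_mult)
      also have "\<dots> \<le> norm A * cmod x0 + norm A"
        by (intro add_mono mult_right_mono abs_matrix_entry_le_norm) auto
      finally show ?thesis by (simp add: algebra_simps)
    qed
    have near: "cmod (moebius A x0 - y) * cmod q \<le> norm A * E" if "cmod y = cmod x0" for y
    proof -
      have "cmod (moebius A x0 - y) * cmod q = cmod (of_real (A$1$1) * x0 + of_real (A$1$2) - y * q)"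
        unfolding norm_mult[symmetric] moebius_def q_def[symmetric] using q
        by (simp add: left_diff_distrib)
      also have "\<dots> \<le> norm A * (1 + cmod x0) + cmod x0 * (norm A * (1 + cmod x0))"
        using le[of 1] mult_left_mono[OF le[of 2], of "cmod x0"] that norm_triangle_ineq4[of "of_real (A$1$1) * x0 + of_real (A$1$2)" "y * q"]
        by (simp add: norm_mult q_def)
      also have "\<dots> = norm A * E" by (simp add: E_def power2_eq_square algebra_simps)
      finally show ?thesis .
    qed
    have i0: "Im x0 > 0" using assms by (simp add: hyp_plane_def)
    have "exp (hyp_dist (moebius A x0) x0)
        = (cmod (moebius A x0 - x0) + cmod (moebius A x0 - cnj x0))\<^sup>2 / (4 * (Im x0 / (cmod q)\<^sup>2) * Im x0)"
      using exp_hyp_dist[OF moebius_closed[OF d assms] assms] Im_moebius[OF d assms] by (simp add: q_def)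
    also have "\<dots> = (cmod (moebius A x0 - x0) * cmod q + cmod (moebius A x0 - cnj x0) * cmod q)\<^sup>2 / (4 * (Im x0)\<^sup>2)"
      unfolding distrib_right[symmetric] power_mult_distrib using q by (simp add: power2_eq_square)
    also have "\<dots> \<le> (norm A * E + norm A * E)\<^sup>2 / (4 * (Im x0)\<^sup>2)"
      by (intro divide_right_mono power_mono add_mono near) auto
    also have "\<dots> = (E / Im x0)\<^sup>2 * (norm A)\<^sup>2"
      by (simp add: power_mult_distrib power_divide power2_eq_square)
    finally show ?thesis .
  qed
  moreover have "E / Im x0 > 0"
    using assms norm_ge_zero[of x0] unfolding E_def hyp_plane_def
    by (intro divide_pos_pos zero_less_power) (auto simp del: norm_ge_zero)
  ultimately show thesis by (intro that[of "(E / Im x0)\<^sup>2"]) auto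
qed

text \<open>\<open>norm\<close> on matrices is the Frobenius norm.\<close>

locale matrix_lattice = group G for G (structure) +
  fixes P :: "'a \<Rightarrow> real^2^2"
  assumes hom: "P \<in> hom G SL"
    and finite_bounded: "finite {\<gamma> \<in> carrier G. norm (P \<gamma>) \<le> K}"
    and contracting: "\<exists>D>0. \<forall>v r. 0 < r \<and> r \<le> 1 \<longrightarrow>
      (\<exists>\<gamma>\<in>carrier G. norm (P \<gamma> *v v) \<le> D * r * norm v \<and> norm (P \<gamma>) \<le> D / r)"

text \<open>M is the symmetric matrix with eigenvalue r on v and 1/r on the orthogonal direction; p
  and q are the coordinates of the unit vector along v.\<close>

lemma contracting_matrix:
  fixes v :: "real^2"
  assumes "0 < r" "r \<le> 1"
  obtains M :: "real^2^2" where "det M = 1" "M *v v = r *\<^sub>R v" "norm M \<le> 2 / r"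
proof (cases "v = 0")
  case True
  have "norm (mat 1 :: real^2^2) \<le> 2"
    by (rule power2_le_imp_le) (auto simp: norm_mat2_sq mat_def)
  moreover have "2 \<le> 2 / r" using assms by (simp add: field_simps)
  ultimately show thesis using True by (intro that[of "mat 1"]) auto
next
  case False
  define p q where "p = v$1 / norm v" and "q = v$2 / norm v"
  have pq: "p\<^sup>2 + q\<^sup>2 = 1"
  proof -
    have "p\<^sup>2 + q\<^sup>2 = ((v$1)\<^sup>2 + (v$2)\<^sup>2) / (norm v)\<^sup>2"
      by (simp add: p_def q_def power_divide add_divide_distrib)
    then show ?thesis using False by (simp flip: norm_vec2_sq)
  qed
  define M :: "real^2^2" where
    "M = vector [vector [r * p\<^sup>2 + q\<^sup>2 / r, (r - 1/r) * p * q], vector [(r - 1/r) * p * q, r * q\<^sup>2 + p\<^sup>2 / r]]"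
  have M: "M$1$1 = r * p\<^sup>2 + q\<^sup>2 / r" "M$1$2 = (r - 1/r) * p * q" "M$2$1 = (r - 1/r) * p * q"
    "M$2$2 = r * q\<^sup>2 + p\<^sup>2 / r" by (simp_all add: M_def)
  define s where "s = 1 / r"
  have rs: "r * s = 1" using assms by (simp add: s_def)
  have M': "M$1$1 = r * p\<^sup>2 + s * q\<^sup>2" "M$1$2 = (r - s) * p * q" "M$2$1 = (r - s) * p * q"
    "M$2$2 = r * q\<^sup>2 + s * p\<^sup>2" by (simp_all add: M s_def)
  have "det M = r * s * (p\<^sup>2 + q\<^sup>2)\<^sup>2"
    unfolding det_2 M' by algebra
  then have 1: "det M = 1" by (simp add: rs pq)
  have "M$1$1 * p + M$1$2 * q = r * p * (p\<^sup>2 + q\<^sup>2)" "M$2$1 * p + M$2$2 * q = r * q * (p\<^sup>2 + q\<^sup>2)"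
    unfolding M' by algebra+
  then have Mp: "M$1$1 * p + M$1$2 * q = r * p" "M$2$1 * p + M$2$2 * q = r * q" by (simp_all add: pq)
  have v: "v$1 = norm v * p" "v$2 = norm v * q" using False by (simp_all add: p_def q_def)
  have "(M *v v)$1 = norm v * (M$1$1 * p + M$1$2 * q)" "(M *v v)$2 = norm v * (M$2$1 * p + M$2$2 * q)"
    unfolding matrix_vector_2 v by (simp_all add: algebra_simps)
  then have 2: "M *v v = r *\<^sub>R v"
    unfolding vec_eq_iff forall_2 Mp vector_scaleR_component v by (simp add: mult.left_commute)
  have "(norm M)\<^sup>2 = (r\<^sup>2 + s\<^sup>2) * (p\<^sup>2 + q\<^sup>2)\<^sup>2"
    unfolding norm_mat2_sq M' by algebra
  also have "\<dots> \<le> (2 / r)\<^sup>2"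
  proof -
    have "r\<^sup>2 \<le> 1" "1 \<le> s\<^sup>2" using assms by (auto simp: s_def power_le_one one_le_power)
    moreover have "(2 / r)\<^sup>2 = 4 * s\<^sup>2" by (simp add: s_def power_divide)
    ultimately show ?thesis by (simp add: pq)
  qed
  finally have 3: "norm M \<le> 2 / r" by (rule power2_le_imp_le) (use assms in auto)
  show thesis by (rule that[OF 1 2 3])
qed

text \<open>Finiteness is proper discontinuity: an element of bounded norm moves \<open>\<i>\<close>
  within a fixed compact set. Contraction is cocompactness: a matrix contracting v exactly lies
  within bounded distance of the lattice, and the bounded error factor only costs a
  constant.\<close>

lemma model_rep_matrix_lattice:
  fixes G (structure)
  assumes "group G" "model_rep G \<rho>"
  shows "matrix_lattice G \<rho>"
proof -
  interpret group G by fact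
  interpret S: group "SL :: (real^2^2) monoid" by (rule group_SL)
  have hom: "\<rho> \<in> hom G SL" using assms(2) by (simp add: model_rep_def)
  interpret group_hom G SL \<rho>
    using hom by (simp add: group_hom_def group_hom_axioms_def group_SL)
  have det: "det (\<rho> \<gamma>) = 1" if "\<gamma> \<in> carrier G" for \<gamma> using hom_closed[OF that] by simp
  have i: "\<i> \<in> hyp_plane" by (simp add: hyp_plane_def)
  have "finite {\<gamma> \<in> carrier G. norm (\<rho> \<gamma>) \<le> K}" for K
  proof -
    define C where "C = max 1 K"
    \<comment> \<open>From 1 + |k|^2 = norm^2 Im k with norm at most C follow |k| at most C^2 and Im
      k at least 1/C^2; since C is at least 1, \<open>Q\<close> also contains \<open>\<i>\<close>
      itself.\<close>
    define Q where "Q = cball 0 (C\<^sup>2) \<inter> {z. Im z \<ge> 1 / C\<^sup>2}"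
    have C: "C \<ge> 1" "K \<le> C" by (auto simp: C_def)
    have "compact Q" unfolding Q_def
      by (intro compact_Int_closed compact_cball closed_halfspace_Im_ge)
    moreover have "Q \<subseteq> hyp_plane"
      using C by (auto simp: Q_def hyp_plane_def intro: less_le_trans[of 0 "1 / C\<^sup>2"])
    ultimately have fin: "finite {\<gamma>\<in>carrier G. moebius (\<rho> \<gamma>) ` Q \<inter> Q \<noteq> {}}"
      using assms(2) by (simp add: model_rep_def)
    have iQ: "\<i> \<in> Q" using C by (simp add: Q_def)
    have "moebius (\<rho> \<gamma>) \<i> \<in> Q" if "\<gamma> \<in> carrier G" "norm (\<rho> \<gamma>) \<le> K" for \<gamma>
    proof -
      let ?k = "moebius (\<rho> \<gamma>) \<i>"
      have Im: "Im ?k > 0" using moebius_closed[OF det[OF that(1)] i] by (simp add: hyp_plane_def)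
      have n: "(norm (\<rho> \<gamma>))\<^sup>2 \<le> C\<^sup>2" using that C by (intro power_mono) auto
      have "1 + (cmod ?k)\<^sup>2 \<le> C\<^sup>2 * Im ?k"
        using norm_sq_moebius_i[OF det[OF that(1)]] mult_right_mono[OF n, of "Im ?k"] Im by simp
      moreover have "C\<^sup>2 * Im ?k \<le> C\<^sup>2 * cmod ?k"
        using abs_Im_le_cmod[of ?k] by (intro mult_left_mono) auto
      moreover have "(cmod ?k)\<^sup>2 \<ge> 0" by simp
      ultimately have 1: "1 \<le> C\<^sup>2 * Im ?k" and "(cmod ?k)\<^sup>2 \<le> C\<^sup>2 * cmod ?k"
        by linarith+
      moreover have "cmod ?k > 0" using Im abs_Im_le_cmod[of ?k] by linarith
      ultimately have "cmod ?k \<le> C\<^sup>2" by (simp add: power2_eq_square[of "cmod ?k"])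
      then show ?thesis using 1 C by (simp add: Q_def field_simps)
    qed
    then have "{\<gamma> \<in> carrier G. norm (\<rho> \<gamma>) \<le> K} \<subseteq> {\<gamma>\<in>carrier G. moebius (\<rho> \<gamma>) ` Q \<inter> Q \<noteq> {}}"
      using iQ by blast
    then show ?thesis using fin finite_subset by blast
  qed
  moreover have "\<exists>D>0. \<forall>v r. 0 < r \<and> r \<le> 1 \<longrightarrow>
      (\<exists>\<gamma>\<in>carrier G. norm (\<rho> \<gamma> *v v) \<le> D * r * norm v \<and> norm (\<rho> \<gamma>) \<le> D / r)"
  proof -
    obtain K where K: "compact K" "K \<subseteq> hyp_plane" "(\<Union>\<gamma>\<in>carrier G. moebius (\<rho> \<gamma>) ` K) = hyp_plane"
      using assms(2) by (auto simp: model_rep_def)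
    have "K \<noteq> {}" using K(3) i by blast
    have "continuous_on K Im" by (intro continuous_intros)
    then obtain k0 where k0: "k0 \<in> K" "\<And>k. k \<in> K \<Longrightarrow> Im k0 \<le> Im k"
      using continuous_attains_inf[OF K(1) \<open>K \<noteq> {}\<close>] by metis
    obtain B where B: "\<And>k. k \<in> K \<Longrightarrow> cmod k \<le> B"
      using compact_imp_bounded[OF K(1)] by (auto simp: bounded_iff)
    have m: "Im k0 > 0" using k0(1) K(2) by (auto simp: hyp_plane_def)
    define D where "D = sqrt ((1 + B\<^sup>2) / Im k0)"
    have D: "D > 0" using m by (simp add: D_def add_pos_nonneg)
    have normK: "norm N \<le> D" if "det N = 1" "moebius N \<i> \<in> K" for N
    proof -
      let ?k = "moebius N \<i>"
      have "(norm N)\<^sup>2 * Im k0 \<le> (norm N)\<^sup>2 * Im ?k" by (intro mult_left_mono k0 that) auto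
      also have "\<dots> \<le> 1 + B\<^sup>2"
        using norm_sq_moebius_i[OF that(1)] power_mono[OF B[OF that(2)], of 2] by simp
      finally show ?thesis unfolding D_def using m by (intro real_le_rsqrt) (simp add: field_simps)
    qed
    have "\<exists>\<gamma>\<in>carrier G. norm (\<rho> \<gamma> *v v) \<le> (2 * D) * r * norm v \<and> norm (\<rho> \<gamma>) \<le> (2 * D) / r"
      if r: "0 < r" "r \<le> 1" for v :: "real^2" and r
    proof -
      obtain M where M: "det M = 1" "M *v v = r *\<^sub>R v" "norm M \<le> 2 / r"
        using contracting_matrix[OF r] by metis
      \<comment> \<open>A translate of \<open>moebius M' \<i>\<close> lies in the compact set K, so
        \<open>N\<close> has bounded norm; since \<open>M'\<close> inverts \<open>M\<close>, the
        lattice element equals \<open>N ** M\<close> and contracts v as \<open>M\<close>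
        does.\<close>
      define M' where "M' = inv\<^bsub>SL\<^esub> M"
      have M': "det M' = 1" "M' ** M = mat 1"
        using S.inv_closed[of M] S.l_inv[of M] M by (simp_all add: M'_def)
      have "moebius M' \<i> \<in> hyp_plane" by (rule moebius_closed[OF M'(1) i])
      then obtain \<gamma> k where g: "\<gamma> \<in> carrier G" "k \<in> K" "moebius M' \<i> = moebius (\<rho> \<gamma>) k"
        using K(3) by blast
      have g': "\<rho> (inv \<gamma>) ** \<rho> \<gamma> = mat 1" "det (\<rho> (inv \<gamma>)) = 1"
        using hom_mult[of "inv \<gamma>" \<gamma>] g det[of "inv \<gamma>"] by auto
      define N where "N = \<rho> (inv \<gamma>) ** M'"
      have "moebius N \<i> = moebius (\<rho> (inv \<gamma>)) (moebius (\<rho> \<gamma>) k)"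
        by (simp add: N_def moebius_mult[OF M'(1) i] g)
      also have "\<dots> = moebius (\<rho> (inv \<gamma>) ** \<rho> \<gamma>) k"
        using moebius_mult[OF det[OF g(1)]] g(2) K(2) by auto
      also have "\<dots> = k" unfolding g' by (simp add: moebius_def mat_def)
      finally have N: "norm N \<le> D" using normK[of N] g M' g' by (simp add: N_def det_mul)
      have eq: "\<rho> (inv \<gamma>) = N ** M" by (simp add: N_def M' flip: matrix_mul_assoc)
      have "norm (\<rho> (inv \<gamma>) *v v) \<le> norm N * norm (M *v v)"
        unfolding eq by (simp add: norm_matrix_vector_mult_le flip: matrix_vector_mul_assoc)
      also have "\<dots> \<le> (2 * D) * (r * norm v)"
        unfolding M using N D r by (intro mult_mono) auto
      finally have 1: "norm (\<rho> (inv \<gamma>) *v v) \<le> 2 * D * r * norm v" by simp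
      have "norm (\<rho> (inv \<gamma>)) \<le> D * (2 / r)"
        unfolding eq using norm_matrix_mult_le[of N M] N M(3) D r
        by (meson mult_mono norm_ge_zero order_trans less_imp_le)
      then show ?thesis using 1 g(1) by (intro bexI[of _ "inv \<gamma>"]) (auto simp: mult.commute)
    qed
    then show ?thesis using D by (intro exI[of _ "2 * D"]) auto
  qed
  ultimately show ?thesis using hom by unfold_locales auto
qed

lemma abs_det2_le: "\<bar>det2 x y\<bar> \<le> norm x * norm y"
proof (rule power2_le_imp_le)
  have "(norm x * norm y)\<^sup>2 - \<bar>det2 x y\<bar>\<^sup>2 = (x$1 * y$1 + x$2 * y$2)\<^sup>2"
    unfolding power_mult_distrib norm_vec2_sq det2_def power2_abs by algebra
  then show "\<bar>det2 x y\<bar>\<^sup>2 \<le> (norm x * norm y)\<^sup>2"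
    using zero_le_power2[of "x$1 * y$1 + x$2 * y$2"] by linarith
qed simp

lemma norm_mat2_le_columns:
  "norm (A :: real^2^2) \<le> norm (A *v axis 1 1) + norm (A *v axis 2 1)"
proof (rule power2_le_imp_le)
  have "(norm A)\<^sup>2 = (norm (A *v axis 1 1))\<^sup>2 + (norm (A *v axis 2 1))\<^sup>2"
    by (simp add: norm_mat2_sq norm_vec2_sq axis_def)
  then show "(norm A)\<^sup>2 \<le> (norm (A *v axis 1 1) + norm (A *v axis 2 1))\<^sup>2"
    by (simp add: power2_sum)
qed simp

lemma norm_mat2_le:
  assumes "\<And>x. norm ((A :: real^2^2) *v x) \<le> K * norm x"
  shows "norm A \<le> 2 * K"
  using norm_mat2_le_columns[of A] assms[of "axis 1 1"] assms[of "axis 2 1"] by simp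

lemma one_le_norm_SL2: "det A = 1 \<Longrightarrow> 1 \<le> norm (A :: real^2^2)"
proof (rule power2_le_imp_le)
  assume "det A = 1"
  moreover have "(norm A)\<^sup>2 = 2 * det A + (A$1$1 - A$2$2)\<^sup>2 + (A$1$2 + A$2$1)\<^sup>2"
    unfolding norm_mat2_sq det_2 by algebra
  ultimately show "1\<^sup>2 \<le> (norm A)\<^sup>2" by simp
qed simp

text \<open>A matrix is controlled by its effect on \<open>A v\<close> and \<open>A v\<^sup>\<bottom>\<close>.\<close>

lemma norm_mat2_quotient_le:
  fixes v :: "real^2" and A B N :: "real^2^2"
  assumes "det A = 1" "N ** A = B"
  shows "norm N * norm v \<le> 2 * (norm (B *v v) * norm A + norm B * norm (A *v v))"
proof (cases "v = 0")
  case False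
  define u :: "real^2" where "u = vector [- v$2, v$1]"
  have nu: "norm u = norm v"
    by (rule power2_eq_imp_eq) (simp_all add: norm_vec2_sq u_def add.commute)
  define p q where "p = A *v v" and "q = A *v u"
  have pq: "det2 p q = (norm v)\<^sup>2"
    by (simp add: p_def q_def det2_mult assms norm_vec2_sq) (simp add: det2_def u_def power2_eq_square)
  have Np: "N *v p = B *v v" and Nq: "N *v q = B *v u"
    by (simp_all add: p_def q_def matrix_vector_mul_assoc assms)
  define K where "K = (norm (B *v v) * norm A + norm B * norm (A *v v)) / norm v"
  have "norm (N *v x) \<le> K * norm x" for x
  proof -
    have "det2 p q *\<^sub>R x = det2 x q *\<^sub>R p + det2 p x *\<^sub>R q"
      by (simp add: vec_eq_iff forall_2 det2_def algebra_simps)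
    then have "(norm v)\<^sup>2 *\<^sub>R (N *v x) = det2 x q *\<^sub>R (B *v v) + det2 p x *\<^sub>R (B *v u)"
      unfolding pq Np[symmetric] Nq[symmetric]
      by (metis matrix_vector_mult_scaleR matrix_vector_right_distrib)
    then have "(norm v)\<^sup>2 * norm (N *v x) = norm (det2 x q *\<^sub>R (B *v v) + det2 p x *\<^sub>R (B *v u))"
      by (metis abs_of_nonneg norm_scaleR zero_le_power2)
    also have "\<dots> \<le> \<bar>det2 x q\<bar> * norm (B *v v) + \<bar>det2 p x\<bar> * norm (B *v u)"
      by (rule norm_triangle_le) simp
    also have "\<dots> \<le> (norm x * (norm A * norm v)) * norm (B *v v) + (norm p * norm x) * (norm B * norm v)"
    proof (intro add_mono mult_mono)
      show "\<bar>det2 x q\<bar> \<le> norm x * (norm A * norm v)"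
        using abs_det2_le[of x q] norm_matrix_vector_mult_le[of A u] nu
        by (metis q_def mult_left_mono norm_ge_zero order_trans)
      show "norm (B *v u) \<le> norm B * norm v" using norm_matrix_vector_mult_le[of B u] nu by simp
    qed (auto simp: abs_det2_le)
    also have "\<dots> = norm v * norm x * (norm (B *v v) * norm A + norm B * norm (A *v v))"
      by (simp add: p_def algebra_simps)
    also have "norm (B *v v) * norm A + norm B * norm (A *v v) = K * norm v"
      using False by (simp add: K_def)
    also have "norm v * norm x * (K * norm v) = (norm v)\<^sup>2 * (K * norm x)"
      by (simp add: power2_eq_square)
    finally show ?thesis using False by simp
  qed
  from norm_mat2_le[OF this] show ?thesis using False by (simp add: K_def field_simps)
qed simp

section \<open>Growth of homomorphisms to the reals and existence of equivariant sections\<close>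

context matrix_lattice
begin

lemma P_det [simp]: "\<gamma> \<in> carrier G \<Longrightarrow> det (P \<gamma>) = 1"
  using hom by (auto simp: hom_def)

lemma P_mult: "\<gamma> \<in> carrier G \<Longrightarrow> \<delta> \<in> carrier G \<Longrightarrow> P (\<gamma> \<otimes> \<delta>) = P \<gamma> ** P \<delta>"
  using hom by (simp add: hom_def)

lemma P_one: "P \<one> = mat 1"
  using hom_one[OF hom is_group group_SL] by simp

lemma one_le_norm_P: "\<gamma> \<in> carrier G \<Longrightarrow> 1 \<le> norm (P \<gamma>)"
  by (simp add: one_le_norm_SL2)

lemma contracting_const:
  obtains D where "D \<ge> 1" "\<And>v r. 0 < r \<Longrightarrow> r \<le> 1 \<Longrightarrow>
    \<exists>\<gamma>\<in>carrier G. norm (P \<gamma> *v v) \<le> D * r * norm v \<and> norm (P \<gamma>) \<le> D / r"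
proof -
  obtain D where D: "\<And>v r. 0 < r \<Longrightarrow> r \<le> 1 \<Longrightarrow>
    \<exists>\<gamma>\<in>carrier G. norm (P \<gamma> *v v) \<le> D * r * norm v \<and> norm (P \<gamma>) \<le> D / r"
    using contracting by metis
  have "\<exists>\<gamma>\<in>carrier G. norm (P \<gamma> *v v) \<le> max 1 D * r * norm v \<and> norm (P \<gamma>) \<le> max 1 D / r"
    if "0 < r" "r \<le> 1" for v r
  proof -
    have "D * r * norm v \<le> max 1 D * r * norm v" "D / r \<le> max 1 D / r"
      using that by (auto intro!: mult_right_mono divide_right_mono)
    then show ?thesis using D[OF that, of v] by force
  qed
  then show thesis by (intro that[of "max 1 D"]) auto
qed

text \<open>The columns of \<open>P \<gamma>\<close> span unit area, so when they are long they are
  almost parallel, and an element contracting the longer one contracts both. This bounded step plays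
  the part of a generator in a word-length argument.\<close>

lemma halving_element:
  obtains L where "L \<ge> 1" "\<And>\<gamma>. \<gamma> \<in> carrier G \<Longrightarrow> norm (P \<gamma>) > L \<Longrightarrow>
    \<exists>s\<in>carrier G. norm (P s) \<le> L \<and> norm (P (s \<otimes> \<gamma>)) \<le> norm (P \<gamma>) / 2"
proof -
  obtain D where D: "D \<ge> 1" "\<And>v r. 0 < r \<Longrightarrow> r \<le> 1 \<Longrightarrow>
    \<exists>\<gamma>\<in>carrier G. norm (P \<gamma> *v v) \<le> D * r * norm v \<and> norm (P \<gamma>) \<le> D / r"
    using contracting_const by metis
  define L where "L = 8 * D\<^sup>2"
  have DL: "8 * D \<le> L" using D(1) by (simp add: L_def power2_eq_square)
  have "\<exists>s\<in>carrier G. norm (P s) \<le> L \<and> norm (P (s \<otimes> \<gamma>)) \<le> norm (P \<gamma>) / 2"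
    if \<gamma>: "\<gamma> \<in> carrier G" and big: "norm (P \<gamma>) > L" for \<gamma>
  proof -
    define N where "N = norm (P \<gamma>)"
    define p q where "p = P \<gamma> *v axis 1 1" and "q = P \<gamma> *v axis 2 1"
    have Npq: "N \<le> norm p + norm q" "norm p \<le> N" "norm q \<le> N"
      using norm_mat2_le_columns[of "P \<gamma>"] norm_matrix_vector_mult_le[of "P \<gamma>"]
      by (simp_all add: N_def p_def q_def) (metis mult.right_neutral norm_axis_1)+
    have dpq: "\<bar>det2 p q\<bar> = 1" using \<gamma> by (simp add: p_def q_def det2_mult) (simp add: det2_def axis_def)
    have key: "\<exists>s\<in>carrier G. norm (P s) \<le> L \<and> norm (P s *v p) + norm (P s *v q) \<le> N / 2"
      if "norm p \<ge> N / 2" "norm q \<le> N" "norm p \<le> N" "\<bar>det2 p q\<bar> = 1" for p q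
    proof -
      \<comment> \<open>Contraction by 1/(8 D) shrinks p by the factor 8 at the price of norm at
        most 8 D^2, which is \<open>L\<close>.\<close>
      obtain s where s: "s \<in> carrier G" "norm (P s *v p) \<le> D * (1 / (8 * D)) * norm p" "norm (P s) \<le> D / (1 / (8 * D))"
        using D(2)[of "1 / (8 * D)" p] D(1) by auto
      have s1: "norm (P s *v p) \<le> norm p / 8" and s2: "norm (P s) \<le> L"
        using s D(1) by (simp_all add: L_def power2_eq_square)
      define t :: "real^2" where "t = vector [- p$2, p$1]"
      have nt: "norm t = norm p"
        by (rule power2_eq_imp_eq) (simp_all add: norm_vec2_sq t_def add.commute)
      have N0: "N > 0" using big DL D(1) unfolding N_def by linarith
      then have p0: "norm p > 0" using that by linarith
      \<comment> \<open>q is split along p and the rotated vector t; the coefficient of t is a unit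
        determinant, so that part stays bounded.\<close>
      have "(norm p)\<^sup>2 *\<^sub>R q = (p \<bullet> q) *\<^sub>R p + det2 p q *\<^sub>R t"
        unfolding norm_vec2_sq
        by (simp add: vec_eq_iff forall_2 inner_vec_def sum_2 det2_def t_def power2_eq_square algebra_simps)
      then have "(norm p)\<^sup>2 *\<^sub>R (P s *v q) = (p \<bullet> q) *\<^sub>R (P s *v p) + det2 p q *\<^sub>R (P s *v t)"
        by (metis matrix_vector_mult_scaleR matrix_vector_right_distrib)
      then have "(norm p)\<^sup>2 * norm (P s *v q) = norm ((p \<bullet> q) *\<^sub>R (P s *v p) + det2 p q *\<^sub>R (P s *v t))"
        by (metis abs_of_nonneg norm_scaleR zero_le_power2)
      also have "\<dots> \<le> \<bar>p \<bullet> q\<bar> * norm (P s *v p) + norm (P s *v t)"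
        by (rule norm_triangle_le) (simp add: that)
      also have "\<dots> \<le> (norm p * norm q) * (norm p / 8) + L * norm p"
      proof (intro add_mono mult_mono Cauchy_Schwarz_ineq2)
        show "norm (P s *v t) \<le> L * norm p"
          using norm_matrix_vector_mult_le[of "P s" t] nt mult_right_mono[OF s2, of "norm p"] by simp
      qed (use s1 in auto)
      also have "\<dots> = (norm p)\<^sup>2 * (norm q / 8 + L / norm p)"
        using p0 by (simp add: power2_eq_square field_simps)
      finally have "norm (P s *v q) \<le> norm q / 8 + L / norm p" using p0 by simp
      moreover have "L / norm p \<le> 2"
      proof -
        have "L \<le> 2 * norm p" using big that unfolding N_def by linarith
        then show ?thesis using p0 by (simp add: field_simps)
      qed
      moreover have "2 \<le> N / 4" using big DL D(1) unfolding N_def by linarith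
      ultimately have "norm (P s *v p) + norm (P s *v q) \<le> N / 2" using s1 that by linarith
      then show ?thesis using s s2 by blast
    qed
    obtain s where s: "s \<in> carrier G" "norm (P s) \<le> L" "norm (P s *v p) + norm (P s *v q) \<le> N / 2"
    proof (cases "norm p \<ge> N / 2")
      case True
      then show ?thesis using key[of p q] Npq dpq that by blast
    next
      case False
      then have "norm q \<ge> N / 2" using Npq by linarith
      moreover have "\<bar>det2 q p\<bar> = 1" using dpq by (simp add: det2_def abs_minus_commute mult.commute)
      ultimately show ?thesis using key[of q p] Npq that by (auto simp: add.commute)
    qed
    have "norm (P (s \<otimes> \<gamma>)) \<le> N / 2"
      using norm_mat2_le_columns[of "P (s \<otimes> \<gamma>)"] s \<gamma>
      by (simp add: P_mult p_def q_def flip: matrix_vector_mul_assoc)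
    then show ?thesis using s by (auto simp: N_def)
  qed
  moreover have "L \<ge> 1" using DL D(1) by linarith
  ultimately show thesis by (intro that) auto
qed

text \<open>About log2 of the norm many halving steps lead into the finite set of elements of norm
  at most L, and each step changes c by at most its maximum M there.\<close>

lemma hom_real_log_bound:
  assumes c: "c \<in> hom G real_add"
  obtains M where "M \<ge> 0" "\<And>\<gamma>. \<gamma> \<in> carrier G \<Longrightarrow> \<bar>c \<gamma>\<bar> \<le> M * (2 + log 2 (norm (P \<gamma>)))"
proof -
  obtain L where L: "L \<ge> 1" "\<And>\<gamma>. \<gamma> \<in> carrier G \<Longrightarrow> norm (P \<gamma>) > L \<Longrightarrow>
    \<exists>s\<in>carrier G. norm (P s) \<le> L \<and> norm (P (s \<otimes> \<gamma>)) \<le> norm (P \<gamma>) / 2"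
    using halving_element by metis
  define M where "M = Max (insert 0 ((\<lambda>\<gamma>. \<bar>c \<gamma>\<bar>) ` {\<gamma> \<in> carrier G. norm (P \<gamma>) \<le> L}))"
  have M: "M \<ge> 0" "\<And>\<gamma>. \<gamma> \<in> carrier G \<Longrightarrow> norm (P \<gamma>) \<le> L \<Longrightarrow> \<bar>c \<gamma>\<bar> \<le> M"
    unfolding M_def using finite_bounded[of L] by (auto intro!: Max_ge)
  have step: "\<bar>c \<gamma>\<bar> \<le> M * (real k + 1)" if "\<gamma> \<in> carrier G" "norm (P \<gamma>) \<le> L * 2 ^ k" for \<gamma> k
    using that
  proof (induction k arbitrary: \<gamma>)
    case 0
    then show ?case using M(2) by simp
  next
    case (Suc k)
    show ?case
    proof (cases "norm (P \<gamma>) > L")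
      case False
      then show ?thesis using M Suc.prems mult_left_mono[of 1 "real (Suc k) + 1" M] by force
    next
      case True
      then obtain s where s: "s \<in> carrier G" "norm (P s) \<le> L" "norm (P (s \<otimes> \<gamma>)) \<le> norm (P \<gamma>) / 2"
        using L(2) Suc.prems by blast
      then have "\<bar>c (s \<otimes> \<gamma>)\<bar> \<le> M * (real k + 1)"
        using Suc.prems by (intro Suc.IH) auto
      moreover have "c (s \<otimes> \<gamma>) = c s + c \<gamma>" using c s Suc.prems by (simp add: hom_def)
      ultimately show ?thesis using M(2)[OF s(1,2)] by (simp add: algebra_simps)
    qed
  qed
  have "\<bar>c \<gamma>\<bar> \<le> M * (2 + log 2 (norm (P \<gamma>)))" if "\<gamma> \<in> carrier G" for \<gamma>
  proof -
    let ?N = "norm (P \<gamma>)"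
    have N: "?N \<ge> 1" using that by (rule one_le_norm_P)
    define k where "k = nat \<lceil>log 2 ?N\<rceil>"
    have N0: "?N > 0" using N by linarith
    have lg: "log 2 ?N \<ge> 0" using N N0 by simp
    have k: "log 2 ?N \<le> real k" "real k \<le> log 2 ?N + 1" using lg unfolding k_def by linarith+
    have "?N = 2 powr log 2 ?N" using N0 by simp
    also have "\<dots> \<le> 2 powr real k" using k by (intro powr_mono) auto
    also have "\<dots> \<le> L * 2 ^ k" using L(1) by (simp add: powr_realpow)
    finally have "\<bar>c \<gamma>\<bar> \<le> M * (real k + 1)" by (intro step that)
    also have "\<dots> \<le> M * (2 + log 2 ?N)" using k M(1) by (intro mult_left_mono) auto
    finally show ?thesis .
  qed
  with M(1) show thesis by (rule that)
qed

text \<open>Trades the logarithm for an arbitrarily small power, the form in which growth of c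
  enters all later estimates.\<close>

lemma hom_real_powr_bound:
  assumes c: "c \<in> hom G real_add" and "\<eta> > 0"
  obtains C where "C \<ge> 0" "\<And>\<gamma>. \<gamma> \<in> carrier G \<Longrightarrow> \<bar>c \<gamma>\<bar> \<le> C * norm (P \<gamma>) powr \<eta>"
proof -
  obtain M where M: "M \<ge> 0" "\<And>\<gamma>. \<gamma> \<in> carrier G \<Longrightarrow> \<bar>c \<gamma>\<bar> \<le> M * (2 + log 2 (norm (P \<gamma>)))"
    using hom_real_log_bound[OF c] by metis
  have "\<bar>c \<gamma>\<bar> \<le> M * (2 + 1 / (\<eta> * ln 2)) * norm (P \<gamma>) powr \<eta>" if "\<gamma> \<in> carrier G" for \<gamma>
  proof -
    let ?N = "norm (P \<gamma>)"
    have N: "?N \<ge> 1" using that by (rule one_le_norm_P)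
    have p1: "1 \<le> ?N powr \<eta>" using N assms(2) by (simp add: ge_one_powr_ge_zero)
    have "\<eta> * ln ?N = ln (?N powr \<eta>)" using N by (simp add: ln_powr)
    also have "\<dots> \<le> ?N powr \<eta>" using ln_le_minus_one[OF less_le_trans[OF zero_less_one p1]] p1 by linarith
    finally have "ln ?N \<le> ?N powr \<eta> / \<eta>" using assms(2) by (simp add: field_simps)
    then have "log 2 ?N \<le> ?N powr \<eta> / \<eta> / ln 2"
      unfolding log_def by (rule divide_right_mono) simp
    then have "2 + log 2 ?N \<le> (2 + 1 / (\<eta> * ln 2)) * ?N powr \<eta>"
      using p1 by (simp add: distrib_right)
    then show ?thesis
      using M(2)[OF that] mult_left_mono[OF _ M(1)] by (metis mult.assoc order_trans)
  qed
  moreover have "M * (2 + 1 / (\<eta> * ln 2)) \<ge> 0" using M assms(2) by simp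
  ultimately show thesis using that by blast
qed

text \<open>Non-hyperbolic elements have powers of at most linear norm, while a homomorphism to the reals
  grows only logarithmically in the norm.\<close>

lemma hom_real_nonzero_hyperbolic:
  assumes c: "c \<in> hom G real_add" and \<gamma>: "\<gamma> \<in> carrier G" "c \<gamma> \<noteq> 0"
  shows "\<bar>P \<gamma> $ 1 $ 1 + P \<gamma> $ 2 $ 2\<bar> > 2"
proof (rule ccontr)
  assume tr: "\<not> \<bar>P \<gamma> $ 1 $ 1 + P \<gamma> $ 2 $ 2\<bar> > 2"
  \<comment> \<open>Iterated squaring: \<open>\<delta> k\<close> is the power of \<gamma> with
    exponent 2^k.\<close>
  define \<delta> where "\<delta> k = rec_nat \<gamma> (\<lambda>_ x. x \<otimes> x) k" for k :: nat
  have \<delta>: "\<delta> 0 = \<gamma>" "\<delta> (Suc k) = \<delta> k \<otimes> \<delta> k" for k by (simp_all add: \<delta>_def)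
  have cl: "\<delta> k \<in> carrier G" for k by (induction k) (auto simp: \<delta> \<gamma>)
  have c\<delta>: "c (\<delta> k) = 2 ^ k * c \<gamma>" for k
    using c cl by (induction k) (auto simp: \<delta> hom_def)
  have trk: "\<bar>P (\<delta> k) $ 1 $ 1 + P (\<delta> k) $ 2 $ 2\<bar> \<le> 2" for k
  proof (induction k)
    case (Suc k)
    let ?A = "P (\<delta> k)"
    have "P (\<delta> (Suc k)) $ 1 $ 1 + P (\<delta> (Suc k)) $ 2 $ 2 = (?A$1$1 + ?A$2$2)\<^sup>2 - 2 * det ?A"
      by (simp add: \<delta> P_mult cl det_2 power2_eq_square algebra_simps)
    moreover have "(?A$1$1 + ?A$2$2)\<^sup>2 \<le> 2\<^sup>2" using Suc by (metis abs_le_square_iff abs_numeral)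
    ultimately show ?case using cl[of k] zero_le_power2[of "?A$1$1 + ?A$2$2"] by (simp add: abs_le_iff)
  qed (use tr \<delta> in auto)
  have nk: "norm (P (\<delta> k)) + 2 \<le> 2 ^ k * (norm (P \<gamma>) + 2)" for k
  proof (induction k)
    case (Suc k)
    let ?A = "P (\<delta> k)" and ?I = "mat 1 :: real^2^2"
    \<comment> \<open>Cayley-Hamilton with determinant 1; with trace at most 2 in absolute value,
      squaring at most doubles the norm up to an additive constant.\<close>
    have "?A ** ?A = (?A$1$1 + ?A$2$2) *\<^sub>R ?A - det ?A *\<^sub>R ?I"
      by (simp add: vec_eq_iff forall_2 det_2 mat_def algebra_simps)
    then have "norm (?A ** ?A) = norm ((?A$1$1 + ?A$2$2) *\<^sub>R ?A - ?I)" using cl[of k] by simp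
    also have "\<dots> \<le> \<bar>?A$1$1 + ?A$2$2\<bar> * norm ?A + norm ?I"
      using norm_triangle_ineq4[of "(?A$1$1 + ?A$2$2) *\<^sub>R ?A" ?I] by simp
    also have "norm ?I \<le> 2" by (rule power2_le_imp_le) (auto simp: norm_mat2_sq mat_def)
    also have "\<bar>?A$1$1 + ?A$2$2\<bar> * norm ?A \<le> 2 * norm ?A" by (intro mult_right_mono trk) auto
    finally have "norm (P (\<delta> (Suc k))) \<le> 2 * norm ?A + 2" by (simp add: \<delta> P_mult cl)
    with Suc show ?case by simp
  qed (simp add: \<delta>)
  \<comment> \<open>Any exponent below 1 would do: c doubles at each squaring while the bound grows
    only like the square root of 2^k.\<close>
  obtain C where C: "C \<ge> 0" "\<And>\<gamma>. \<gamma> \<in> carrier G \<Longrightarrow> \<bar>c \<gamma>\<bar> \<le> C * norm (P \<gamma>) powr (1/2)"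
    using hom_real_powr_bound[OF c, of "1/2"] by auto
  define B where "B = C\<^sup>2 * (norm (P \<gamma>) + 2) / (c \<gamma>)\<^sup>2"
  have "2 ^ k \<le> B" for k :: nat
  proof -
    have "2 ^ k * \<bar>c \<gamma>\<bar> \<le> C * sqrt (norm (P (\<delta> k)))"
      using C(2)[OF cl[of k]] by (simp add: c\<delta> abs_mult powr_half_sqrt)
    also have "\<dots> \<le> C * sqrt (2 ^ k * (norm (P \<gamma>) + 2))"
      using nk[of k] C(1) by (intro mult_left_mono real_sqrt_le_mono) auto
    finally have "(2 ^ k * \<bar>c \<gamma>\<bar>)\<^sup>2 \<le> (C * sqrt (2 ^ k * (norm (P \<gamma>) + 2)))\<^sup>2"
      by (intro power_mono) auto
    then have "2 ^ k * (2 ^ k * (c \<gamma>)\<^sup>2) \<le> 2 ^ k * (C\<^sup>2 * (norm (P \<gamma>) + 2))"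
      by (simp add: power_mult_distrib power2_eq_square[of "2 ^ k"] mult_ac)
    then have "2 ^ k * (c \<gamma>)\<^sup>2 \<le> C\<^sup>2 * (norm (P \<gamma>) + 2)" by simp
    then show ?thesis using \<gamma>(2) by (simp add: B_def field_simps)
  qed
  moreover obtain k :: nat where "B < 2 ^ k" using real_arch_pow[of 2 B] by auto
  ultimately show False by (meson not_le)
qed

text \<open>Equivariance reads f v = f (P \<gamma> v) - \<beta> \<gamma> v. If \<gamma> contracts v,
  the first term is negligible, so f v must be the limit of -\<beta> \<gamma>_n v along elements
  contracting v by 2^-n. Consecutive elements differ by one of bounded norm applied to a vector of
  size O(2^-n), so the sequence has geometrically decaying increments. The cocycle is a function
  rather than a covector because for h it contains the nonlinear term c f.\<close>

lemma section_exists: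
  fixes \<beta> :: "'a \<Rightarrow> real^2 \<Rightarrow> real"
  assumes coc: "\<And>\<gamma> \<delta> v. \<gamma> \<in> carrier G \<Longrightarrow> \<delta> \<in> carrier G \<Longrightarrow> \<beta> (\<gamma> \<otimes> \<delta>) v = \<beta> \<gamma> (P \<delta> *v v) + \<beta> \<delta> v"
    and hmg: "\<And>\<gamma> k v. \<gamma> \<in> carrier G \<Longrightarrow> \<beta> \<gamma> (k *\<^sub>R v) = k * \<beta> \<gamma> v"
    and bnd: "\<And>\<gamma>. \<gamma> \<in> carrier G \<Longrightarrow> \<exists>C. \<forall>v. \<bar>\<beta> \<gamma> v\<bar> \<le> C * norm v"
  obtains f C where "C \<ge> 0" "\<And>v. \<bar>f v\<bar> \<le> C * norm v" "\<And>k v. f (k *\<^sub>R v) = k * f v"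
    "\<And>\<gamma> v. \<gamma> \<in> carrier G \<Longrightarrow> f (P \<gamma> *v v) = f v + \<beta> \<gamma> v"
proof -
  define near where "near C r v \<gamma> \<longleftrightarrow> \<gamma> \<in> carrier G \<and> norm (P \<gamma> *v v) \<le> C * r * norm v \<and> norm (P \<gamma>) \<le> C / r"
    for C r v \<gamma>
  have fb: "\<exists>B\<ge>0. \<forall>\<gamma>\<in>carrier G. norm (P \<gamma>) \<le> K \<longrightarrow> (\<forall>v. \<bar>\<beta> \<gamma> v\<bar> \<le> B * norm v)" for K
  proof -
    obtain C where C: "\<And>\<gamma> v. \<gamma> \<in> carrier G \<Longrightarrow> \<bar>\<beta> \<gamma> v\<bar> \<le> C \<gamma> * norm v" using bnd by metis
    define B where "B = Max (insert 0 (C ` {\<gamma> \<in> carrier G. norm (P \<gamma>) \<le> K}))"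
    have "B \<ge> 0" "\<And>\<gamma>. \<gamma> \<in> carrier G \<Longrightarrow> norm (P \<gamma>) \<le> K \<Longrightarrow> C \<gamma> \<le> B"
      unfolding B_def using finite_bounded[of K] by (auto intro!: Max_ge)
    then show ?thesis using C
      by (intro exI[of _ B]) (auto intro!: order_trans[OF C] mult_right_mono)
  qed
  have cmp: "\<exists>C'\<ge>0. \<forall>v r r' \<gamma> \<gamma>'. near C r v \<gamma> \<longrightarrow> near C r' v \<gamma>' \<longrightarrow> 0 < r \<longrightarrow> r \<le> 2 * r' \<longrightarrow> r' \<le> 2 * r \<longrightarrow>
      \<bar>\<beta> \<gamma>' v - \<beta> \<gamma> v\<bar> \<le> C' * r * norm v" if "C \<ge> 0" for C
  proof -
    obtain B where B: "B \<ge> 0" "\<And>\<gamma> v. \<gamma> \<in> carrier G \<Longrightarrow> norm (P \<gamma>) \<le> 8 * C\<^sup>2 \<Longrightarrow> \<bar>\<beta> \<gamma> v\<bar> \<le> B * norm v"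
      using fb[of "8 * C\<^sup>2"] by blast
    have "\<bar>\<beta> \<gamma>' v - \<beta> \<gamma> v\<bar> \<le> B * C * r * norm v"
      if n: "near C r v \<gamma>" "near C r' v \<gamma>'" and r: "0 < r" "r \<le> 2 * r'" "r' \<le> 2 * r" for v r r' \<gamma> \<gamma>'
    proof (cases "v = 0")
      case True
      then show ?thesis using n hmg[of \<gamma> 0 v] hmg[of \<gamma>' 0 v] by (simp add: near_def)
    next
      case False
      have g: "\<gamma> \<in> carrier G" "\<gamma>' \<in> carrier G" using n by (auto simp: near_def)
      \<comment> \<open>Two elements contracting the same v at comparable scales differ by an
        element of bounded norm, hence by one of finitely many, and the cocycle identity compares
        them at the short vector \<open>P \<gamma> *v v\<close>.\<close>
      define \<delta> where "\<delta> = \<gamma>' \<otimes> inv \<gamma>"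
      have \<delta>: "\<delta> \<in> carrier G" "\<gamma>' = \<delta> \<otimes> \<gamma>" using g by (auto simp: \<delta>_def m_assoc)
      have "norm (P \<delta>) * norm v \<le> 2 * (norm (P \<gamma>' *v v) * norm (P \<gamma>) + norm (P \<gamma>') * norm (P \<gamma> *v v))"
        using norm_mat2_quotient_le[OF P_det[OF g(1)], of "P \<delta>" "P \<gamma>'" v] \<delta> g by (simp add: P_mult)
      also have "\<dots> \<le> 2 * ((C * r' * norm v) * (C / r) + (C / r') * (C * r * norm v))"
        using n r \<open>C \<ge> 0\<close> by (intro mult_left_mono add_mono mult_mono) (auto simp: near_def)
      also have "\<dots> = (2 * C\<^sup>2 * (r' / r + r / r')) * norm v"
        by (simp add: power2_eq_square algebra_simps)
      also have "\<dots> \<le> (2 * C\<^sup>2 * (2 + 2)) * norm v"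
        using r by (intro mult_right_mono mult_left_mono add_mono) (auto simp: field_simps)
      finally have "norm (P \<delta>) \<le> 8 * C\<^sup>2" using False by simp
      then have "\<bar>\<beta> \<delta> (P \<gamma> *v v)\<bar> \<le> B * norm (P \<gamma> *v v)" using B(2) \<delta> by blast
      also have "\<dots> \<le> B * (C * r * norm v)" using n B(1) by (intro mult_left_mono) (auto simp: near_def)
      finally show ?thesis using coc[OF \<delta>(1) g(1), of v] \<delta>(2) by (simp add: mult.assoc)
    qed
    then show ?thesis using B(1) \<open>C \<ge> 0\<close> by (intro exI[of _ "B * C"]) auto
  qed
  obtain D where D: "D \<ge> 1" "\<And>v r. 0 < r \<Longrightarrow> r \<le> 1 \<Longrightarrow> \<exists>\<gamma>. near D r v \<gamma>"
    using contracting_const unfolding near_def by metis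
  define q :: "nat \<Rightarrow> real" where "q n = (1/2) ^ n" for n
  have q: "0 < q n" "q n \<le> 1" "q n = 2 * q (Suc n)" for n by (auto simp: q_def power_le_one)
  have qlim: "q \<longlonglongrightarrow> 0" unfolding q_def by (rule LIMSEQ_realpow_zero) auto
  have "\<exists>g. \<forall>n v. near D (q n) v (g n v)" using D(2)[OF q(1,2)] by metis
  then obtain g where g: "\<And>n v. near D (q n) v (g n v)" by blast
  have gc: "g n v \<in> carrier G" for n v using g[of n v] by (simp add: near_def)
  define x where "x v n = - \<beta> (g n v) v" for v n
  obtain C1 where C1: "C1 \<ge> 0" "\<forall>v r r' \<gamma> \<gamma>'. near D r v \<gamma> \<longrightarrow> near D r' v \<gamma>' \<longrightarrow> 0 < r \<longrightarrow> r \<le> 2 * r' \<longrightarrow> r' \<le> 2 * r \<longrightarrow>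
      \<bar>\<beta> \<gamma>' v - \<beta> \<gamma> v\<bar> \<le> C1 * r * norm v"
    using cmp[of D] D(1) by auto
  have dx: "\<bar>x v (Suc n) - x v n\<bar> \<le> C1 * norm v * (1/2) ^ n" for v n
  proof -
    have "\<bar>\<beta> (g (Suc n) v) v - \<beta> (g n v) v\<bar> \<le> C1 * q n * norm v"
      by (rule C1(2)[rule_format, OF g g]) (use q(1)[of n] q(3)[of n] in auto)
    then show ?thesis by (simp add: x_def q_def mult_ac abs_minus_commute)
  qed
  have tele: "x v n = x v 0 + (\<Sum>i<n. x v (Suc i) - x v i)" for v n
    by (simp add: sum_lessThan_telescope)
  have sgeo: "summable (\<lambda>n. C1 * norm v * (1/2) ^ n)" for v :: "real^2"
    by (intro summable_mult summable_geometric) simp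
  have sx: "summable (\<lambda>i. x v (Suc i) - x v i)" for v
    by (rule summable_comparison_test'[OF sgeo[of v], of 0]) (use dx in auto)
  define f where "f v = x v 0 + (\<Sum>i. x v (Suc i) - x v i)" for v
  have fl: "x v \<longlonglongrightarrow> f v" for v
  proof -
    have "(\<lambda>n. x v 0 + (\<Sum>i<n. x v (Suc i) - x v i)) \<longlonglongrightarrow> f v"
      unfolding f_def by (intro tendsto_intros summable_LIMSEQ sx)
    then show ?thesis unfolding tele[symmetric] .
  qed
  obtain B0 where B0: "B0 \<ge> 0" "\<And>\<gamma> v. \<gamma> \<in> carrier G \<Longrightarrow> norm (P \<gamma>) \<le> D \<Longrightarrow> \<bar>\<beta> \<gamma> v\<bar> \<le> B0 * norm v"
    using fb[of D] by blast
  have fbd: "\<bar>f v\<bar> \<le> (B0 + 2 * C1) * norm v" for v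
  proof -
    have "\<bar>x v 0\<bar> \<le> B0 * norm v" using g[of 0 v] B0(2) by (simp add: x_def near_def q_def)
    moreover have "\<bar>\<Sum>i. x v (Suc i) - x v i\<bar> \<le> (\<Sum>n. C1 * norm v * (1/2) ^ n)"
    proof -
      have "norm (\<Sum>i. x v (Suc i) - x v i) \<le> (\<Sum>n. C1 * norm v * (1/2) ^ n)"
        by (rule norm_suminf_le[OF _ sgeo]) (use dx in auto)
      then show ?thesis by simp
    qed
    moreover have "(\<Sum>n. C1 * norm v * (1/2) ^ n) = 2 * C1 * norm v"
      by (subst suminf_mult) (auto simp: suminf_geometric)
    ultimately show ?thesis unfolding f_def by (simp add: algebra_simps)
  qed
  \<comment> \<open>The limit does not depend on the contracting elements chosen, up to worse
    constants; equivariance and homogeneity both follow by inserting another choice.\<close>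
  have indep: "(\<lambda>n. \<beta> (h n) v - \<beta> (g n v) v) \<longlonglongrightarrow> 0" if "C \<ge> D" "\<And>n. near C (q n) v (h n)" for C h v
  proof -
    have nC: "near C (q n) v (g n v)" for n
    proof -
      have "D * q n * norm v \<le> C * q n * norm v" "D / q n \<le> C / q n"
        using \<open>C \<ge> D\<close> q(1)[of n] by (auto intro!: mult_right_mono divide_right_mono)
      then show ?thesis using g[of n v] by (simp add: near_def)
    qed
    have "C \<ge> 0" using that D(1) by linarith
    then obtain C' where C': "\<forall>v r r' \<gamma> \<gamma>'. near C r v \<gamma> \<longrightarrow> near C r' v \<gamma>' \<longrightarrow> 0 < r \<longrightarrow> r \<le> 2 * r' \<longrightarrow> r' \<le> 2 * r \<longrightarrow>
      \<bar>\<beta> \<gamma>' v - \<beta> \<gamma> v\<bar> \<le> C' * r * norm v"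
      using cmp[of C] by auto
    have "(\<lambda>n. C' * q n * norm v) \<longlonglongrightarrow> C' * 0 * norm v" by (intro tendsto_intros qlim)
    then have l: "(\<lambda>n. C' * q n * norm v) \<longlonglongrightarrow> 0" by simp
    show ?thesis
    proof (rule Lim_null_comparison[OF _ l])
      show "\<forall>\<^sub>F n in sequentially. norm (\<beta> (h n) v - \<beta> (g n v) v) \<le> C' * q n * norm v"
        using C'[rule_format, OF nC that(2)] q(1) by (intro always_eventually allI) (simp add: less_imp_le)
    qed
  qed
  have equiv: "f (P \<delta> *v v) = f v + \<beta> \<delta> v" if \<delta>: "\<delta> \<in> carrier G" for \<delta> v
  proof -
    let ?w = "P \<delta> *v v"
    define h where "h n = g n ?w \<otimes> \<delta>" for n
    have n1: "1 \<le> norm (P \<delta>)" using \<delta> by (rule one_le_norm_P)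
    have "near (D * norm (P \<delta>)) (q n) v (h n)" for n
    proof -
      have gn: "near D (q n) ?w (g n ?w)" by (rule g)
      have "norm (P (h n) *v v) \<le> D * q n * norm ?w"
        using gn \<delta> gc by (simp add: h_def P_mult near_def matrix_vector_mul_assoc)
      also have "\<dots> \<le> D * q n * (norm (P \<delta>) * norm v)"
        using D(1) q(1)[of n] by (intro mult_left_mono norm_matrix_vector_mult_le) auto
      finally have 1: "norm (P (h n) *v v) \<le> D * norm (P \<delta>) * q n * norm v" by (simp add: mult_ac)
      have "norm (P (h n)) \<le> norm (P (g n ?w)) * norm (P \<delta>)"
        using \<delta> gc by (simp add: h_def P_mult norm_matrix_mult_le)
      also have "\<dots> \<le> D / q n * norm (P \<delta>)" using gn by (intro mult_right_mono) (auto simp: near_def)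
      finally show ?thesis using 1 \<delta> gc by (simp add: near_def h_def)
    qed
    then have "(\<lambda>n. \<beta> (h n) v - \<beta> (g n v) v) \<longlonglongrightarrow> 0"
      by (rule indep[rotated]) (use n1 D(1) mult_left_mono[of 1 "norm (P \<delta>)" D] in auto)
    moreover have "x ?w n = x v n + \<beta> \<delta> v - (\<beta> (h n) v - \<beta> (g n v) v)" for n
      using coc[OF gc \<delta>] by (simp add: x_def h_def)
    ultimately have "x ?w \<longlonglongrightarrow> f v + \<beta> \<delta> v - 0"
      using tendsto_diff[OF tendsto_add[OF fl tendsto_const]] by presburger
    then show ?thesis using LIMSEQ_unique[OF fl] by simp
  qed
  have hom_f: "f (k *\<^sub>R v) = k * f v" for k v
  proof (cases "k = 0")
    case True
    then show ?thesis using fbd[of 0] by simp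
  next
    case False
    have "near D (q n) v (g n (k *\<^sub>R v))" for n
      using g[of n "k *\<^sub>R v"] False by (simp add: near_def matrix_vector_mult_scaleR)
    then have "(\<lambda>n. \<beta> (g n (k *\<^sub>R v)) v - \<beta> (g n v) v) \<longlonglongrightarrow> 0" by (rule indep[OF order.refl])
    then have "(\<lambda>n. k * (x v n - (\<beta> (g n (k *\<^sub>R v)) v - \<beta> (g n v) v))) \<longlonglongrightarrow> k * (f v - 0)"
      by (intro tendsto_intros fl)
    moreover have "k * (x v n - (\<beta> (g n (k *\<^sub>R v)) v - \<beta> (g n v) v)) = x (k *\<^sub>R v) n" for n
      using hmg[OF gc] by (simp add: x_def)
    ultimately have "x (k *\<^sub>R v) \<longlonglongrightarrow> k * f v" by simp
    then show ?thesis using LIMSEQ_unique[OF fl] by simp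
  qed
  show thesis by (rule that[OF _ fbd hom_f equiv]) (use B0 C1 in auto)
qed

end

section \<open>Angles between lines\<close>

text \<open>Taylor gives sin x at least x - x^3/6, and x at most 2 bounds the cubic term by 2x/3;
  the remaining third is the constant.\<close>

lemma le_3_sin:
  assumes "0 \<le> x" "x \<le> pi / 2"
  shows "x \<le> 3 * sin x"
proof -
  have "\<bar>sin x - (\<Sum>m<3. sin_coeff m * x ^ m)\<bar> \<le> inverse (fact 3) * \<bar>x\<bar> ^ 3"
    by (rule Maclaurin_sin_bound)
  then have "\<bar>sin x - x\<bar> \<le> x ^ 3 / 6"
    using assms(1) by (simp add: numeral_3_eq_3 sin_coeff_def fact_numeral)
  then have "x - x ^ 3 / 6 \<le> sin x" by linarith
  moreover have "x ^ 3 \<le> 4 * x"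
  proof -
    have "x * x \<le> 2 * 2" using assms pi_less_4 by (intro mult_mono) auto
    from mult_right_mono[OF this assms(1)] show ?thesis by (simp add: power3_eq_cube)
  qed
  ultimately show ?thesis by linarith
qed

text \<open>The Euclidean norm of the bivector of p and q, that is the square root of their Gram
  determinant, or the product of the norms with the sine of the angle.\<close>

definition wedge_norm :: "real^'n \<Rightarrow> real^'n \<Rightarrow> real" where
  "wedge_norm p q = sqrt ((norm p)\<^sup>2 * (norm q)\<^sup>2 - (p \<bullet> q)\<^sup>2)"

lemma wedge_radicand_nonneg: "0 \<le> (norm p)\<^sup>2 * (norm q)\<^sup>2 - (p \<bullet> q)\<^sup>2"
  for p q :: "real^'n"
proof -
  have "\<bar>p \<bullet> q\<bar>\<^sup>2 \<le> (norm p * norm q)\<^sup>2"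
    by (intro power_mono Cauchy_Schwarz_ineq2) auto
  then show ?thesis by (simp only: power2_abs power_mult_distrib diff_ge_0_iff_ge)
qed

lemma wedge_norm_nonneg: "0 \<le> wedge_norm p q"
  unfolding wedge_norm_def by (rule real_sqrt_ge_zero[OF wedge_radicand_nonneg])

lemma wedge_norm_le: "wedge_norm p q \<le> norm (p - q) * norm q"
proof -
  have "(norm (p - q) * norm q)\<^sup>2 - ((norm p)\<^sup>2 * (norm q)\<^sup>2 - (p \<bullet> q)\<^sup>2) = (q \<bullet> q - p \<bullet> q)\<^sup>2"
    unfolding power_mult_distrib power2_norm_eq_inner inner_diff_left inner_diff_right
    by (simp add: inner_commute[of q p] power2_eq_square algebra_simps)
  then have "(norm p)\<^sup>2 * (norm q)\<^sup>2 - (p \<bullet> q)\<^sup>2 \<le> (norm (p - q) * norm q)\<^sup>2"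
    using zero_le_power2[of "q \<bullet> q - p \<bullet> q"] by linarith
  then show ?thesis unfolding wedge_norm_def by (intro real_le_lsqrt) auto
qed

lemma wedge_norm_commute: "wedge_norm p q = wedge_norm q p"
  by (simp add: wedge_norm_def inner_commute mult.commute)

lemma norm_orthogonal_part:
  assumes "q \<noteq> 0"
  shows "norm (p - ((p \<bullet> q) / (q \<bullet> q)) *\<^sub>R q) * norm q = wedge_norm p q"
proof -
  define s where "s = (p \<bullet> q) / (q \<bullet> q)"
  define e where "e = p - s *\<^sub>R q"
  have sq: "s * (q \<bullet> q) = p \<bullet> q" using assms by (simp add: s_def)
  have "(e \<bullet> e) = p \<bullet> p - 2 * s * (p \<bullet> q) + s * (s * (q \<bullet> q))"
    by (simp add: e_def inner_diff_left inner_diff_right inner_commute[of q p] algebra_simps)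
  then have ee: "e \<bullet> e = p \<bullet> p - s * (p \<bullet> q)"
    unfolding sq by (simp add: algebra_simps)
  have "(e \<bullet> e) * (q \<bullet> q) = (p \<bullet> p) * (q \<bullet> q) - (p \<bullet> q) * (s * (q \<bullet> q))"
    unfolding ee by (simp add: algebra_simps)
  then have "(norm e)\<^sup>2 * (norm q)\<^sup>2 = (norm p)\<^sup>2 * (norm q)\<^sup>2 - (p \<bullet> q)\<^sup>2"
    unfolding sq power2_norm_eq_inner power2_eq_square[of "p \<bullet> q"] .
  then have "norm e * norm q = wedge_norm p q"
    unfolding wedge_norm_def by (metis norm_ge_zero power_mult_distrib real_sqrt_unique zero_le_mult_iff)
  then show ?thesis by (simp only: e_def s_def)
qed

text \<open>\<open>q\<^sub>j p - p\<^sub>j q\<close> only depends on the component of \<open>p\<close> orthogonal to \<open>q\<close>.\<close>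

lemma minor_le_wedge_norm: "\<bar>q$j * p$i - p$j * q$i\<bar> \<le> 2 * wedge_norm p q"
proof (cases "q = 0")
  case False
  define e where "e = p - ((p \<bullet> q) / (q \<bullet> q)) *\<^sub>R q"
  have w: "norm e * norm q = wedge_norm p q"
    unfolding e_def by (rule norm_orthogonal_part[OF False])
  have "q$j * p$i - p$j * q$i = q$j * e$i - e$j * q$i" by (simp add: e_def algebra_simps)
  also have "\<bar>\<dots>\<bar> \<le> \<bar>q$j\<bar> * \<bar>e$i\<bar> + \<bar>e$j\<bar> * \<bar>q$i\<bar>"
    using abs_triangle_ineq4[of "q$j * e$i" "e$j * q$i"] by (simp add: abs_mult)
  also have "\<dots> \<le> norm q * norm e + norm e * norm q"
    by (intro add_mono mult_mono component_le_norm_cart) auto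
  finally show ?thesis using w by (simp add: mult.commute)
qed (simp add: wedge_norm_nonneg)

text \<open>The normalised wedge norm is the sine of the angle that \<open>proj_dist\<close>
  measures, and on [0, pi/2] an angle lies between its sine and three times its sine. This replaces
  \<open>arccos\<close> by a polynomial expression.\<close>

lemma proj_dist_bounds:
  assumes "p \<noteq> 0" "q \<noteq> 0"
  shows "wedge_norm p q / (norm p * norm q) \<le> proj_dist (span {p}) (span {q})"
    and "proj_dist (span {p}) (span {q}) \<le> 3 * (wedge_norm p q / (norm p * norm q))"
    and "0 \<le> proj_dist (span {p}) (span {q})"
proof -
  define t where "t = \<bar>p \<bullet> q\<bar> / (norm p * norm q)"
  have pq: "norm p * norm q > 0" using assms by simp
  have t: "0 \<le> t" "t \<le> 1" using Cauchy_Schwarz_ineq2[of p q] pq by (auto simp: t_def)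
  have pd: "proj_dist (span {p}) (span {q}) = arccos t"
    by (simp add: t_def proj_dist_span assms)
  have "sqrt (1 - t\<^sup>2) = wedge_norm p q / (norm p * norm q)"
  proof -
    have "1 - t\<^sup>2 = ((norm p)\<^sup>2 * (norm q)\<^sup>2 - (p \<bullet> q)\<^sup>2) / (norm p * norm q)\<^sup>2"
      using assms by (simp add: t_def power_divide power_mult_distrib diff_divide_distrib)
    then show ?thesis using pq by (simp add: wedge_norm_def real_sqrt_divide)
  qed
  then have sin: "sin (arccos t) = wedge_norm p q / (norm p * norm q)"
    using t by (simp add: sin_arccos)
  have a: "0 \<le> arccos t" using t by (intro arccos_lbound) auto
  have b: "arccos t \<le> pi / 2" using t by (intro arccos_le_pi2) auto
  show "wedge_norm p q / (norm p * norm q) \<le> proj_dist (span {p}) (span {q})"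
    unfolding pd sin[symmetric] using a by (rule sin_x_le_x)
  show "proj_dist (span {p}) (span {q}) \<le> 3 * (wedge_norm p q / (norm p * norm q))"
    unfolding pd sin[symmetric] by (rule le_3_sin[OF a b])
  show "0 \<le> proj_dist (span {p}) (span {q})" unfolding pd by (rule a)
qed

lemma proj_dist_le_norm_diff:
  assumes "p \<noteq> 0" "q \<noteq> 0"
  shows "proj_dist (span {p}) (span {q}) \<le> 3 * norm (p - q) / norm p"
proof -
  have "wedge_norm p q / (norm p * norm q) \<le> norm (p - q) * norm q / (norm p * norm q)"
    by (intro divide_right_mono wedge_norm_le) auto
  also have "\<dots> = norm (p - q) / norm p" using assms by simp
  finally show ?thesis using proj_dist_bounds(2)[OF assms] by simp
qed

section \<open>Regularity of the equivariant section\<close>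

text \<open>The graph of \<open>(f, h)\<close> over \<open>\<real>\<^sup>2\<close> is invariant under the affine-type action with linear parts
  \<open>P\<close>, \<open>a\<close>, \<open>b\<close>, \<open>c\<close>; homogeneity makes it a cone over the limit curve.\<close>

locale lattice_section = matrix_lattice G P for G (structure) and P +
  fixes a b :: "'a \<Rightarrow> real^2" and c :: "'a \<Rightarrow> real" and f h :: "real^2 \<Rightarrow> real" and K :: real
  assumes c_hom: "c \<in> hom G real_add"
    and f_scale: "f (k *\<^sub>R v) = k * f v" and h_scale: "h (k *\<^sub>R v) = k * h v"
    and f_bound: "\<bar>f v\<bar> \<le> K * norm v" and h_bound: "\<bar>h v\<bar> \<le> K * norm v"
    and f_equiv: "\<gamma> \<in> carrier G \<Longrightarrow> f (P \<gamma> *v v) = f v + a \<gamma> \<bullet> v"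
    and h_equiv: "\<gamma> \<in> carrier G \<Longrightarrow> h (P \<gamma> *v v) = h v + c \<gamma> * f v + b \<gamma> \<bullet> v"
begin

lemma K_nonneg: "K \<ge> 0"
proof -
  have "0 \<le> K * norm (axis 1 1 :: real^2)" using f_bound[of "axis 1 1"] abs_ge_zero order_trans by blast
  then show ?thesis by simp
qed

lemma c_mult: "\<gamma> \<in> carrier G \<Longrightarrow> \<delta> \<in> carrier G \<Longrightarrow> c (\<gamma> \<otimes> \<delta>) = c \<gamma> + c \<delta>"
  using c_hom by (simp add: hom_def)

text \<open>Solving the equivariance for the linear term bounds the cocycle by the sizes of v and
  its image, instead of by the norm of \<gamma> times that of v. This is what makes contracting
  elements effective.\<close>

lemma a_inner_bound: "\<gamma> \<in> carrier G \<Longrightarrow> \<bar>a \<gamma> \<bullet> v\<bar> \<le> K * (norm (P \<gamma> *v v) + norm v)"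
  using f_equiv[of \<gamma> v] f_bound[of v] f_bound[of "P \<gamma> *v v"] by (simp add: distrib_left)

lemma b_inner_bound:
  assumes "\<gamma> \<in> carrier G"
  shows "\<bar>b \<gamma> \<bullet> v\<bar> \<le> K * (1 + \<bar>c \<gamma>\<bar>) * (norm (P \<gamma> *v v) + norm v)"
proof -
  have "\<bar>c \<gamma> * f v\<bar> \<le> \<bar>c \<gamma>\<bar> * (K * norm v)"
    unfolding abs_mult by (intro mult_left_mono f_bound) auto
  then have "\<bar>b \<gamma> \<bullet> v\<bar> \<le> K * norm (P \<gamma> *v v) + K * norm v + \<bar>c \<gamma>\<bar> * (K * norm v)"
    using h_equiv[OF assms, of v] h_bound[of v] h_bound[of "P \<gamma> *v v"] by linarith
  also have "\<dots> \<le> \<dots> + \<bar>c \<gamma>\<bar> * (K * norm (P \<gamma> *v v))"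
    using K_nonneg by simp
  also have "\<dots> = K * (1 + \<bar>c \<gamma>\<bar>) * (norm (P \<gamma> *v v) + norm v)" by (simp add: algebra_simps)
  finally show ?thesis .
qed

text \<open>A single \<gamma> makes v, w and v - w all of size O(r) with r the square root of the
  determinant. Equivariance then expresses the increments of f and h by boundedly many terms of that
  size, with an extra factor \<open>c \<gamma>\<close> only in h.\<close>

lemma section_difference_bound:
  obtains M where "M \<ge> 0" "\<And>v w. norm v = 1 \<Longrightarrow> norm w = 1 \<Longrightarrow> v \<bullet> w \<ge> 0 \<Longrightarrow> v \<noteq> w \<Longrightarrow>
    \<exists>\<gamma>\<in>carrier G. norm (P \<gamma>) \<le> M / sqrt \<bar>det2 v w\<bar> \<and>
      \<bar>f v - f w\<bar> \<le> M * sqrt \<bar>det2 v w\<bar> \<and> \<bar>h v - h w\<bar> \<le> M * (1 + \<bar>c \<gamma>\<bar>) * sqrt \<bar>det2 v w\<bar> \<and>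
      norm (v - w) \<le> M * sqrt \<bar>det2 v w\<bar> \<and> 0 < \<bar>det2 v w\<bar> \<and> \<bar>det2 v w\<bar> \<le> 1"
proof -
  obtain D where D: "D \<ge> 1" "\<And>v r. 0 < r \<Longrightarrow> r \<le> 1 \<Longrightarrow>
    \<exists>\<gamma>\<in>carrier G. norm (P \<gamma> *v v) \<le> D * r * norm v \<and> norm (P \<gamma>) \<le> D / r"
    using contracting_const by metis
  \<comment> \<open>Large enough for \<open>D\<close>, 2, 8 K D and 12 K D at once.\<close>
  define M where "M = 16 * (K + 1) * D"
  have M: "M \<ge> D" "M \<ge> 2" "M \<ge> 0"
  proof -
    have "1 * D \<le> 16 * (K + 1) * D" using K_nonneg D(1) by (intro mult_right_mono) auto
    moreover have "16 * 1 * 1 \<le> 16 * (K + 1) * D" using K_nonneg D(1) by (intro mult_mono) auto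
    ultimately show "M \<ge> D" "M \<ge> 2" "M \<ge> 0" unfolding M_def by linarith+
  qed
  show thesis
  proof (rule that[OF M(3)])
    fix v w :: "real^2"
    assume vw: "norm v = 1" "norm w = 1" "v \<bullet> w \<ge> 0" "v \<noteq> w"
    define d where "d = \<bar>det2 v w\<bar>"
    \<comment> \<open>The square root balances the contraction of v by r against the possible
      expansion of v - w, of size O(d), by 1/r. The Hoelder exponent 1/2 originates here.\<close>
    define r where "r = sqrt d"
    have d2: "d\<^sup>2 = 1 - (v \<bullet> w)\<^sup>2"
    proof -
      have "(det2 v w)\<^sup>2 + (v \<bullet> w)\<^sup>2 = (norm v)\<^sup>2 * (norm w)\<^sup>2"
        unfolding norm_vec2_sq by (simp add: det2_def inner_vec_def sum_2) algebra
      then show ?thesis using vw by (simp add: d_def)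
    qed
    have vw1: "v \<bullet> w \<le> 1" using Cauchy_Schwarz_ineq2[of v w] vw by simp
    have "(norm (v - w))\<^sup>2 = 2 - 2 * (v \<bullet> w)"
      using vw by (simp add: power2_norm_eq_inner inner_diff_left inner_diff_right inner_commute[of w v])
        (simp flip: power2_norm_eq_inner)
    also have "\<dots> \<le> (2 * d)\<^sup>2"
    proof -
      have "(v \<bullet> w)\<^sup>2 \<le> v \<bullet> w" using mult_left_mono[OF vw1 vw(3)] by (simp add: power2_eq_square)
      then show ?thesis using vw1 by (simp add: power_mult_distrib d2)
    qed
    finally have diff: "norm (v - w) \<le> 2 * d" by (rule power2_le_imp_le) (simp add: d_def)
    have "norm (v - w) > 0" using vw by simp
    then have d0: "d > 0" using diff by linarith
    have d1: "d \<le> 1" using abs_det2_le[of v w] vw by (simp add: d_def)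
    have r: "0 < r" "r \<le> 1" "d = r * r" using d0 d1 by (auto simp: r_def)
    obtain \<gamma> where g: "\<gamma> \<in> carrier G" "norm (P \<gamma> *v v) \<le> D * r" "norm (P \<gamma>) \<le> D / r"
      using D(2)[OF r(1,2), of v] vw by auto
    have u: "norm (P \<gamma> *v (v - w)) \<le> 2 * D * r"
    proof -
      have "norm (P \<gamma> *v (v - w)) \<le> norm (P \<gamma>) * norm (v - w)" by (rule norm_matrix_vector_mult_le)
      also have "\<dots> \<le> (D / r) * (2 * d)" using diff g r D(1) by (intro mult_mono) auto
      finally show ?thesis using r by simp
    qed
    have w: "norm (P \<gamma> *v w) \<le> 3 * D * r"
      using u g(2) norm_triangle_ineq4[of "P \<gamma> *v v" "P \<gamma> *v (v - w)"]
      by (simp add: matrix_vector_mult_diff_distrib)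
    have dr: "2 * d \<le> 2 * D * r"
    proof -
      have "r * r \<le> D * r" using r D(1) by (intro mult_right_mono) auto
      then show ?thesis using r(3) by simp
    qed
    have un: "norm (P \<gamma> *v (v - w)) + norm (v - w) \<le> 4 * D * r" using u diff dr by linarith
    have fa: "\<bar>f (P \<gamma> *v v)\<bar> \<le> K * (D * r)" "\<bar>f (P \<gamma> *v w)\<bar> \<le> K * (3 * D * r)"
      "\<bar>h (P \<gamma> *v v)\<bar> \<le> K * (D * r)" "\<bar>h (P \<gamma> *v w)\<bar> \<le> K * (3 * D * r)"
      using g w K_nonneg f_bound h_bound by (meson mult_left_mono order_trans)+
    have ab: "\<bar>a \<gamma> \<bullet> (v - w)\<bar> \<le> K * (4 * D * r)" "\<bar>b \<gamma> \<bullet> (v - w)\<bar> \<le> K * (1 + \<bar>c \<gamma>\<bar>) * (4 * D * r)"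
      using a_inner_bound[OF g(1), of "v - w"] b_inner_bound[OF g(1), of "v - w"]
        mult_left_mono[OF un, of K] mult_left_mono[OF un, of "K * (1 + \<bar>c \<gamma>\<bar>)"] K_nonneg by auto
    have f1: "\<bar>f v - f w\<bar> \<le> 8 * K * D * r"
    proof -
      have "f v - f w = f (P \<gamma> *v v) - f (P \<gamma> *v w) - a \<gamma> \<bullet> (v - w)"
        using f_equiv[OF g(1)] by (simp add: inner_diff_right)
      then show ?thesis using fa ab by (simp add: abs_le_iff)
    qed
    have h1: "\<bar>h v - h w\<bar> \<le> 12 * K * D * r * (1 + \<bar>c \<gamma>\<bar>)"
    proof -
      have tri: "\<bar>x - y - z - u\<bar> \<le> \<bar>x\<bar> + \<bar>y\<bar> + \<bar>z\<bar> + \<bar>u\<bar>" for x y z u :: real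
        by linarith
      have eq: "h v - h w = h (P \<gamma> *v v) - h (P \<gamma> *v w) - c \<gamma> * (f v - f w) - b \<gamma> \<bullet> (v - w)"
        using h_equiv[OF g(1)] by (simp add: inner_diff_right algebra_simps)
      have "\<bar>c \<gamma> * (f v - f w)\<bar> \<le> \<bar>c \<gamma>\<bar> * (8 * K * D * r)"
        unfolding abs_mult by (intro mult_left_mono f1) auto
      then have "\<bar>h v - h w\<bar> \<le> K * (D * r) + K * (3 * D * r) + \<bar>c \<gamma>\<bar> * (8 * K * D * r) + K * (1 + \<bar>c \<gamma>\<bar>) * (4 * D * r)"
        unfolding eq by (intro order_trans[OF tri] add_mono fa ab)
      also have "\<dots> \<le> \<dots> + 4 * K * D * r" using K_nonneg D(1) r by simp
      also have "\<dots> = 12 * K * D * r * (1 + \<bar>c \<gamma>\<bar>)" by (simp add: algebra_simps)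
      finally show ?thesis .
    qed
    have KM: "8 * K * D \<le> M" "12 * K * D \<le> M"
      using K_nonneg D(1) by (auto simp: M_def algebra_simps)
    have "norm (P \<gamma>) \<le> M / r" using g M r by (meson divide_right_mono less_imp_le order_trans)
    moreover have "\<bar>f v - f w\<bar> \<le> M * r" using f1 mult_right_mono[OF KM(1), of r] r by linarith
    moreover have "\<bar>h v - h w\<bar> \<le> M * (1 + \<bar>c \<gamma>\<bar>) * r"
    proof -
      have "12 * K * D * (r * (1 + \<bar>c \<gamma>\<bar>)) \<le> M * (r * (1 + \<bar>c \<gamma>\<bar>))"
        using KM(2) r by (intro mult_right_mono) auto
      then show ?thesis using h1 by (simp add: mult_ac)
    qed
    moreover have "norm (v - w) \<le> M * r"
    proof -
      have "2 * d \<le> 2 * r" using r mult_left_mono[of r 1 r] by simp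
      also have "\<dots> \<le> M * r" using M(2) r by (intro mult_right_mono) auto
      finally show ?thesis using diff by linarith
    qed
    ultimately show "\<exists>\<gamma>\<in>carrier G. norm (P \<gamma>) \<le> M / sqrt \<bar>det2 v w\<bar> \<and>
      \<bar>f v - f w\<bar> \<le> M * sqrt \<bar>det2 v w\<bar> \<and> \<bar>h v - h w\<bar> \<le> M * (1 + \<bar>c \<gamma>\<bar>) * sqrt \<bar>det2 v w\<bar> \<and>
      norm (v - w) \<le> M * sqrt \<bar>det2 v w\<bar> \<and> 0 < \<bar>det2 v w\<bar> \<and> \<bar>det2 v w\<bar> \<le> 1"
      using g(1) d0 d1 by (intro bexI[of _ \<gamma>]) (auto simp: r_def d_def)
  qed
qed

text \<open>With \<eta> = 1 - 2 \<alpha> the factor c is absorbed into r^-\<eta>, since the norm of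
  the renormalising element is O(1/r), and r^(1 - \<eta>) is the \<alpha>-th power of the
  determinant.\<close>

lemma section_Hoelder:
  assumes \<alpha>: "0 < \<alpha>" "\<alpha> < 1 / 2"
  obtains B where "B \<ge> 0" "\<And>v w. norm v = 1 \<Longrightarrow> norm w = 1 \<Longrightarrow> v \<bullet> w \<ge> 0 \<Longrightarrow>
    norm (v - w) + \<bar>f v - f w\<bar> + \<bar>h v - h w\<bar> \<le> B * \<bar>det2 v w\<bar> powr \<alpha>"
proof -
  define \<eta> where "\<eta> = 1 - 2 * \<alpha>"
  have \<eta>: "\<eta> > 0" using \<alpha> by (simp add: \<eta>_def)
  obtain M where M: "M \<ge> 0" "\<And>v w. norm v = 1 \<Longrightarrow> norm w = 1 \<Longrightarrow> v \<bullet> w \<ge> 0 \<Longrightarrow> v \<noteq> w \<Longrightarrow>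
    \<exists>\<gamma>\<in>carrier G. norm (P \<gamma>) \<le> M / sqrt \<bar>det2 v w\<bar> \<and>
      \<bar>f v - f w\<bar> \<le> M * sqrt \<bar>det2 v w\<bar> \<and> \<bar>h v - h w\<bar> \<le> M * (1 + \<bar>c \<gamma>\<bar>) * sqrt \<bar>det2 v w\<bar> \<and>
      norm (v - w) \<le> M * sqrt \<bar>det2 v w\<bar> \<and> 0 < \<bar>det2 v w\<bar> \<and> \<bar>det2 v w\<bar> \<le> 1"
    using section_difference_bound by metis
  obtain C where C: "C \<ge> 0" "\<And>\<gamma>. \<gamma> \<in> carrier G \<Longrightarrow> \<bar>c \<gamma>\<bar> \<le> C * norm (P \<gamma>) powr \<eta>"
    using hom_real_powr_bound[OF c_hom \<eta>] by metis
  define B where "B = 3 * M + M * C * M powr \<eta>"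
  have B: "B \<ge> 0" using M C by (simp add: B_def)
  have "norm (v - w) + \<bar>f v - f w\<bar> + \<bar>h v - h w\<bar> \<le> B * \<bar>det2 v w\<bar> powr \<alpha>"
    if vw: "norm v = 1" "norm w = 1" "v \<bullet> w \<ge> 0" for v w
  proof (cases "v = w")
    case True
    then show ?thesis using B by simp
  next
    case False
    define d r where "d = \<bar>det2 v w\<bar>" and "r = sqrt d"
    obtain \<gamma> where g: "\<gamma> \<in> carrier G" "norm (P \<gamma>) \<le> M / r" "\<bar>f v - f w\<bar> \<le> M * r"
      "\<bar>h v - h w\<bar> \<le> M * (1 + \<bar>c \<gamma>\<bar>) * r" "norm (v - w) \<le> M * r" "0 < d" "d \<le> 1"
      using M(2)[OF vw False] unfolding d_def r_def by blast
    have r: "0 < r" "r \<le> 1" using g by (auto simp: r_def)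
    have rd: "r powr (1 - \<eta>) = d powr \<alpha>"
      using g(6) by (simp add: r_def \<eta>_def powr_powr flip: powr_half_sqrt)
    have rr: "r \<le> r powr (1 - \<eta>)"
      using powr_mono'[of "1 - \<eta>" 1 r] r \<eta> by simp
    have "\<bar>c \<gamma>\<bar> \<le> C * (M / r) powr \<eta>"
      using C g r by (meson mult_left_mono norm_ge_zero order_trans powr_mono2 \<eta> less_imp_le)
    also have "\<dots> = C * M powr \<eta> * r powr (- \<eta>)"
      using M(1) r by (simp add: powr_divide powr_minus_divide)
    finally have "\<bar>c \<gamma>\<bar> * r \<le> C * M powr \<eta> * r powr (- \<eta>) * r"
      using r by (intro mult_right_mono) auto
    also have "\<dots> = C * M powr \<eta> * r powr (1 - \<eta>)"
      using r powr_add[of r "- \<eta>" 1] by simp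
    finally have cr: "M * (\<bar>c \<gamma>\<bar> * r) \<le> M * (C * M powr \<eta> * r powr (1 - \<eta>))"
      using M(1) by (rule mult_left_mono)
    have "norm (v - w) + \<bar>f v - f w\<bar> + \<bar>h v - h w\<bar> \<le> 3 * M * r + M * (\<bar>c \<gamma>\<bar> * r)"
      using g by (simp add: algebra_simps)
    also have "\<dots> \<le> 3 * M * r powr (1 - \<eta>) + M * (C * M powr \<eta> * r powr (1 - \<eta>))"
      using rr M(1) by (intro add_mono cr mult_left_mono) auto
    also have "\<dots> = B * d powr \<alpha>" by (simp add: B_def rd algebra_simps)
    finally show ?thesis by (simp add: d_def)
  qed
  with B show thesis by (rule that)
qed

end

section \<open>Singular values\<close>

lemma quadratic_nonpos_imp_linear_zero:
  fixes A B :: real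
  assumes "\<And>t. 2 * t * A + t\<^sup>2 * B \<le> 0"
  shows "A = 0"
proof (rule ccontr)
  assume A: "A \<noteq> 0"
  define t where "t = A / (\<bar>B\<bar> + 1)"
  have t: "t * (\<bar>B\<bar> + 1) = A" by (simp add: t_def)
  have "t \<noteq> 0" using A t by auto
  then have t2: "t\<^sup>2 > 0" by simp
  have "2 * t * A + t\<^sup>2 * B = t\<^sup>2 * (2 * (\<bar>B\<bar> + 1) + B)"
    unfolding t[symmetric] by (simp add: power2_eq_square algebra_simps)
  also have "\<dots> > 0" using t2 by (intro mult_pos_pos) auto
  finally show False using assms[of t] by linarith
qed

text \<open>A maximiser of the Rayleigh quotient on an invariant subspace is an eigenvector.\<close>

lemma symmetric_eigenvector_in_subspace:
  fixes S :: "real^'n^'n"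
  assumes sym: "transpose S = S" and W: "subspace W" "\<And>x. x \<in> W \<Longrightarrow> S *v x \<in> W"
    and ne: "W \<noteq> {0}"
  obtains x \<mu> where "x \<in> W" "norm x = 1" "S *v x = \<mu> *\<^sub>R x"
proof -
  have symi: "y \<bullet> (S *v x) = x \<bullet> (S *v y)" for x y
    using sym by (metis dot_lmul_matrix inner_commute vector_transpose_matrix)
  let ?U = "W \<inter> sphere 0 1"
  obtain w where "w \<in> W" "w \<noteq> 0" using ne subspace_0[OF W(1)] by blast
  then have "w /\<^sub>R norm w \<in> ?U" by (simp add: subspace_scale W)
  then have "?U \<noteq> {}" by blast
  moreover have "compact ?U"
    using closed_subspace[OF W(1)] by (simp add: closed_Int_compact)
  moreover have "continuous_on ?U (\<lambda>x. x \<bullet> (S *v x))" by (intro continuous_intros linear_continuous_on) auto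
  ultimately obtain x where x: "x \<in> ?U" "\<forall>y\<in>?U. y \<bullet> (S *v y) \<le> x \<bullet> (S *v x)"
    using continuous_attains_sup[of ?U "\<lambda>x. x \<bullet> (S *v x)"] by blast
  define \<mu> where "\<mu> = x \<bullet> (S *v x)"
  have nx: "x \<bullet> x = 1" "x \<in> W" using x(1) by (auto simp: dot_square_norm)
  have ray: "y \<bullet> (S *v y) \<le> \<mu> * (y \<bullet> y)" if "y \<in> W" for y
  proof (cases "y = 0")
    case False
    have "y /\<^sub>R norm y \<in> ?U" using that False by (simp add: subspace_scale W)
    from bspec[OF x(2) this] have "(y \<bullet> (S *v y)) / (norm y * norm y) \<le> \<mu>"
      by (simp add: \<mu>_def matrix_vector_mult_scaleR divide_inverse mult_ac)
    then show ?thesis using False by (simp add: dot_square_norm power2_eq_square field_simps)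
  qed simp
  define z where "z = S *v x - \<mu> *\<^sub>R x"
  have zW: "z \<in> W" unfolding z_def using nx W by (intro subspace_diff subspace_scale) auto
  have "y \<bullet> z = 0" if "y \<in> W" for y
  proof (rule quadratic_nonpos_imp_linear_zero)
    fix t
    have "x + t *\<^sub>R y \<in> W" using nx that W by (intro subspace_add subspace_scale) auto
    note le = ray[OF this]
    have e1: "(x + t *\<^sub>R y) \<bullet> (S *v (x + t *\<^sub>R y)) = \<mu> + 2 * t * (y \<bullet> (S *v x)) + t\<^sup>2 * (y \<bullet> (S *v y))"
      using symi[of x y] by (simp add: matrix_vector_right_distrib matrix_vector_mult_scaleR inner_add_left
        inner_add_right \<mu>_def power2_eq_square algebra_simps)
    have e2: "(x + t *\<^sub>R y) \<bullet> (x + t *\<^sub>R y) = 1 + 2 * t * (y \<bullet> x) + t\<^sup>2 * (y \<bullet> y)"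
      using nx(1) inner_commute[of x y]
      by (simp add: inner_add_left inner_add_right power2_eq_square algebra_simps)
    show "2 * t * (y \<bullet> z) + t\<^sup>2 * (y \<bullet> (S *v y) - \<mu> * (y \<bullet> y)) \<le> 0"
      using le[unfolded e1 e2] by (simp add: z_def inner_diff_right algebra_simps)
  qed
  from this[OF zW] have "S *v x = \<mu> *\<^sub>R x" by (simp add: z_def)
  then show thesis using that nx x(1) by auto
qed

text \<open>The orthogonal complement of a set of eigenvectors is invariant under S and, while there
  are fewer than the dimension, nonzero; so another unit eigenvector can be added.\<close>

lemma symmetric_orthonormal_eigenvectors:
  fixes S :: "real^'n^'n"
  assumes sym: "transpose S = S" and "k \<le> CARD('n)"
  shows "\<exists>B. finite B \<and> card B = k \<and> pairwise orthogonal B \<and> (\<forall>u\<in>B. norm u = 1 \<and> (\<exists>\<mu>. S *v u = \<mu> *\<^sub>R u))"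
  using assms(2)
proof (induction k)
  case 0
  show ?case by (intro exI[of _ "{}"]) auto
next
  case (Suc k)
  then obtain B where B: "finite B" "card B = k" "pairwise orthogonal B"
    "\<And>u. u \<in> B \<Longrightarrow> norm u = 1 \<and> (\<exists>\<mu>. S *v u = \<mu> *\<^sub>R u)" by auto
  define W where "W = {x. \<forall>u\<in>B. orthogonal u x}"
  have W: "subspace W" unfolding W_def by (rule subspace_orthogonal_to_vectors)
  have symi: "y \<bullet> (S *v x) = x \<bullet> (S *v y)" for x y
    using sym by (metis dot_lmul_matrix inner_commute vector_transpose_matrix)
  have inv: "S *v x \<in> W" if "x \<in> W" for x
  proof -
    have "u \<bullet> (S *v x) = 0" if u: "u \<in> B" for u
    proof -
      obtain \<mu> where "S *v u = \<mu> *\<^sub>R u" using B(4)[OF u] by blast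
      then have "u \<bullet> (S *v x) = \<mu> * (u \<bullet> x)" by (simp add: symi[of u x] inner_commute)
      then show ?thesis using \<open>x \<in> W\<close> u by (simp add: W_def orthogonal_def)
    qed
    then show ?thesis by (simp add: W_def orthogonal_def)
  qed
  have "W \<noteq> {0}"
  proof -
    have "dim (span B) \<le> k" using B dim_le_card'[of B] by (simp add: dim_span)
    then have "span B \<noteq> UNIV" using Suc.prems by (metis DIM_cart DIM_real Suc_n_not_le_n dim_UNIV mult.right_neutral order_trans)
    then obtain x where "x \<noteq> 0" "\<And>y. y \<in> span B \<Longrightarrow> orthogonal x y"
      using orthogonal_to_subspace_exists_gen[of B UNIV] by (metis psubsetI span_UNIV subset_UNIV)
    then have "x \<in> W" "x \<noteq> 0" by (auto simp: W_def span_base orthogonal_commute)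
    then show ?thesis by blast
  qed
  obtain x \<mu> where x: "x \<in> W" "norm x = 1" "S *v x = \<mu> *\<^sub>R x"
    using symmetric_eigenvector_in_subspace[OF sym W inv \<open>W \<noteq> {0}\<close>] by metis
  have "x \<notin> B" using x by (auto simp: W_def orthogonal_def dot_square_norm)
  then show ?case
    using B x by (intro exI[of _ "insert x B"])
      (auto simp: pairwise_insert W_def orthogonal_commute)
qed

section \<open>Characteristic polynomials under similarity and singular bases\<close>

definition const_poly_mat :: "real^'n^'m \<Rightarrow> real poly^'n^'m" where
  "const_poly_mat A = (\<chi> i j. [:A $ i $ j:])"

lemma const_poly_mat_mult: "const_poly_mat (A ** B) = const_poly_mat A ** const_poly_mat B"
proof -
  have const_sum: "[:sum f X:] = (\<Sum>x\<in>X. [:f x:])" for f :: "'x \<Rightarrow> real" and X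
  proof (induction X rule: infinite_finite_induct)
    case (insert x F)
    have eq: "[:sum f (insert x F):] = [:f x:] + [:sum f F:]" using insert.hyps by simp
    show ?case by (subst eq) (simp only: insert.IH sum.insert[OF insert.hyps])
  qed auto
  show ?thesis
    by (simp add: const_poly_mat_def matrix_matrix_mult_def vec_eq_iff const_sum mult.commute)
qed

lemma charpoly_alt: "charpoly A = det (mat [:0, 1:] - const_poly_mat A)"
  unfolding charpoly_def const_poly_mat_def
  by (rule arg_cong[where f = det]) (simp add: vec_eq_iff mat_def)

lemma charpoly_similar:
  fixes A B Q Q' :: "real^'n^'n"
  assumes "Q' ** Q = mat 1" "Q' ** A ** Q = B"
  shows "charpoly A = charpoly B"
proof -
  let ?c = const_poly_mat
  have c1: "?c Q' ** ?c Q = mat 1"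
    unfolding const_poly_mat_mult[symmetric] assms(1) by (simp add: const_poly_mat_def mat_def vec_eq_iff)
  have X: "?c Q' ** mat [:0, 1:] ** ?c Q = mat [:0, 1:]"
  proof -
    have "?c Q' ** mat [:0, 1:] = mat [:0, 1:] ** ?c Q'"
      by (simp add: matrix_matrix_mult_def mat_def vec_eq_iff if_distrib[where f = "\<lambda>x. _ * x"]
          if_distrib[where f = "\<lambda>x. x * _"] cong: if_cong)
    then show ?thesis by (simp add: c1 flip: matrix_mul_assoc)
  qed
  have "?c Q' ** (mat [:0, 1:] - ?c A) ** ?c Q = mat [:0, 1:] - ?c B"
  proof -
    have "?c Q' ** (mat [:0, 1:] - ?c A) ** ?c Q = ?c Q' ** mat [:0, 1:] ** ?c Q - ?c Q' ** ?c A ** ?c Q"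
      by (simp add: matrix_matrix_mult_def vec_eq_iff sum_subtractf left_diff_distrib right_diff_distrib)
    then show ?thesis by (simp add: X assms(2) flip: const_poly_mat_mult)
  qed
  then have "det (mat [:0, 1:] - ?c B) = det (?c Q') * det (mat [:0, 1:] - ?c A) * det (?c Q)"
    by (simp only: det_mul[symmetric])
  also have "\<dots> = det (?c Q' ** ?c Q) * det (mat [:0, 1:] - ?c A)"
    by (simp only: det_mul mult_ac)
  also have "\<dots> = det (mat [:0, 1:] - ?c A)"
    unfolding c1 by simp
  finally show ?thesis unfolding charpoly_alt by (rule HOL.sym)
qed

lemma charpoly_diagonal:
  fixes d :: "'n::finite \<Rightarrow> real"
  shows "charpoly (\<chi> i j. if i = j then d i else 0) = (\<Prod>i\<in>UNIV. [:- d i, 1:])"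
  unfolding charpoly_def by (subst det_diagonal) (auto intro!: prod.cong)

lemma orthogonal_matrix_norm:
  fixes Q :: "real^'n^'n"
  assumes "orthogonal_matrix Q"
  shows "norm (Q *v y) = norm y"
proof -
  have Q: "transpose Q ** Q = mat 1" using assms by (simp only: orthogonal_matrix)
  have "(Q *v y) \<bullet> (Q *v y) = (y v* transpose Q) \<bullet> (Q *v y)" by (simp only: vector_transpose_matrix)
  also have "\<dots> = y \<bullet> (transpose Q *v (Q *v y))" by (rule dot_lmul_matrix)
  also have "\<dots> = y \<bullet> y" by (simp only: matrix_vector_mul_assoc Q matrix_vector_mul_lid)
  finally show ?thesis by (simp only: norm_eq_sqrt_inner)
qed

text \<open>The columns of Q are right singular vectors with values s. The list ys orders the index
  type by decreasing s, tying positions in \<open>singular_values\<close> to directions.\<close>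

definition singular_basis :: "real^'n^'n \<Rightarrow> real^'n^'n \<Rightarrow> ('n \<Rightarrow> real) \<Rightarrow> 'n list \<Rightarrow> bool" where
  "singular_basis A Q s ys \<longleftrightarrow> orthogonal_matrix Q \<and>
     (\<forall>x. (norm (A *v x))\<^sup>2 = (\<Sum>i\<in>UNIV. (s i)\<^sup>2 * ((transpose Q *v x) $ i)\<^sup>2)) \<and>
     (\<forall>i. s i \<ge> 0) \<and> distinct ys \<and> set ys = UNIV \<and> singular_values A = map s ys \<and>
     sorted_wrt (\<lambda>i j. s i \<ge> s j) ys"

text \<open>The spectral theorem for the Gram matrix S of A. Diagonalising it factors its
  characteristic polynomial, which identifies the multiset of roots with the eigenvalues of the
  orthonormal basis.\<close>

lemma singular_basis_exists: "\<exists>Q s ys. singular_basis A Q s ys"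
  for A :: "real^'n^'n"
proof -
  define S where "S = transpose A ** A"
  have sym: "transpose S = S" by (simp add: S_def matrix_transpose_mul)
  have quad: "x \<bullet> (S *v x) = (norm (A *v x))\<^sup>2" for x
  proof -
    have "x \<bullet> (S *v x) = (x v* transpose A) \<bullet> (A *v x)"
      by (simp only: S_def dot_lmul_matrix matrix_vector_mul_assoc)
    also have "\<dots> = (A *v x) \<bullet> (A *v x)" by (simp only: vector_transpose_matrix)
    finally show ?thesis by (simp only: dot_square_norm)
  qed
  obtain B where B: "finite B" "card B = CARD('n)" "pairwise orthogonal B"
    "\<And>u. u \<in> B \<Longrightarrow> norm u = 1 \<and> (\<exists>\<mu>. S *v u = \<mu> *\<^sub>R u)"
    using symmetric_orthonormal_eigenvectors[OF sym order.refl] by blast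
  obtain e :: "'n \<Rightarrow> real^'n" where e: "bij_betw e UNIV B"
    using finite_same_card_bij[of "UNIV :: 'n set" B, OF finite B(1) B(2)[symmetric]] by blast
  have eB: "e i \<in> B" for i using e by (auto simp: bij_betw_def)
  obtain \<mu> where \<mu>: "\<And>i. S *v e i = \<mu> i *\<^sub>R e i" using B(4)[OF eB] by metis
  have on: "e i \<bullet> e j = (if i = j then 1 else 0)" for i j
  proof (cases "i = j")
    case True
    then show ?thesis using B(4)[OF eB[of j]] by (simp add: dot_square_norm)
  next
    case False
    then have "e i \<noteq> e j" using e by (auto simp: bij_betw_def inj_on_def)
    then show ?thesis using B(3) eB False by (auto simp: pairwise_def orthogonal_def)
  qed
  define Q :: "real^'n^'n" where "Q = (\<chi> i j. e j $ i)"
  have Q1: "transpose Q ** Q = mat 1"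
    using on by (simp add: Q_def transpose_def matrix_matrix_mult_def vec_eq_iff mat_def inner_vec_def)
  have Q: "orthogonal_matrix Q" using Q1 by (simp add: orthogonal_matrix)
  have Q2: "Q ** transpose Q = mat 1" using Q by (simp add: orthogonal_matrix_def)
  define D :: "real^'n^'n" where "D = (\<chi> i j. if i = j then \<mu> i else 0)"
  have Dv: "(D *v y) $ i = \<mu> i * y $ i" for y i
    by (simp add: D_def matrix_vector_mult_def if_distrib[where f = "\<lambda>x. x * _"] cong: if_cong)
  have SQ: "S ** Q = Q ** D"
  proof -
    have "(S ** Q) $ i $ j = (Q ** D) $ i $ j" for i j
    proof -
      have "(S ** Q) $ i $ j = (S *v e j) $ i"
        by (simp add: Q_def matrix_matrix_mult_def matrix_vector_mult_def)
      also have "\<dots> = (Q ** D) $ i $ j"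
        by (simp add: \<mu> Q_def D_def matrix_matrix_mult_def if_distrib[where f = "\<lambda>x. _ * x"] cong: if_cong)
      finally show ?thesis .
    qed
    then show ?thesis by (simp add: vec_eq_iff)
  qed
  have QSQ: "transpose Q ** S ** Q = D"
    by (simp only: matrix_mul_assoc[symmetric] SQ) (simp only: matrix_mul_assoc Q1 matrix_mul_lid)
  have S_eq: "S = Q ** D ** transpose Q"
    by (simp only: SQ[symmetric] matrix_mul_assoc[symmetric] Q2 matrix_mul_rid)
  have cp: "charpoly S = (\<Prod>i\<in>UNIV. [:- \<mu> i, 1:])"
    using charpoly_similar[OF Q1 QSQ] charpoly_diagonal[of \<mu>] by (simp add: D_def)
  have \<mu>0: "\<mu> i \<ge> 0" for i
  proof -
    have "\<mu> i = e i \<bullet> (S *v e i)" using on[of i i] by (simp add: \<mu>)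
    then show ?thesis by (simp add: quad)
  qed
  define s where "s i = sqrt (\<mu> i)" for i
  have roots: "proots (charpoly S) = image_mset \<mu> (mset_set UNIV)"
  proof -
    have "proots (\<Prod>i\<in>X. [:- \<mu> i, 1:]) = image_mset \<mu> (mset_set X)" if "finite X" for X
      using that by (induction X rule: finite_induct) (simp_all add: proots_mult del: mult_pCons_left)
    then show ?thesis by (simp add: cp)
  qed
  obtain xs :: "'n list" where xs: "set xs = UNIV" "distinct xs"
    using finite_distinct_list[of "UNIV :: 'n set"] by auto
  define zs where "zs = sort_key s xs"
  have "mset_set UNIV = mset zs"
    using xs by (metis mset_set_set mset_sort set_sort zs_def distinct_sort)
  then have ms: "image_mset sqrt (proots (charpoly S)) = mset (map s zs)"
    by (simp add: roots s_def[abs_def] multiset.map_comp comp_def)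
  have sz: "sorted (map s zs)" by (simp add: zs_def)
  have sv: "singular_values A = map s (rev zs)"
    unfolding singular_values_def S_def[symmetric] ms
    by (simp only: sorted_list_of_multiset_mset sorted_sort_id[OF sz] rev_map)
  have so: "sorted_wrt (\<lambda>i j. s i \<ge> s j) (rev zs)"
    using sz by (simp add: sorted_wrt_rev sorted_map)
  have sq: "(norm (A *v x))\<^sup>2 = (\<Sum>i\<in>UNIV. (s i)\<^sup>2 * ((transpose Q *v x) $ i)\<^sup>2)" for x
  proof -
    have "x \<bullet> (S *v x) = (transpose Q *v x) \<bullet> (D *v (transpose Q *v x))"
      unfolding S_eq by (simp add: dot_lmul_matrix flip: matrix_vector_mul_assoc)
    also have "\<dots> = (\<Sum>i\<in>UNIV. \<mu> i * ((transpose Q *v x) $ i)\<^sup>2)"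
      by (simp only: inner_vec_def Dv) (simp add: power2_eq_square mult_ac)
    also have "\<dots> = (\<Sum>i\<in>UNIV. (s i)\<^sup>2 * ((transpose Q *v x) $ i)\<^sup>2)"
      by (simp only: s_def real_sqrt_pow2[OF \<mu>0])
    finally show ?thesis by (simp only: quad)
  qed
  have ds: "distinct (rev zs)" "set (rev zs) = UNIV" using xs by (simp_all add: zs_def)
  have s0: "s i \<ge> 0" for i using \<mu>0 by (simp add: s_def)
  show ?thesis
    unfolding singular_basis_def
    by (rule exI[of _ Q], rule exI[of _ s], rule exI[of _ "rev zs"]) (intro conjI allI Q sq s0 ds sv so)
qed

lemma norm_le_singular_value_1:
  fixes A :: "real^'n^'n"
  shows "norm (A *v x) \<le> singular_value 1 A * norm x"
proof -
  obtain Q s ys where "singular_basis A Q s ys" using singular_basis_exists by blast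
  then have Q: "orthogonal_matrix Q"
    "\<And>x. (norm (A *v x))\<^sup>2 = (\<Sum>i\<in>UNIV. (s i)\<^sup>2 * ((transpose Q *v x) $ i)\<^sup>2)"
    and s: "\<And>i. s i \<ge> 0" and ys: "distinct ys" "set ys = UNIV" "singular_values A = map s ys"
    "sorted_wrt (\<lambda>i j. s i \<ge> s j) ys"
    unfolding singular_basis_def by blast+
  obtain i1 zs where z: "ys = i1 # zs" using ys(2) by (cases ys) auto
  have s1: "singular_value 1 A = s i1" by (simp add: singular_value_def ys z)
  have "s i \<le> s i1" for i using ys(2,4) z by (cases "i = i1") auto
  then have "(norm (A *v x))\<^sup>2 \<le> (\<Sum>i\<in>UNIV. (s i1)\<^sup>2 * ((transpose Q *v x) $ i)\<^sup>2)"
    unfolding Q(2) using s by (intro sum_mono mult_right_mono power_mono) auto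
  also have "\<dots> = (s i1)\<^sup>2 * (norm (transpose Q *v x))\<^sup>2"
    by (simp add: norm_vec_def L2_set_def sum_nonneg sum_distrib_left)
  also have "norm (transpose Q *v x) = norm x"
    using Q(1) by (intro orthogonal_matrix_norm) (simp only: orthogonal_matrix_transpose)
  finally show ?thesis
    unfolding s1 using s[of i1] by - (rule power2_le_imp_le, simp_all add: power_mult_distrib)
qed

text \<open>The hyperplane orthogonal to \<open>w\<close> meets the span of the first two singular directions.\<close>

lemma singular_value_2_bounds:
  fixes A :: "real^'n^'n"
  assumes n: "CARD('n) \<ge> 2" and "det A \<noteq> 0"
    and C: "\<And>x. w \<bullet> x = 0 \<Longrightarrow> norm (A *v x) \<le> C * norm x"
  shows "0 < singular_value 2 A" "singular_value 2 A \<le> C"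
proof -
  obtain Q s ys where "singular_basis A Q s ys" using singular_basis_exists by blast
  then have Q: "orthogonal_matrix Q"
    "\<And>x. (norm (A *v x))\<^sup>2 = (\<Sum>i\<in>UNIV. (s i)\<^sup>2 * ((transpose Q *v x) $ i)\<^sup>2)"
    and s: "\<And>i. s i \<ge> 0" and ys: "distinct ys" "set ys = UNIV" "singular_values A = map s ys"
    "sorted_wrt (\<lambda>i j. s i \<ge> s j) ys"
    unfolding singular_basis_def by blast+
  have "length ys = CARD('n)" using ys(1,2) by (metis distinct_card)
  then obtain i j zs where z: "ys = i # j # zs"
    using n by (cases ys; cases "tl ys") auto
  have s2: "singular_value 2 A = s j" by (simp add: singular_value_def ys z)
  have ij: "i \<noteq> j" "s j \<le> s i" using ys z by auto
  have QQ: "transpose Q *v (Q *v y) = y" for y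
    using Q(1) by (simp add: matrix_vector_mul_assoc orthogonal_matrix)
  have nQ: "norm (Q *v y) = norm y" for y
    using Q(1) by (rule orthogonal_matrix_norm)
  have AQ: "(norm (A *v (Q *v y)))\<^sup>2 = (\<Sum>k\<in>UNIV. (s k)\<^sup>2 * (y $ k)\<^sup>2)" for y
    unfolding Q(2) QQ ..
  have "(norm (A *v (Q *v axis j 1)))\<^sup>2 = (s j)\<^sup>2"
    unfolding AQ by (simp add: axis_def if_distrib[where f = "\<lambda>x. x\<^sup>2"] if_distrib[where f = "\<lambda>x. _ * x"] cong: if_cong)
  moreover have "Q *v axis j 1 \<noteq> 0" using nQ[of "axis j 1"] by auto
  then have "A *v (Q *v axis j 1) \<noteq> 0"
  proof -
    obtain B where B: "B ** A = mat 1"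
      using \<open>det A \<noteq> 0\<close> unfolding invertible_det_nz[symmetric] invertible_def by blast
    have "B *v (A *v (Q *v axis j 1)) = Q *v axis j 1"
      by (simp only: matrix_vector_mul_assoc[of B] B matrix_vector_mul_lid)
    then show ?thesis using \<open>Q *v axis j 1 \<noteq> 0\<close> by (metis matrix_vector_mult_0_right)
  qed
  ultimately have "s j \<noteq> 0" by auto
  then show "0 < singular_value 2 A" using s[of j] by (simp add: s2)
  define p q where "p = w \<bullet> (Q *v axis i 1)" and "q = w \<bullet> (Q *v axis j 1)"
  obtain \<alpha> \<beta> where ab: "\<alpha> * p + \<beta> * q = 0" "\<alpha> \<noteq> 0 \<or> \<beta> \<noteq> 0"
  proof (cases "p = 0 \<and> q = 0")
    case True
    then show ?thesis by (intro that[of 1 1]) auto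
  next
    case False
    then show ?thesis by (intro that[of q "- p"]) auto
  qed
  define y where "y = \<alpha> *\<^sub>R axis i 1 + \<beta> *\<^sub>R (axis j 1 :: real^'n)"
  have yk: "y $ k = (if k = i then \<alpha> else if k = j then \<beta> else 0)" for k
    using ij by (auto simp: y_def axis_def)
  have two: "(\<Sum>k\<in>UNIV. g k * (y $ k)\<^sup>2) = g i * \<alpha>\<^sup>2 + g j * \<beta>\<^sup>2" for g
  proof -
    have "(\<Sum>k\<in>UNIV. g k * (y $ k)\<^sup>2) = (\<Sum>k\<in>{i, j}. g k * (y $ k)\<^sup>2)"
      by (rule sum.mono_neutral_right) (auto simp: yk)
    then show ?thesis using ij by (simp add: yk)
  qed
  have ny: "(norm y)\<^sup>2 = \<alpha>\<^sup>2 + \<beta>\<^sup>2"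
    using two[of "\<lambda>_. 1"] by (simp add: norm_vec_def L2_set_def sum_nonneg)
  have "w \<bullet> (Q *v y) = 0"
    using ab by (simp add: y_def p_def q_def matrix_vector_right_distrib matrix_vector_mult_scaleR inner_add_right)
  then have le: "norm (A *v (Q *v y)) \<le> C * norm y" using C[of "Q *v y"] nQ by simp
  have "(s j * norm y)\<^sup>2 \<le> (norm (A *v (Q *v y)))\<^sup>2"
  proof -
    have "(s j * norm y)\<^sup>2 = (s j)\<^sup>2 * \<alpha>\<^sup>2 + (s j)\<^sup>2 * \<beta>\<^sup>2"
      by (simp add: power_mult_distrib ny distrib_left)
    also have "\<dots> \<le> (s i)\<^sup>2 * \<alpha>\<^sup>2 + (s j)\<^sup>2 * \<beta>\<^sup>2"
      using ij s by (intro add_mono mult_right_mono power_mono) auto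
    finally show ?thesis unfolding AQ two .
  qed
  then have "s j * norm y \<le> C * norm y" using le by (meson norm_ge_zero order_trans power2_le_imp_le)
  moreover have "norm y > 0"
  proof -
    have "(norm y)\<^sup>2 \<noteq> 0" using ab(2) by (simp add: ny sum_power2_eq_zero_iff)
    then show ?thesis by auto
  qed
  ultimately show "singular_value 2 A \<le> C" by (simp add: s2)
qed

section \<open>Block matrices\<close>

definition vec4 :: "real \<Rightarrow> real \<Rightarrow> real \<Rightarrow> real \<Rightarrow> real^4" where
  "vec4 p q r s = (\<chi> i. if i = 1 then p else if i = 2 then q else if i = 3 then r else s)"

lemma vec4_nth [simp]:
  "vec4 p q r s $ 1 = p" "vec4 p q r s $ 2 = q" "vec4 p q r s $ 3 = r" "vec4 p q r s $ 4 = s"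
  by (simp_all add: vec4_def)

lemma vec4_eq_iff: "x = y \<longleftrightarrow> x$1 = y$1 \<and> x$2 = y$2 \<and> x$3 = y$3 \<and> x$4 = y$4" for x y :: "'a^4"
  by (simp add: vec_eq_iff forall_4)

definition block_mat :: "real^2^2 \<Rightarrow> real^2 \<Rightarrow> real^2 \<Rightarrow> real \<Rightarrow> real^4^4" where
  "block_mat P a b c = (\<chi> i. if i = 1 then vec4 (P$1$1) (P$1$2) 0 0
     else if i = 2 then vec4 (P$2$1) (P$2$2) 0 0
     else if i = 3 then vec4 (a$1) (a$2) 1 0 else vec4 (b$1) (b$2) c 1)"

lemma block_mat_nth [simp]:
  "block_mat P a b c $ 1 = vec4 (P$1$1) (P$1$2) 0 0"
  "block_mat P a b c $ 2 = vec4 (P$2$1) (P$2$2) 0 0"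
  "block_mat P a b c $ 3 = vec4 (a$1) (a$2) 1 0"
  "block_mat P a b c $ 4 = vec4 (b$1) (b$2) c 1"
  by (simp_all add: block_mat_def)

lemma vector_matrix_2 [simp]:
  "(a v* (P :: real^2^2)) $ 1 = a$1 * P$1$1 + a$2 * P$2$1"
  "(a v* (P :: real^2^2)) $ 2 = a$1 * P$1$2 + a$2 * P$2$2"
  by (simp_all add: vector_matrix_mult_def sum_2 mult.commute)

lemma block_mat_mult:
  "block_mat P a b c ** block_mat P' a' b' c' =
    block_mat (P ** P') (a' + a v* P') (b' + c *\<^sub>R a' + b v* P') (c + c')"
  unfolding vec4_eq_iff by (simp add: matrix_matrix_mult_def sum_4 sum_2)

lemma block_mat_mult_vec:
  "block_mat P a b c *v q = vec4 (P$1$1 * q$1 + P$1$2 * q$2) (P$2$1 * q$1 + P$2$2 * q$2)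
    (a$1 * q$1 + a$2 * q$2 + q$3) (b$1 * q$1 + b$2 * q$2 + c * q$3 + q$4)"
  unfolding vec4_eq_iff by (simp add: matrix_vector_mult_def sum_4)

lemma det_block_mat: "det (block_mat P a b c) = det P"
proof -
  have f: "finite {2::4, 3, 4}" "1 \<notin> {2::4, 3, 4}" "finite {3::4, 4}" "2 \<notin> {3::4, 4}"
    "finite {4::4}" "3 \<notin> {4::4}" by auto
  show ?thesis
    unfolding det_def[of "block_mat P a b c"] UNIV_4
    unfolding sum_over_permutations_insert[OF f(1,2)] sum_over_permutations_insert[OF f(3,4)]
      sum_over_permutations_insert[OF f(5,6)] permutes_sing
    by (simp add: sign_swap_id permutation_swap_id sign_compose sign_id swap_id_eq det_2)
qed

lemma norm_vec4_le: "norm (vec4 p q r s) \<le> norm (vector [p, q] :: real^2) + \<bar>r\<bar> + \<bar>s\<bar>"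
proof (rule power2_le_imp_le)
  have "(norm (vec4 p q r s))\<^sup>2 = p\<^sup>2 + q\<^sup>2 + r\<^sup>2 + s\<^sup>2"
    by (simp add: norm_vec_def L2_set_def sum_4)
  also have "p\<^sup>2 + q\<^sup>2 = (norm (vector [p, q] :: real^2))\<^sup>2" by (simp add: norm_vec2_sq)
  also have "\<dots> + r\<^sup>2 + s\<^sup>2 \<le> (norm (vector [p, q] :: real^2) + \<bar>r\<bar> + \<bar>s\<bar>)\<^sup>2"
    by (simp add: power2_eq_square algebra_simps)
  finally show "(norm (vec4 p q r s))\<^sup>2 \<le> (norm (vector [p, q] :: real^2) + \<bar>r\<bar> + \<bar>s\<bar>)\<^sup>2" .
qed simp

lemma norm_vec4_ge: "norm (vector [p, q] :: real^2) \<le> norm (vec4 p q r s)"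
  by (rule power2_le_imp_le) (simp_all add: norm_vec2_sq norm_vec_def[of "vec4 p q r s"] L2_set_def sum_4)

definition plane_part :: "real^4 \<Rightarrow> real^2" where
  "plane_part q = vector [q$1, q$2]"

lemma plane_part_nth [simp]: "plane_part q $ 1 = q$1" "plane_part q $ 2 = q$2"
  by (simp_all add: plane_part_def)

lemma norm_plane_part_le: "norm (plane_part q) \<le> norm q"
  by (rule power2_le_imp_le) (simp_all add: norm_vec2_sq norm_vec_def[of q] L2_set_def sum_4)

section \<open>Lines, boundary points and visual distance in homogeneous coordinates\<close>

lemma span_singleton_scale:
  fixes x :: "'a::real_vector"
  assumes "k \<noteq> 0" shows "span {k *\<^sub>R x} = span {x}"
proof (rule span_eq[THEN iffD2], intro conjI)
  show "{k *\<^sub>R x} \<subseteq> span {x}" by (simp add: span_base span_scale)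
  have "inverse k *\<^sub>R (k *\<^sub>R x) \<in> span {k *\<^sub>R x}" by (intro span_scale span_base) simp
  then show "{x} \<subseteq> span {k *\<^sub>R x}" using assms by simp
qed

lemma proj_action_span: "proj_action A (span {q}) = span {A *v q}"
  by (auto simp: proj_action_def span_singleton image_iff matrix_vector_mult_scaleR)

lemma boundary_vec_moebius:
  assumes "det A = 1"
  obtains k where "k \<noteq> 0" "boundary_vec (moebius_boundary A x) = k *\<^sub>R (A *v boundary_vec x)"
proof (cases x)
  case (Finite_Pt t)
  show thesis
  proof (cases "A$2$1 * t + A$2$2 = 0")
    case True
    have "A$1$1 * t + A$1$2 \<noteq> 0"
    proof
      assume "A$1$1 * t + A$1$2 = 0"
      then have "det A = 0" using True by (simp add: det_2) algebra
      then show False using assms by simp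
    qed
    then show thesis using True Finite_Pt
      by (intro that[of "1 / (A$1$1 * t + A$1$2)"]) (auto simp: vec_eq_iff forall_2)
  next
    case False
    then show thesis using Finite_Pt
      by (intro that[of "1 / (A$2$1 * t + A$2$2)"]) (auto simp: vec_eq_iff forall_2)
  qed
next
  case Infinite_Pt
  show thesis
  proof (cases "A$2$1 = 0")
    case True
    then have "A$1$1 \<noteq> 0" using assms by (auto simp: det_2)
    then show thesis using True Infinite_Pt
      by (intro that[of "1 / A$1$1"]) (auto simp: vec_eq_iff forall_2)
  next
    case False
    then show thesis using Infinite_Pt
      by (intro that[of "1 / A$2$1"]) (auto simp: vec_eq_iff forall_2)
  qed
qed

lemma boundary_vec_surj:
  assumes "v \<noteq> 0"
  obtains x k where "k \<noteq> 0" "boundary_vec x = k *\<^sub>R v"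
proof (cases "v$2 = 0")
  case True
  then have "v$1 \<noteq> 0" using assms by (auto simp: vec_eq_iff forall_2)
  then show thesis using True
    by (intro that[of "1 / v$1" Infinite_Pt]) (auto simp: vec_eq_iff forall_2)
next
  case False
  then show thesis
    by (intro that[of "1 / v$2" "Finite_Pt (v$1 / v$2)"]) (auto simp: vec_eq_iff forall_2)
qed

lemma based_norm_scale: "based_norm x0 (k *\<^sub>R v) = \<bar>k\<bar> * based_norm x0 v"
proof -
  have "of_real ((k *\<^sub>R v)$1) - of_real ((k *\<^sub>R v)$2) * x0 = of_real k * (of_real (v$1) - of_real (v$2) * x0)"
    by (simp add: algebra_simps)
  then show ?thesis unfolding based_norm_def by (simp only: norm_mult norm_of_real)
qed

lemma based_norm_diff: "based_norm x0 (v - w) \<le> based_norm x0 v + based_norm x0 w"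
proof -
  have "of_real ((v - w)$1) - of_real ((v - w)$2) * x0
      = (of_real (v$1) - of_real (v$2) * x0) - (of_real (w$1) - of_real (w$2) * x0)"
    by (simp add: algebra_simps)
  then show ?thesis unfolding based_norm_def by (metis norm_triangle_ineq4)
qed

lemma based_norm_le: "based_norm x0 v \<le> (1 + cmod x0) * norm v"
proof -
  have "based_norm x0 v \<le> \<bar>v$1\<bar> + \<bar>v$2\<bar> * cmod x0"
    unfolding based_norm_def using norm_triangle_ineq4[of "of_real (v$1)" "of_real (v$2) * x0"]
    by (simp add: norm_mult)
  also have "\<dots> \<le> norm v + norm v * cmod x0"
    by (intro add_mono mult_right_mono component_le_norm_cart) auto
  finally show ?thesis by (simp add: algebra_simps)
qed

text \<open>The left side is the absolute imaginary part of a complex number whose modulus is the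
  right side. It bounds visual distances by 1 and \<open>based_norm\<close> from below.\<close>

lemma det2_le_based_norm: "Im x0 * \<bar>det2 v w\<bar> \<le> based_norm x0 v * based_norm x0 w"
  if "x0 \<in> hyp_plane"
proof -
  let ?z = "(of_real (v$1) - of_real (v$2) * x0) * cnj (of_real (w$1) - of_real (w$2) * x0)"
  have "Im ?z = Im x0 * det2 v w" by (simp add: det2_def algebra_simps)
  then have "\<bar>Im x0 * det2 v w\<bar> \<le> cmod ?z" by (metis abs_Im_le_cmod)
  then show ?thesis
    using that unfolding norm_mult complex_mod_cnj by (simp add: based_norm_def abs_mult hyp_plane_def)
qed

lemma det2_scale [simp]: "det2 (k *\<^sub>R v) w = k * det2 v w" "det2 v (k *\<^sub>R w) = k * det2 v w"
  by (simp_all add: det2_def algebra_simps)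

lemma visual_dist_vec:
  assumes "x0 \<in> hyp_plane" "boundary_vec x = k *\<^sub>R v" "boundary_vec y = l *\<^sub>R w" "k \<noteq> 0" "l \<noteq> 0"
  shows "visual_dist x0 x y = Im x0 * \<bar>det2 v w\<bar> / (based_norm x0 v * based_norm x0 w)"
  using assms(4,5) unfolding visual_dist_eq[OF assms(1)] assms(2,3)
  by (simp add: based_norm_scale abs_mult)

lemma visual_dist_nonneg: "x0 \<in> hyp_plane \<Longrightarrow> 0 \<le> visual_dist x0 x y"
  using visual_dist_eq[of x0 x y] by (simp add: hyp_plane_def based_norm_def)

lemma visual_dist_le_1:
  assumes "x0 \<in> hyp_plane"
  shows "visual_dist x0 x y \<le> 1"
  unfolding visual_dist_eq[OF assms]
  using det2_le_based_norm[OF assms] based_norm_pos[OF assms] by (simp add: divide_le_eq_1 mult_pos_pos)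

section \<open>The representation and its limit map\<close>

context lattice_section
begin

definition \<rho> :: "'a \<Rightarrow> real^4^4" where
  "\<rho> \<gamma> = block_mat (P \<gamma>) (a \<gamma>) (b \<gamma>) (c \<gamma>)"

definition lift :: "real^2 \<Rightarrow> real^4" where
  "lift v = vec4 (v$1) (v$2) (f v) (h v)"

definition \<xi> :: "hyp_boundary \<Rightarrow> (real^4) set" where
  "\<xi> x = span {lift (boundary_vec x)}"

text \<open>The locale does not assume the cocycle identities for a and b; comparing the
  equivariance under a product with that under its factors recovers them.\<close>

lemma a_mult:
  assumes "\<gamma> \<in> carrier G" "\<delta> \<in> carrier G"
  shows "a (\<gamma> \<otimes> \<delta>) = a \<delta> + a \<gamma> v* P \<delta>"
proof -
  have "a (\<gamma> \<otimes> \<delta>) \<bullet> v = (a \<delta> + a \<gamma> v* P \<delta>) \<bullet> v" for v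
    using f_equiv[of "\<gamma> \<otimes> \<delta>" v] f_equiv[OF assms(1), of "P \<delta> *v v"] f_equiv[OF assms(2), of v] assms
    by (simp add: P_mult matrix_vector_mul_assoc inner_add_left dot_lmul_matrix)
  then show ?thesis by (metis vector_eq_rdot)
qed

lemma b_mult:
  assumes "\<gamma> \<in> carrier G" "\<delta> \<in> carrier G"
  shows "b (\<gamma> \<otimes> \<delta>) = b \<delta> + c \<gamma> *\<^sub>R a \<delta> + b \<gamma> v* P \<delta>"
proof -
  have "b (\<gamma> \<otimes> \<delta>) \<bullet> v = (b \<delta> + c \<gamma> *\<^sub>R a \<delta> + b \<gamma> v* P \<delta>) \<bullet> v" for v
    using h_equiv[of "\<gamma> \<otimes> \<delta>" v] h_equiv[OF assms(1), of "P \<delta> *v v"] h_equiv[OF assms(2), of v]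
      f_equiv[OF assms(2), of v] assms
    by (simp add: P_mult c_mult matrix_vector_mul_assoc inner_add_left dot_lmul_matrix algebra_simps)
  then show ?thesis by (metis vector_eq_rdot)
qed

lemma \<rho>_mult: "\<gamma> \<in> carrier G \<Longrightarrow> \<delta> \<in> carrier G \<Longrightarrow> \<rho> (\<gamma> \<otimes> \<delta>) = \<rho> \<gamma> ** \<rho> \<delta>"
  by (simp add: \<rho>_def block_mat_mult P_mult a_mult b_mult c_mult)

lemma det_\<rho> [simp]: "\<gamma> \<in> carrier G \<Longrightarrow> det (\<rho> \<gamma>) = 1"
  by (simp add: \<rho>_def det_block_mat)

lemma \<rho>_hom: "\<rho> \<in> hom G SL" "\<rho> \<in> hom G GL"
  by (auto simp: hom_def \<rho>_mult SL_def GL_def invertible_det_nz)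

lemma \<rho>_lift: "\<gamma> \<in> carrier G \<Longrightarrow> \<rho> \<gamma> *v lift v = lift (P \<gamma> *v v)"
  unfolding lift_def \<rho>_def block_mat_mult_vec
  by (simp add: f_equiv h_equiv inner_vec_def sum_2 add_ac)

lemma lift_scale: "lift (k *\<^sub>R v) = k *\<^sub>R lift v"
  unfolding vec4_eq_iff by (simp add: lift_def f_scale h_scale)

lemma lift_diff_norm: "norm (lift v - lift w) \<le> norm (v - w) + \<bar>f v - f w\<bar> + \<bar>h v - h w\<bar>"
proof -
  have "lift v - lift w = vec4 ((v - w)$1) ((v - w)$2) (f v - f w) (h v - h w)"
    unfolding vec4_eq_iff by (simp add: lift_def)
  moreover have "vector [(v - w)$1, (v - w)$2] = v - w" by (simp add: vec_eq_iff forall_2)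
  ultimately show ?thesis using norm_vec4_le[of "(v - w)$1" "(v - w)$2" "f v - f w" "h v - h w"] by simp
qed

lemma norm_lift_bounds: "norm v \<le> norm (lift v)" "norm (lift v) \<le> (1 + 2 * K) * norm v"
proof -
  have v: "vector [v$1, v$2] = v" by (simp add: vec_eq_iff forall_2)
  show "norm v \<le> norm (lift v)"
    using norm_vec4_ge[of "v$1" "v$2"] unfolding v lift_def .
  show "norm (lift v) \<le> (1 + 2 * K) * norm v"
    using norm_vec4_le[of "v$1" "v$2" "f v" "h v"] f_bound[of v] h_bound[of v]
    unfolding v lift_def by (simp add: algebra_simps)
qed

lemma lift_nz: "v \<noteq> 0 \<Longrightarrow> lift v \<noteq> 0"
  using norm_lift_bounds(1)[of v] by auto

lemma \<xi>_eq: "boundary_vec x = k *\<^sub>R v \<Longrightarrow> k \<noteq> 0 \<Longrightarrow> \<xi> x = span {lift v}"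
  by (simp add: \<xi>_def lift_scale span_singleton_scale)

lemma \<xi>_range: "range \<xi> \<subseteq> proj_space"
  unfolding \<xi>_def proj_space_def using lift_nz[OF boundary_vec_nz] by blast

lemma \<xi>_equivariant:
  assumes "\<gamma> \<in> carrier G"
  shows "\<xi> (moebius_boundary (P \<gamma>) x) = proj_action (\<rho> \<gamma>) (\<xi> x)"
proof -
  obtain k where "k \<noteq> 0" "boundary_vec (moebius_boundary (P \<gamma>) x) = k *\<^sub>R (P \<gamma> *v boundary_vec x)"
    using boundary_vec_moebius[OF P_det[OF assms]] by metis
  then show ?thesis
    using \<xi>_eq by (simp add: \<xi>_def[of x] proj_action_span \<rho>_lift[OF assms])
qed

lemma \<xi>_Hoelder:
  assumes x0: "x0 \<in> hyp_plane" and \<alpha>: "0 < \<alpha>" "\<alpha> < 1 / 2"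
  shows "is_Hoelder (visual_dist x0) proj_dist \<alpha> \<xi>"
proof -
  obtain B where B: "B \<ge> 0" "\<And>v w. norm v = 1 \<Longrightarrow> norm w = 1 \<Longrightarrow> v \<bullet> w \<ge> 0 \<Longrightarrow>
    norm (v - w) + \<bar>f v - f w\<bar> + \<bar>h v - h w\<bar> \<le> B * \<bar>det2 v w\<bar> powr \<alpha>"
    using section_Hoelder[OF \<alpha>] by metis
  have i0: "Im x0 > 0" using x0 by (simp add: hyp_plane_def)
  define A where "A = (1 + cmod x0)\<^sup>2 / Im x0"
  have A: "A \<ge> 0" using i0 by (simp add: A_def)
  have "proj_dist (\<xi> x) (\<xi> y) \<le> (3 * B * A powr \<alpha> + 1) * visual_dist x0 x y powr \<alpha>" for x y
  proof -
    define v where "v = boundary_vec x /\<^sub>R norm (boundary_vec x)"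
    define w' where "w' = boundary_vec y /\<^sub>R norm (boundary_vec y)"
    \<comment> \<open>A line has two unit vectors; the sign picks the one at an acute angle to v, as
      \<open>section_Hoelder\<close> requires.\<close>
    define s :: real where "s = (if v \<bullet> w' \<ge> 0 then 1 else - 1)"
    define w where "w = s *\<^sub>R w'"
    have s: "s \<noteq> 0" "s * s = 1" "\<bar>s\<bar> = 1" by (auto simp: s_def)
    have "norm w' = 1" by (simp add: w'_def)
    then have vw: "norm v = 1" "norm w = 1" by (simp_all add: v_def w_def s)
    have vw0: "v \<bullet> w \<ge> 0" by (simp add: w_def s_def)
    have bx: "boundary_vec x = norm (boundary_vec x) *\<^sub>R v" by (simp add: v_def)
    have "boundary_vec y = norm (boundary_vec y) *\<^sub>R w'" by (simp add: w'_def)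
    then have byy: "boundary_vec y = (norm (boundary_vec y) * s) *\<^sub>R w"
      using s by (simp add: w_def mult.assoc)
    have nz: "v \<noteq> 0" "w \<noteq> 0" using vw by auto
    have \<xi>x: "\<xi> x = span {lift v}" by (rule \<xi>_eq[OF bx]) simp
    have \<xi>y: "\<xi> y = span {lift w}" by (rule \<xi>_eq[OF byy]) (simp add: s)
    have "proj_dist (\<xi> x) (\<xi> y) \<le> 3 * norm (lift v - lift w) / norm (lift v)"
      unfolding \<xi>x \<xi>y by (intro proj_dist_le_norm_diff lift_nz nz)
    also have "\<dots> \<le> 3 * norm (lift v - lift w) / 1"
      using norm_lift_bounds(1)[of v] vw by (intro divide_left_mono) auto
    also have "\<dots> \<le> 3 * (B * \<bar>det2 v w\<bar> powr \<alpha>)"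
      using lift_diff_norm[of v w] B(2)[OF vw vw0] by simp
    finally have le: "proj_dist (\<xi> x) (\<xi> y) \<le> 3 * (B * \<bar>det2 v w\<bar> powr \<alpha>)" .
    have "\<bar>det2 v w\<bar> powr \<alpha> \<le> (A * visual_dist x0 x y) powr \<alpha>"
    proof (rule powr_mono2)
      have vd: "visual_dist x0 x y = Im x0 * \<bar>det2 v w\<bar> / (based_norm x0 v * based_norm x0 w)"
        by (rule visual_dist_vec[OF x0 bx byy]) (auto simp: s)
      have n: "based_norm x0 v * based_norm x0 w \<le> (1 + cmod x0) * (1 + cmod x0)"
        using based_norm_le[of x0 v] based_norm_le[of x0 w] vw by (intro mult_mono) (auto simp: based_norm_def)
      have pos: "based_norm x0 v * based_norm x0 w > 0" using based_norm_pos[OF x0] nz by simp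
      have "\<bar>det2 v w\<bar> * 1 \<le> \<bar>det2 v w\<bar> * ((1 + cmod x0)\<^sup>2 / (based_norm x0 v * based_norm x0 w))"
        using n pos by (intro mult_left_mono) (auto simp: power2_eq_square)
      also have "\<dots> = A * visual_dist x0 x y" using i0 by (simp add: A_def vd)
      finally show "\<bar>det2 v w\<bar> \<le> A * visual_dist x0 x y" by simp
    qed (use \<alpha> in auto)
    also have "(A * visual_dist x0 x y) powr \<alpha> = A powr \<alpha> * visual_dist x0 x y powr \<alpha>"
      using A visual_dist_nonneg[OF x0] by (simp add: powr_mult)
    finally have "3 * (B * \<bar>det2 v w\<bar> powr \<alpha>) \<le> 3 * (B * (A powr \<alpha> * visual_dist x0 x y powr \<alpha>))"
      using B(1) by (intro mult_left_mono) auto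
    also have "\<dots> \<le> (3 * B * A powr \<alpha> + 1) * visual_dist x0 x y powr \<alpha>"
      by (simp add: distrib_right mult.assoc)
    finally show ?thesis using le by linarith
  qed
  moreover have "3 * B * A powr \<alpha> + 1 > 0" using B(1) by (simp add: add_nonneg_pos)
  ultimately show ?thesis unfolding is_Hoelder_def by blast
qed

lemma \<xi>_continuous:
  assumes x0: "x0 \<in> hyp_plane" and "e > 0"
  shows "\<exists>\<delta>>0. \<forall>y. visual_dist x0 x y < \<delta> \<longrightarrow> proj_dist (\<xi> x) (\<xi> y) < e"
proof -
  obtain C where C: "C > 0" "\<And>x y. proj_dist (\<xi> x) (\<xi> y) \<le> C * visual_dist x0 x y powr (1/4)"
    using \<xi>_Hoelder[OF x0, of "1/4"] by (auto simp: is_Hoelder_def)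
  define \<delta> where "\<delta> = (e / C) powr 4"
  have d: "\<delta> > 0" using C assms by (simp add: \<delta>_def)
  have "proj_dist (\<xi> x) (\<xi> y) < e" if "visual_dist x0 x y < \<delta>" for y
  proof -
    have "visual_dist x0 x y powr (1/4) < \<delta> powr (1/4)"
      using that visual_dist_nonneg[OF x0] by (intro powr_less_mono2) auto
    also have "\<dots> = e / C" using C assms by (simp only: \<delta>_def powr_powr) simp
    finally have "C * visual_dist x0 x y powr (1/4) < e" using C by (simp add: field_simps)
    then show ?thesis using C(2)[of x y] by linarith
  qed
  with d show ?thesis by blast
qed

text \<open>On this hyperplane the plane part is a multiple of v, which \<gamma> hardly expands, so
  only the unipotent block acts and the growth is linear in c. The lemma bounds the second singular
  value and, later, the dynamics transverse to an attracting line.\<close>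

lemma \<rho>_bound_on_hyperplane:
  assumes \<gamma>: "\<gamma> \<in> carrier G" and v: "v \<noteq> 0" "norm (P \<gamma> *v v) \<le> 2 * norm v"
    and q: "det2 v (plane_part q) = 0"
  shows "norm (\<rho> \<gamma> *v q) \<le> (6 * K + 5) * (1 + \<bar>c \<gamma>\<bar>) * norm q"
proof -
  define x where "x = plane_part q"
  define k where "k = (v \<bullet> x) / (v \<bullet> v)"
  have x: "x = k *\<^sub>R v"
  proof -
    have "(v \<bullet> v) *\<^sub>R x = (v \<bullet> x) *\<^sub>R v"
      using q by (simp add: x_def[symmetric] vec_eq_iff forall_2 inner_vec_def sum_2 det2_def) algebra
    then show ?thesis using v(1) by (simp add: k_def) (metis inner_eq_zero_iff real_vector_eq_affinity scaleR_eq_0_iff scaleR_one scaleR_scaleR divide_inverse left_inverse mult.commute)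
  qed
  define X C where "X = norm q" and "C = \<bar>c \<gamma>\<bar>"
  have X: "norm x \<le> X" "\<bar>q$3\<bar> \<le> X" "\<bar>q$4\<bar> \<le> X" "X \<ge> 0" "C \<ge> 0"
    by (auto simp: X_def C_def x_def norm_plane_part_le component_le_norm_cart)
  have Px: "norm (P \<gamma> *v x) \<le> 2 * norm x"
    using mult_left_mono[OF v(2), of "\<bar>k\<bar>"] unfolding x by (simp add: matrix_vector_mult_scaleR)
  have n3: "norm (P \<gamma> *v x) + norm x \<le> 3 * X" using Px X by linarith
  have ax: "\<bar>a \<gamma> \<bullet> x\<bar> \<le> K * (3 * X)"
    using a_inner_bound[OF \<gamma>, of x] mult_left_mono[OF n3 K_nonneg] by linarith
  have bx: "\<bar>b \<gamma> \<bullet> x\<bar> \<le> K * (1 + C) * (3 * X)"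
    using b_inner_bound[OF \<gamma>, of x] mult_left_mono[OF n3, of "K * (1 + C)"] K_nonneg X(5) by (simp add: C_def)
  have cq: "\<bar>c \<gamma> * q$3\<bar> \<le> C * X" unfolding abs_mult C_def by (intro mult_left_mono X) auto
  have "\<rho> \<gamma> *v q = vec4 ((P \<gamma> *v x)$1) ((P \<gamma> *v x)$2) (a \<gamma> \<bullet> x + q$3) (b \<gamma> \<bullet> x + c \<gamma> * q$3 + q$4)"
    by (simp add: \<rho>_def block_mat_mult_vec x_def inner_vec_def sum_2)
  moreover have "vector [(P \<gamma> *v x)$1, (P \<gamma> *v x)$2] = P \<gamma> *v x" by (simp add: vec_eq_iff forall_2)
  ultimately have "norm (\<rho> \<gamma> *v q) \<le> norm (P \<gamma> *v x) + \<bar>a \<gamma> \<bullet> x + q$3\<bar> + \<bar>b \<gamma> \<bullet> x + c \<gamma> * q$3 + q$4\<bar>"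
    using norm_vec4_le by metis
  also have "\<dots> \<le> 2 * X + (K * (3 * X) + X) + (K * (1 + C) * (3 * X) + C * X + X)"
    using Px X(1) abs_triangle_ineq[of "a \<gamma> \<bullet> x" "q$3"] abs_triangle_ineq[of "b \<gamma> \<bullet> x + c \<gamma> * q$3" "q$4"]
      abs_triangle_ineq[of "b \<gamma> \<bullet> x" "c \<gamma> * q$3"] ax bx cq X by (intro add_mono) linarith+
  also have "\<dots> \<le> \<dots> + (3 * K * C * X + C * X * 4 + X)"
    using K_nonneg X by simp
  also have "\<dots> = (6 * K + 5) * (1 + C) * X" by (simp add: algebra_simps)
  finally show ?thesis by (simp add: X_def C_def)
qed

text \<open>With N the norm of \<open>P \<gamma>\<close>, the first singular value is at least N/2
  and the second is O(1 + |c|). Bounding c by the square root of N leaves a ratio of order N^(1/2),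
  and exp d is O(N^2), whence the rate 1/4.\<close>

lemma \<rho>_Anosov:
  assumes x0: "x0 \<in> hyp_plane"
  shows "one_Anosov x0 G P \<rho>"
proof -
  obtain C0 where C0: "C0 > 0" "\<And>A. det A = 1 \<Longrightarrow> exp (hyp_dist (moebius A x0) x0) \<le> C0 * (norm A)\<^sup>2"
    using exp_hyp_dist_moebius_le[OF x0] by metis
  obtain C where C: "C \<ge> 0" "\<And>\<gamma>. \<gamma> \<in> carrier G \<Longrightarrow> \<bar>c \<gamma>\<bar> \<le> C * norm (P \<gamma>) powr (1/2)"
    using hom_real_powr_bound[OF c_hom, of "1/2"] by auto
  define E where "E = (6 * K + 5) * (1 + C)"
  have E: "E > 0" using K_nonneg C by (simp add: E_def)
  define L where "L = 2 * E * C0 powr (1/4)"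
  have L: "L > 0" using E C0 by (simp add: L_def)
  have main: "exp (1/4 * hyp_dist (moebius (P \<gamma>) x0) x0) \<le> L * (singular_value 1 (\<rho> \<gamma>) / singular_value 2 (\<rho> \<gamma>))"
    if \<gamma>: "\<gamma> \<in> carrier G" for \<gamma>
  proof -
    let ?N = "norm (P \<gamma>)"
    have N1: "?N \<ge> 1" using \<gamma> by (rule one_le_norm_P)
    have sing1: "?N / 2 \<le> singular_value 1 (\<rho> \<gamma>)"
    proof -
      have le: "norm (P \<gamma> *v e) \<le> singular_value 1 (\<rho> \<gamma>)" if e: "norm e = 1" for e :: "real^2"
      proof -
        let ?q = "vec4 (e$1) (e$2) 0 0"
        have ee: "vector [e$1, e$2] = e" by (simp add: vec_eq_iff forall_2)
        have "norm ?q \<le> 1" using norm_vec4_le[of "e$1" "e$2" 0 0] e unfolding ee by simp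
        moreover have "1 \<le> norm ?q" using norm_vec4_ge[of "e$1" "e$2" 0 0] e unfolding ee by simp
        ultimately have "norm ?q = 1" by simp
        moreover have "plane_part (\<rho> \<gamma> *v ?q) = P \<gamma> *v e"
          by (simp add: vec_eq_iff forall_2 \<rho>_def block_mat_mult_vec)
        ultimately show ?thesis
          using norm_le_singular_value_1[of "\<rho> \<gamma>" ?q] norm_plane_part_le[of "\<rho> \<gamma> *v ?q"] by simp
      qed
      show ?thesis
        using norm_mat2_le_columns[of "P \<gamma>"] le[of "axis 1 1"] le[of "axis 2 1"] by (simp add: field_simps)
    qed
    \<comment> \<open>The preimage of a basis vector under \<open>P \<gamma>\<close>, for whichever
      column of the inverse has norm at least 1/2.\<close>
    obtain v where v: "v \<noteq> 0" "norm (P \<gamma> *v v) \<le> 2 * norm v"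
    proof -
      have n1: "1 \<le> norm (P (inv \<gamma>))" using \<gamma> by (intro one_le_norm_P) auto
      have "\<exists>i. norm (P (inv \<gamma>) *v axis i 1) \<ge> 1 / 2"
      proof (rule ccontr)
        assume "\<nexists>i. 1 / 2 \<le> norm (P (inv \<gamma>) *v axis i 1)"
        then have "norm (P (inv \<gamma>) *v axis 1 1) < 1/2" "norm (P (inv \<gamma>) *v axis 2 1) < 1/2"
          by (auto simp: not_le)
        then show False using norm_mat2_le_columns[of "P (inv \<gamma>)"] n1 by linarith
      qed
      then obtain i where i: "norm (P (inv \<gamma>) *v axis i 1) \<ge> 1 / 2" by blast
      have "P \<gamma> *v (P (inv \<gamma>) *v axis i 1) = axis i 1"
        using \<gamma> by (simp add: matrix_vector_mul_assoc P_one flip: P_mult)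
      moreover have "P (inv \<gamma>) *v axis i 1 \<noteq> 0" using i by auto
      ultimately show thesis using i by (intro that[of "P (inv \<gamma>) *v axis i 1"]) auto
    qed
    \<comment> \<open>The normal of the hyperplane of vectors whose plane part is parallel to
      v.\<close>
    define w where "w = vec4 (- v$2) (v$1) 0 0"
    have "w \<bullet> q = det2 v (plane_part q)" for q
      by (simp add: w_def inner_vec_def sum_4 det2_def)
    then have bnd: "norm (\<rho> \<gamma> *v q) \<le> (6 * K + 5) * (1 + \<bar>c \<gamma>\<bar>) * norm q" if "w \<bullet> q = 0" for q
      using \<rho>_bound_on_hyperplane[OF \<gamma> v] that by simp
    have d0: "det (\<rho> \<gamma>) \<noteq> 0" using \<gamma> by simp
    have card4: "CARD(4) \<ge> 2" by simp
    note s2 = singular_value_2_bounds[OF card4 d0 bnd]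
    have "singular_value 2 (\<rho> \<gamma>) \<le> (6 * K + 5) * (1 + \<bar>c \<gamma>\<bar>)" by (rule s2(2))
    also have "\<dots> \<le> (6 * K + 5) * (?N powr (1/2) + C * ?N powr (1/2))"
      using C(2)[OF \<gamma>] ge_one_powr_ge_zero[OF N1, of "1/2"] K_nonneg by (intro mult_left_mono add_mono) auto
    also have "\<dots> = E * ?N powr (1/2)" by (simp add: E_def algebra_simps)
    finally have s2': "singular_value 2 (\<rho> \<gamma>) \<le> E * ?N powr (1/2)" .
    have s2p: "0 < singular_value 2 (\<rho> \<gamma>)" by (rule s2(1))
    have Nn: "?N = ?N powr (1/2) * ?N powr (1/2)" using N1 by (simp flip: powr_add)
    have "exp (1/4 * hyp_dist (moebius (P \<gamma>) x0) x0) = exp (hyp_dist (moebius (P \<gamma>) x0) x0) powr (1/4)"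
      by (simp add: powr_def)
    also have "\<dots> \<le> (C0 * ?N\<^sup>2) powr (1/4)"
      using C0(2) \<gamma> by (intro powr_mono2) auto
    also have "\<dots> = C0 powr (1/4) * ?N powr (1/2)"
      using N1 C0(1) by (simp add: powr_mult powr_powr flip: powr_numeral)
    also have "\<dots> \<le> L * (singular_value 1 (\<rho> \<gamma>) / singular_value 2 (\<rho> \<gamma>))"
    proof -
      have "?N powr (1/2) * singular_value 2 (\<rho> \<gamma>) \<le> ?N powr (1/2) * (E * ?N powr (1/2))"
        using s2' by (intro mult_left_mono) auto
      also have "\<dots> = E * ?N" using Nn by (metis mult.left_commute)
      also have "\<dots> \<le> E * (2 * singular_value 1 (\<rho> \<gamma>))" using sing1 E by (intro mult_left_mono) auto
      finally have "?N powr (1/2) \<le> 2 * E * (singular_value 1 (\<rho> \<gamma>) / singular_value 2 (\<rho> \<gamma>))"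
        using s2p by (simp add: field_simps)
      from mult_left_mono[OF this, of "C0 powr (1/4)"] show ?thesis by (simp add: L_def mult_ac)
    qed
    finally show ?thesis .
  qed
  define R where "R = max 1 (ln L)"
  have "L = exp (ln L)" using L by simp
  also have "\<dots> \<le> exp R" by (simp add: R_def)
  finally have R: "R > 0" "L \<le> exp R" by (auto simp: R_def)
  have "exp (1/4 * hyp_dist (moebius (P \<gamma>) x0) x0 - R) \<le> singular_value 1 (\<rho> \<gamma>) / singular_value 2 (\<rho> \<gamma>)"
    if "\<gamma> \<in> carrier G" for \<gamma>
  proof -
    let ?X = "singular_value 1 (\<rho> \<gamma>) / singular_value 2 (\<rho> \<gamma>)"
    have X: "?X > 0" using main[OF that] L by (smt (verit) exp_gt_zero mult_nonneg_nonpos)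
    have "exp (1/4 * hyp_dist (moebius (P \<gamma>) x0) x0) \<le> exp R * ?X"
      using main[OF that] mult_right_mono[OF R(2), of ?X] X by linarith
    then show ?thesis
      unfolding exp_diff pos_divide_le_eq[OF exp_gt_zero] by (simp only: mult.commute)
  qed
  then show ?thesis
    unfolding one_Anosov_def using R(1) \<rho>_hom by (intro conjI exI[of _ R] exI[of _ "1/4"]) auto
qed

end

section \<open>Attracting fixed points\<close>

lemma det2_decomposition: "det2 v w *\<^sub>R y = det2 y w *\<^sub>R v + det2 v y *\<^sub>R w"
  by (simp add: vec_eq_iff forall_2 det2_def algebra_simps)

lemma det2_unit_complement:
  assumes "v \<noteq> 0"
  obtains w where "det2 v w = 1"
proof -
  have "(v$1)\<^sup>2 + (v$2)\<^sup>2 \<noteq> 0" using assms by (simp add: sum_power2_eq_zero_iff vec_eq_iff forall_2)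
  then show thesis
    by (intro that[of "(1 / ((v$1)\<^sup>2 + (v$2)\<^sup>2)) *\<^sub>R vector [- v$2, v$1]"])
      (simp only: det2_scale, simp add: det2_def power2_eq_square)
qed

lemma det2_antisym: "det2 v w = - det2 w v"
  by (simp add: det2_def)

lemma det2_add: "det2 (v + v') w = det2 v w + det2 v' w" "det2 v (w + w') = det2 v w + det2 v w'"
  by (simp_all add: det2_def algebra_simps)

text \<open>In a basis starting with v the matrix is triangular with diagonal l, 1/l; as these
  differ, adding a multiple of v to the second basis vector diagonalises it.\<close>

lemma transverse_eigenvector:
  assumes A: "det A = 1" "A *v v = l *\<^sub>R v" and "v \<noteq> 0" and l: "\<bar>l\<bar> > 1"
  obtains w where "det2 v w = 1" "A *v w = (1 / l) *\<^sub>R w"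
proof -
  obtain w0 where w0: "det2 v w0 = 1" using det2_unit_complement[OF \<open>v \<noteq> 0\<close>] .
  have "l * det2 v (A *v w0) = 1" using det2_mult[of A v w0] A w0 by simp
  then have d: "det2 v (A *v w0) = 1 / l" using l by (auto simp: field_simps)
  define q where "q = det2 (A *v w0) w0"
  have Aw0: "A *v w0 = q *\<^sub>R v + (1 / l) *\<^sub>R w0"
    using det2_decomposition[of v w0 "A *v w0"] by (simp add: w0 d q_def)
  have ne: "1 / l - l \<noteq> 0"
  proof
    assume "1 / l - l = 0"
    then have "l * l = 1" using l by (auto simp: field_simps split: if_splits)
    moreover have "\<bar>l\<bar> * \<bar>l\<bar> > 1" using l by (metis less_1_mult)
    ultimately show False by (simp flip: abs_mult)
  qed
  define s where "s = q / (1 / l - l)"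
  have s: "q + s * l = s * (1 / l)"
  proof -
    have "s * (1 / l - l) = q" using ne by (simp add: s_def)
    then show ?thesis by (simp add: right_diff_distrib)
  qed
  show thesis
  proof (rule that[of "w0 + s *\<^sub>R v"])
    show "det2 v (w0 + s *\<^sub>R v) = 1" using w0 by (simp add: det2_def algebra_simps)
    have "A *v (w0 + s *\<^sub>R v) = (q + s * l) *\<^sub>R v + (1 / l) *\<^sub>R w0"
      by (simp add: matrix_vector_right_distrib matrix_vector_mult_scaleR A(2) Aw0 algebra_simps)
    then show "A *v (w0 + s *\<^sub>R v) = (1 / l) *\<^sub>R (w0 + s *\<^sub>R v)"
      unfolding s by (simp add: scaleR_add_right mult.commute)
  qed
qed

text \<open>The sign of the trace t selects the root of the characteristic polynomial of larger
  modulus, so that no cancellation occurs and its modulus exceeds |t|/2 > 1.\<close>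

lemma hyperbolic_eigenvector:
  fixes A :: "real^2^2"
  assumes "det A = 1" "\<bar>A$1$1 + A$2$2\<bar> > 2"
  obtains v l where "v \<noteq> 0" "A *v v = l *\<^sub>R v" "\<bar>l\<bar> > 1"
proof -
  define t where "t = A$1$1 + A$2$2"
  have t: "\<bar>t\<bar> > 2" using assms by (simp add: t_def)
  have t4: "t\<^sup>2 > 4" using power_strict_mono[OF t, of 2] by simp
  define l where "l = (t + sgn t * sqrt (t\<^sup>2 - 4)) / 2"
  have sg: "sgn t * sgn t = 1" "\<bar>sgn t\<bar> = 1" "\<bar>t\<bar> = sgn t * t" using t by (auto simp: sgn_if)
  have char: "l\<^sup>2 - t * l + 1 = 0"
  proof -
    define s where "s = sgn t * sqrt (t\<^sup>2 - 4)"
    have ss: "s\<^sup>2 = t\<^sup>2 - 4" using t4 sg by (simp add: s_def power_mult_distrib power2_eq_square[of "sgn t"])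
    have "l = (t + s) / 2" by (simp add: l_def s_def)
    then have "2 * l = t + s" by (simp only: nonzero_mult_div_cancel_left times_divide_eq_right)
    then have "2 * l - t = s" by (simp only: add_diff_cancel_left')
    then have "(2 * l - t)\<^sup>2 = t\<^sup>2 - 4" by (simp only: ss)
    then show ?thesis by (simp add: power2_eq_square algebra_simps)
  qed
  define x where "x = sgn t * l"
  have "2 * l = t + sgn t * sqrt (t\<^sup>2 - 4)"
    by (simp only: l_def nonzero_mult_div_cancel_left times_divide_eq_right)
  then have "sgn t * (2 * l) = \<bar>t\<bar> + (sgn t * sgn t) * sqrt (t\<^sup>2 - 4)"
    by (simp only: distrib_left sg(3) mult.assoc)
  then have "2 * x = \<bar>t\<bar> + sqrt (t\<^sup>2 - 4)"
    unfolding sg(1) by (simp add: x_def mult.left_commute)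
  moreover have "sqrt (t\<^sup>2 - 4) > 0" using t4 by simp
  ultimately have "x > 1" using t by linarith
  then have "sgn t * l > 1" by (simp only: x_def)
  then have l1: "\<bar>l\<bar> > 1" using sg(2) by (metis abs_ge_self abs_mult less_le_trans mult_1)
  have "det (A - l *\<^sub>R mat 1) = 0"
    using char assms(1) by (simp add: det_2 mat_def t_def power2_eq_square algebra_simps)
  then have "\<not> invertible (A - l *\<^sub>R mat 1)" by (simp add: invertible_det_nz)
  then obtain v where "v \<noteq> 0" "(A - l *\<^sub>R mat 1) *v v = 0"
    unfolding invertible_left_inverse matrix_left_invertible_ker by blast
  then have "A *v v = l *\<^sub>R v"
    by (simp add: vec_eq_iff forall_2 mat_def algebra_simps)
  from that[OF \<open>v \<noteq> 0\<close> this l1] show thesis .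
qed

section \<open>Eigenvalues at attracting boundary points\<close>

context matrix_lattice
begin

lemma P_pow_eigenvector:
  assumes "\<gamma> \<in> carrier G" "P \<gamma> *v v = l *\<^sub>R v"
  shows "P (\<gamma> [^] (n::nat)) *v v = (l ^ n) *\<^sub>R v"
  using assms
  by (induction n) (simp_all add: P_one P_mult matrix_vector_mult_scaleR flip: matrix_vector_mul_assoc)

lemma boundary_vec_moebius_funpow:
  assumes "\<gamma> \<in> carrier G"
  shows "\<exists>k. k \<noteq> 0 \<and> boundary_vec ((moebius_boundary (P \<gamma>) ^^ n) y) = k *\<^sub>R (P (\<gamma> [^] n) *v boundary_vec y)"
proof (induction n)
  case 0
  then show ?case by (intro exI[of _ 1]) (simp add: P_one)
next
  case (Suc n)
  then obtain k where k: "k \<noteq> 0" "boundary_vec ((moebius_boundary (P \<gamma>) ^^ n) y) = k *\<^sub>R (P (\<gamma> [^] n) *v boundary_vec y)"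
    by blast
  obtain k' where k': "k' \<noteq> 0" "boundary_vec (moebius_boundary (P \<gamma>) ((moebius_boundary (P \<gamma>) ^^ n) y))
      = k' *\<^sub>R (P \<gamma> *v boundary_vec ((moebius_boundary (P \<gamma>) ^^ n) y))"
    using boundary_vec_moebius[OF P_det[OF assms]] by metis
  have "P (\<gamma> [^] Suc n) = P \<gamma> ** P (\<gamma> [^] n)"
    using assms by (simp only: nat_pow_Suc2 P_mult nat_pow_closed)
  then show ?case using k k'
    by (intro exI[of _ "k' * k"]) (simp add: matrix_vector_mult_scaleR flip: matrix_vector_mul_assoc)
qed

text \<open>If \<open>\<bar>l\<bar> \<le> 1\<close>, at least one of the preimages under \<open>\<gamma>\<^sup>n\<close> of two given points, chosen far apart
  along the horocycle, stays close to \<open>x\<close>, although its \<open>n\<close>-th iterate does not.\<close>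

lemma attracting_boundary_eigenvalue:
  assumes x0: "x0 \<in> hyp_plane" and \<gamma>: "\<gamma> \<in> carrier G"
    and att: "attracting_fixed_point UNIV (visual_dist x0) (moebius_boundary (P \<gamma>)) x"
  obtains l where "P \<gamma> *v boundary_vec x = l *\<^sub>R boundary_vec x" "\<bar>l\<bar> > 1"
proof -
  define V where "V = boundary_vec x"
  have V: "V \<noteq> 0" by (simp add: V_def)
  obtain k0 where k0: "k0 \<noteq> 0" "boundary_vec (moebius_boundary (P \<gamma>) x) = k0 *\<^sub>R (P \<gamma> *v V)"
    using boundary_vec_moebius[OF P_det[OF \<gamma>]] unfolding V_def by metis
  define l where "l = 1 / k0"
  have l0: "l \<noteq> 0" using k0 by (simp add: l_def)
  have "V = k0 *\<^sub>R (P \<gamma> *v V)"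
    using att k0(2) by (simp add: attracting_fixed_point_def V_def)
  then have "l *\<^sub>R V = l *\<^sub>R (k0 *\<^sub>R (P \<gamma> *v V))" by simp
  then have PV: "P \<gamma> *v V = l *\<^sub>R V" using k0 by (simp add: l_def)
  have "\<bar>l\<bar> > 1"
  proof (rule ccontr)
    assume "\<not> \<bar>l\<bar> > 1"
    then have l1: "\<bar>l\<bar> \<le> 1" by simp
    obtain r where r: "r > 0" "\<And>e. e > 0 \<Longrightarrow> \<exists>N. \<forall>n\<ge>N. \<forall>y. visual_dist x0 x y < r \<longrightarrow>
        visual_dist x0 x ((moebius_boundary (P \<gamma>) ^^ n) y) < e"
      using att by (auto simp: attracting_fixed_point_def)
    let ?N = "based_norm x0"
    have i0: "Im x0 > 0" using x0 by (simp add: hyp_plane_def)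
    have NV: "?N V > 0" by (rule based_norm_pos[OF x0 V])
    \<comment> \<open>Chosen so that T r N(V)^2, with N the based norm, exceeds 2 Im x0, the total
      of the two bounds \<open>zr\<close>.\<close>
    define T where "T = 2 * Im x0 / (r * (?N V)\<^sup>2) + 1"
    have T: "T > 0" using i0 r NV by (simp add: T_def add_pos_pos)
    obtain w where w: "det2 V w = 1" using det2_unit_complement[OF V] .
    define u where "u i = w + (if i then T else 0) *\<^sub>R V" for i
    have du: "det2 V (u i) = 1" for i using w by (simp add: u_def det2_add) (simp add: det2_def)
    have u0: "u i \<noteq> 0" for i using du[of i] by (auto simp: det2_def)
    define e where "e i = Im x0 / (?N V * ?N (u i))" for i
    have e: "e i > 0" for i using i0 NV based_norm_pos[OF x0 u0[of i]] by (simp add: e_def)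
    obtain n where n: "\<And>y. visual_dist x0 x y < r \<Longrightarrow>
        visual_dist x0 x ((moebius_boundary (P \<gamma>) ^^ n) y) < min (e True) (e False)"
      using r(2)[of "min (e True) (e False)"] e by auto
    define g where "g = \<gamma> [^] n"
    have g: "g \<in> carrier G" "inv g \<in> carrier G" using \<gamma> by (auto simp: g_def)
    have inv1: "P g *v (P (inv g) *v y) = y" "P (inv g) *v (P g *v y) = y" for y
      using g by (simp_all add: matrix_vector_mul_assoc P_one flip: P_mult)
    have gV: "P g *v V = (l ^ n) *\<^sub>R V" unfolding g_def by (rule P_pow_eigenvector[OF \<gamma> PV])
    have ln: "l ^ n \<noteq> 0" "\<bar>l ^ n\<bar> \<le> 1" using l0 l1 by (auto simp: power_abs power_le_one)
    define z where "z i = P (inv g) *v u i" for i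
    have gz: "P g *v z i = u i" for i by (simp add: z_def inv1)
    have z0: "z i \<noteq> 0" for i using gz[of i] u0[of i] by auto
    have dz: "det2 V (z i) = l ^ n" for i
      using det2_mult[of "P g" V "z i"] g du[of i] by (simp add: gV gz)
    \<comment> \<open>If the point of \<open>z i\<close> were within r of x, its n-th iterate, the
      point of \<open>u i\<close>, would be closer to x than its actual distance \<open>e i\<close>.
      The distance is thus at least r, which bounds \<open>z i\<close>.\<close>
    have zr: "r * (?N V * ?N (z i)) \<le> Im x0" for i
    proof -
      obtain y k where y: "k \<noteq> 0" "boundary_vec y = k *\<^sub>R z i" using boundary_vec_surj[OF z0] by metis
      obtain k' where k': "k' \<noteq> 0" "boundary_vec ((moebius_boundary (P \<gamma>) ^^ n) y) = k' *\<^sub>R (P g *v boundary_vec y)"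
        using boundary_vec_moebius_funpow[OF \<gamma>] unfolding g_def by metis
      have Vx: "boundary_vec x = 1 *\<^sub>R V" by (simp add: V_def)
      have "boundary_vec ((moebius_boundary (P \<gamma>) ^^ n) y) = (k' * k) *\<^sub>R u i"
        using k' y by (simp add: matrix_vector_mult_scaleR gz)
      then have "visual_dist x0 x ((moebius_boundary (P \<gamma>) ^^ n) y) = e i"
        using visual_dist_vec[OF x0 Vx, of _ "k' * k" "u i"] k' y by (simp add: e_def du)
      moreover have "min (e True) (e False) \<le> e i" by (cases i) auto
      ultimately have "\<not> visual_dist x0 x y < r" using n[of y] by auto
      then have "r \<le> visual_dist x0 x y" by simp
      also have "\<dots> = Im x0 * \<bar>l ^ n\<bar> / (?N V * ?N (z i))"
        using visual_dist_vec[OF x0 Vx y(2) _ y(1)] by (simp add: dz)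
      also have "\<dots> \<le> Im x0 * 1 / (?N V * ?N (z i))"
        using ln i0 NV based_norm_pos[OF x0 z0[of i]] by (intro divide_right_mono mult_left_mono) auto
      finally show ?thesis using NV based_norm_pos[OF x0 z0[of i]] by (simp add: field_simps)
    qed
    have "z True - z False = T *\<^sub>R (P (inv g) *v V)"
      by (simp add: z_def u_def matrix_vector_right_distrib matrix_vector_mult_scaleR)
    moreover have "P (inv g) *v V = (1 / l ^ n) *\<^sub>R V"
    proof -
      have "(l ^ n) *\<^sub>R (P (inv g) *v V) = V" using inv1(2)[of V] by (simp add: gV matrix_vector_mult_scaleR)
      then have "(1 / l ^ n) *\<^sub>R ((l ^ n) *\<^sub>R (P (inv g) *v V)) = (1 / l ^ n) *\<^sub>R V" by (simp only:)
      moreover have "1 / l ^ n * l ^ n = 1" unfolding times_divide_eq_left mult_1 by (rule divide_self[OF ln(1)])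
      ultimately show ?thesis by (simp only: scaleR_scaleR scaleR_one)
    qed
    ultimately have "?N (z True - z False) = T * (1 / \<bar>l ^ n\<bar>) * ?N V"
      using T by (simp add: based_norm_scale)
    also have "\<dots> \<ge> T * 1 * ?N V"
      using T NV ln by (intro mult_right_mono mult_left_mono) (auto simp: field_simps)
    finally have "T * ?N V \<le> ?N (z True) + ?N (z False)"
      using based_norm_diff[of x0 "z True" "z False"] by linarith
    then have "(r * ?N V) * (T * ?N V) \<le> (r * ?N V) * (?N (z True) + ?N (z False))"
      using r NV by (intro mult_left_mono) auto
    also have "\<dots> \<le> 2 * Im x0" using zr[of True] zr[of False] by (simp add: algebra_simps)
    finally have "T * (r * (?N V)\<^sup>2) \<le> 2 * Im x0" by (simp add: power2_eq_square mult_ac)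
    moreover have "T * (r * (?N V)\<^sup>2) = 2 * Im x0 + r * (?N V)\<^sup>2"
      using r NV by (simp add: T_def distrib_right)
    moreover have "r * (?N V)\<^sup>2 > 0" using r NV by simp
    ultimately show False by linarith
  qed
  with PV show thesis by (intro that[of l]) (simp_all add: V_def)
qed

end

section \<open>Dynamics, span and regularity of the limit map\<close>

context lattice_section
begin

lemma c_pow: "\<gamma> \<in> carrier G \<Longrightarrow> c (\<gamma> [^] (n::nat)) = real n * c \<gamma>"
proof (induction n)
  case 0
  have "c (\<one> \<otimes> \<one>) = c \<one> + c \<one>" by (rule c_mult) auto
  then show ?case by simp
qed (simp add: c_mult algebra_simps)

lemma proj_action_funpow:
  assumes "\<gamma> \<in> carrier G"
  shows "(proj_action (\<rho> \<gamma>) ^^ n) (span {q}) = span {\<rho> (\<gamma> [^] n) *v q}"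
proof (induction n)
  case 0
  have "\<rho> \<one> = mat 1"
    using hom_one[OF \<rho>_hom(1) is_group group_SL] by simp
  then show ?case by simp
next
  case (Suc n)
  have "\<rho> (\<gamma> [^] Suc n) = \<rho> \<gamma> ** \<rho> (\<gamma> [^] n)"
    using assms by (simp only: nat_pow_Suc2 \<rho>_mult nat_pow_closed)
  then show ?case using Suc by (simp add: proj_action_span matrix_vector_mul_assoc)
qed

text \<open>A vector near the fixed line is a nonzero multiple of p plus a vector u in an invariant
  complementary hyperplane. The n-th power multiplies p by l^n and u by at most a linear function of
  n, so the lines converge at the rate n l^-n, uniformly.\<close>

lemma \<xi>_attracting:
  assumes x0: "x0 \<in> hyp_plane" and \<gamma>: "\<gamma> \<in> carrier G"
    and att: "attracting_fixed_point UNIV (visual_dist x0) (moebius_boundary (P \<gamma>)) x"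
  shows "attracting_fixed_point proj_space proj_dist (proj_action (\<rho> \<gamma>)) (\<xi> x)"
proof -
  define V where "V = boundary_vec x"
  have V: "V \<noteq> 0" by (simp add: V_def)
  obtain l where l: "P \<gamma> *v V = l *\<^sub>R V" "\<bar>l\<bar> > 1"
    using attracting_boundary_eigenvalue[OF x0 \<gamma> att] unfolding V_def by metis
  obtain w where w: "det2 V w = 1" "P \<gamma> *v w = (1 / l) *\<^sub>R w"
    using transverse_eigenvector[OF P_det[OF \<gamma>] l(1) V l(2)] .
  have w0: "w \<noteq> 0" using w(1) by (auto simp: det2_def)
  define p where "p = lift V"
  have p0: "p \<noteq> 0" unfolding p_def by (rule lift_nz[OF V])
  have \<xi>x: "\<xi> x = span {p}" by (simp add: \<xi>_def p_def V_def)
  \<comment> \<open>The V-coordinate of the plane part in the basis V, w. Its kernel is the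
    hyperplane complementary to the line of p and invariant under
    \<open>\<rho> \<gamma>\<close>.\<close>
  define \<kappa> where "\<kappa> q = det2 (plane_part q) w" for q
  have \<kappa>_lin: "\<kappa> (q + q') = \<kappa> q + \<kappa> q'" "\<kappa> (k *\<^sub>R q) = k * \<kappa> q" for q q' k
    by (simp_all add: \<kappa>_def det2_def algebra_simps)
  have \<kappa>p: "\<kappa> p = 1"
    using w(1) by (simp add: \<kappa>_def p_def lift_def det2_def)
  have \<kappa>_bound: "\<bar>\<kappa> q\<bar> \<le> norm q * norm w" for q
    unfolding \<kappa>_def
    by (rule order_trans[OF abs_det2_le mult_right_mono[OF norm_plane_part_le]]) simp
  define np nw where "np = norm p" and "nw = norm w"
  have np: "np > 0" "nw \<ge> 0" using p0 by (auto simp: np_def nw_def)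
  \<comment> \<open>With r U = 1/2, a unit vector q within r of the line of p satisfies
    |\<open>\<kappa> q\<close>| norm p at least 1 - r - r nw np = 1/2.\<close>
  define U where "U = 1 + nw * np"
  have U: "U \<ge> 1" using np by (simp add: U_def)
  define r where "r = 1 / (2 * U)"
  have r: "r > 0" "r * U = 1 / 2" using U by (auto simp: r_def)
  define C where "C = 6 * K + 5"
  have C: "C > 0" using K_nonneg by (simp add: C_def)
  define B where "B n = 6 * C * (1 + real n * \<bar>c \<gamma>\<bar>) * U * (1 / \<bar>l\<bar>) ^ n" for n
  have "(\<lambda>n. 6 * C * U * ((1 / \<bar>l\<bar>) ^ n + \<bar>c \<gamma>\<bar> * (real n * (1 / \<bar>l\<bar>) ^ n))) \<longlonglongrightarrow> 6 * C * U * (0 + \<bar>c \<gamma>\<bar> * 0)"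
    using l(2) by (intro tendsto_intros LIMSEQ_realpow_zero powser_times_n_limit_0) auto
  then have Blim: "B \<longlonglongrightarrow> 0"
    by (simp add: B_def[abs_def] algebra_simps)
  have main: "proj_dist (span {p}) ((proj_action (\<rho> \<gamma>) ^^ n) Y) \<le> B n"
    if Y: "Y \<in> proj_space" "proj_dist (span {p}) Y < r" for Y n
  proof -
    obtain q0 where q0: "q0 \<noteq> 0" "Y = span {q0}" using Y by (auto simp: proj_space_def)
    define q where "q = q0 /\<^sub>R norm q0"
    have q: "norm q = 1" "q \<noteq> 0" using q0 by (auto simp: q_def)
    have Yq: "Y = span {q}" unfolding q_def q0(2) using q0(1) by (subst span_singleton_scale) auto
    define s where "s = (q \<bullet> p) / (p \<bullet> p)"
    define e where "e = q - s *\<^sub>R p"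
    have "norm e * np = wedge_norm p q"
      unfolding e_def s_def np_def wedge_norm_commute[of p q] by (rule norm_orthogonal_part[OF p0])
    then have "norm e = wedge_norm p q / (norm p * norm q)" using np q by (simp add: np_def field_simps)
    also have "\<dots> < r" using proj_dist_bounds(1)[OF p0 q(2)] Y(2) Yq by simp
    finally have er: "norm e < r" .
    have qs: "q = s *\<^sub>R p + e" by (simp add: e_def)
    have "1 \<le> \<bar>s\<bar> * np + norm e" using norm_triangle_ineq[of "s *\<^sub>R p" e] q(1) by (simp add: np_def flip: qs)
    then have s1: "\<bar>s\<bar> * np \<ge> 1 - r" using er by linarith
    have \<kappa>q: "\<kappa> q = s + \<kappa> e" by (subst qs) (simp add: \<kappa>_lin \<kappa>p)
    have "\<bar>\<kappa> e\<bar> * np \<le> r * nw * np"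
    proof (rule mult_right_mono)
      show "\<bar>\<kappa> e\<bar> \<le> r * nw"
        using \<kappa>_bound[of e] mult_right_mono[of "norm e" r nw] er np by (simp add: nw_def)
    qed (use np in simp)
    moreover have "\<bar>\<kappa> q\<bar> * np \<ge> \<bar>s\<bar> * np - \<bar>\<kappa> e\<bar> * np"
      using np mult_right_mono[of "\<bar>s\<bar> - \<bar>\<kappa> e\<bar>" "\<bar>\<kappa> q\<bar>" np] by (simp add: \<kappa>q left_diff_distrib)
    moreover have "r + r * nw * np = 1 / 2" using r(2) by (simp add: U_def algebra_simps)
    ultimately have \<kappa>low: "\<bar>\<kappa> q\<bar> * np \<ge> 1 / 2" using s1 by linarith
    then have \<kappa>0: "\<kappa> q \<noteq> 0" by auto
    define u where "u = q - \<kappa> q *\<^sub>R p"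
    have "norm u \<le> norm q + \<bar>\<kappa> q\<bar> * np" unfolding u_def np_def by (metis norm_scaleR norm_triangle_ineq4)
    also have "\<dots> \<le> 1 + nw * np" using \<kappa>_bound[of q] q np by (intro add_mono mult_right_mono) (auto simp: nw_def)
    finally have uU: "norm u \<le> U" by (simp add: U_def)
    have "\<kappa> u = \<kappa> q + \<kappa> ((- \<kappa> q) *\<^sub>R p)" by (simp add: u_def flip: \<kappa>_lin(1))
    then have "\<kappa> u = 0" by (simp only: \<kappa>_lin(2) \<kappa>p)
    then have du: "det2 w (plane_part u) = 0" using det2_antisym[of w "plane_part u"] by (simp add: \<kappa>_def)
    define g where "g = \<gamma> [^] n"
    have g: "g \<in> carrier G" using \<gamma> by (simp add: g_def)
    have ln: "\<bar>l\<bar> ^ n \<ge> 1" using l(2) by (simp add: one_le_power)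
    have "norm (P g *v w) = (1 / \<bar>l\<bar> ^ n) * norm w"
      unfolding g_def P_pow_eigenvector[OF \<gamma> w(2)] by (simp add: power_abs power_one_over)
    also have "\<dots> \<le> 2 * norm w"
    proof (rule mult_right_mono)
      have "1 / \<bar>l\<bar> ^ n \<le> 1 / 1" using ln l(2) by (intro divide_left_mono) auto
      then show "1 / \<bar>l\<bar> ^ n \<le> 2" by simp
    qed simp
    finally have "norm (\<rho> g *v u) \<le> C * (1 + \<bar>c g\<bar>) * norm u"
      unfolding C_def by (intro \<rho>_bound_on_hyperplane[OF g w0 _ du])
    also have "\<dots> \<le> C * (1 + \<bar>c g\<bar>) * U" using uU C by (intro mult_left_mono) auto
    also have "\<bar>c g\<bar> = real n * \<bar>c \<gamma>\<bar>" by (simp add: g_def c_pow \<gamma> abs_mult)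
    finally have gu: "norm (\<rho> g *v u) \<le> C * (1 + real n * \<bar>c \<gamma>\<bar>) * U" .
    define m where "m = \<kappa> q * l ^ n"
    have m0: "m \<noteq> 0" using \<kappa>0 l(2) by (auto simp: m_def)
    have gp: "\<rho> g *v p = (l ^ n) *\<^sub>R p"
      unfolding p_def \<rho>_lift[OF g] unfolding g_def P_pow_eigenvector[OF \<gamma> l(1)] lift_scale ..
    have "q = \<kappa> q *\<^sub>R p + u" by (simp add: u_def)
    then have "\<rho> g *v q = \<rho> g *v (\<kappa> q *\<^sub>R p + u)" by simp
    then have gq: "\<rho> g *v q = m *\<^sub>R p + \<rho> g *v u"
      by (simp add: matrix_vector_right_distrib matrix_vector_mult_scaleR gp m_def)
    have gq0: "\<rho> g *v q \<noteq> 0"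
    proof
      assume "\<rho> g *v q = 0"
      moreover have "invertible (\<rho> g)" using g by (simp add: invertible_det_nz)
      ultimately show False
        using q(2) unfolding invertible_left_inverse matrix_left_invertible_ker by blast
    qed
    define q' where "q' = (1 / m) *\<^sub>R (\<rho> g *v q)"
    have q'0: "q' \<noteq> 0" using gq0 m0 by (simp add: q'_def)
    have pq': "p - q' = - (1 / m) *\<^sub>R (\<rho> g *v u)"
      using m0 by (simp add: q'_def gq scaleR_add_right)
    have "(proj_action (\<rho> \<gamma>) ^^ n) Y = span {\<rho> g *v q}" unfolding Yq g_def by (rule proj_action_funpow[OF \<gamma>])
    also have "\<dots> = span {q'}" unfolding q'_def using m0 by (subst span_singleton_scale) auto
    finally have "proj_dist (span {p}) ((proj_action (\<rho> \<gamma>) ^^ n) Y) \<le> 3 * norm (p - q') / np"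
      unfolding np_def using proj_dist_le_norm_diff[OF p0 q'0] by simp
    also have "norm (p - q') = norm (\<rho> g *v u) / (\<bar>\<kappa> q\<bar> * \<bar>l\<bar> ^ n)"
      unfolding pq' by (simp add: m_def abs_mult power_abs)
    also have "3 * (norm (\<rho> g *v u) / (\<bar>\<kappa> q\<bar> * \<bar>l\<bar> ^ n)) / np
        = 3 * norm (\<rho> g *v u) / (\<bar>\<kappa> q\<bar> * np) * (1 / \<bar>l\<bar>) ^ n"
      by (simp add: power_one_over field_simps)
    also have "\<dots> \<le> 3 * (C * (1 + real n * \<bar>c \<gamma>\<bar>) * U) / (1 / 2) * (1 / \<bar>l\<bar>) ^ n"
      using gu \<kappa>low order_trans[OF norm_ge_zero gu] by (intro mult_right_mono frac_le mult_left_mono) auto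
    also have "\<dots> = B n" by (simp add: B_def)
    finally show ?thesis .
  qed
  show ?thesis
    unfolding attracting_fixed_point_def
  proof (intro conjI exI[of _ r] r(1) allI impI)
    show "\<xi> x \<in> proj_space" using \<xi>_range by blast
    have "moebius_boundary (P \<gamma>) x = x" using att by (simp add: attracting_fixed_point_def)
    then show "proj_action (\<rho> \<gamma>) (\<xi> x) = \<xi> x" using \<xi>_equivariant[OF \<gamma>, of x] by simp
    fix e :: real assume "e > 0"
    then obtain N where N: "\<And>n. n \<ge> N \<Longrightarrow> B n < e"
      using order_tendstoD(2)[OF Blim] by (auto simp: eventually_sequentially)
    show "\<exists>N. \<forall>n\<ge>N. \<forall>y\<in>proj_space. proj_dist (\<xi> x) y < r \<longrightarrow> proj_dist (\<xi> x) ((proj_action (\<rho> \<gamma>) ^^ n) y) < e"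
    proof (intro exI[of _ N] allI ballI impI)
      fix n Y assume "N \<le> n" "Y \<in> proj_space" "proj_dist (\<xi> x) Y < r"
      then show "proj_dist (\<xi> x) ((proj_action (\<rho> \<gamma>) ^^ n) Y) < e"
        using main[of Y n] N[of n] unfolding \<xi>x by linarith
    qed
  qed
qed

lemma \<xi>_limit_map:
  assumes "x0 \<in> hyp_plane"
  shows "Anosov_limit_map x0 G P \<rho> \<xi>"
  unfolding Anosov_limit_map_def
  by (intro conjI allI impI ballI \<xi>_range \<xi>_continuous[OF assms] \<xi>_equivariant \<xi>_attracting[OF assms])

text \<open>A hyperplane containing the curve is a linear relation between v, f v and h v.
  Subtracting the relation at v from that at \<open>P \<gamma> *v v\<close> eliminates h and leaves
  \<open>c \<gamma>\<close> times f as a linear function, against nonlinearity; then f drops out for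
  the same reason.\<close>

lemma \<xi>_spanning:
  assumes nonlinear: "\<And>l. \<exists>v. f v \<noteq> l \<bullet> v" and \<gamma>: "\<gamma> \<in> carrier G" "c \<gamma> \<noteq> 0"
  shows "span (\<Union>x. \<xi> x) = UNIV"
proof (rule ccontr)
  assume "span (\<Union>x. \<xi> x) \<noteq> UNIV"
  then obtain m where m: "m \<noteq> 0" "span (\<Union>x. \<xi> x) \<subseteq> {q. m \<bullet> q = 0}"
    using span_not_univ_subset_hyperplane by blast
  define m' where "m' = plane_part m"
  have van: "m' \<bullet> v + m$3 * f v + m$4 * h v = 0" for v
  proof -
    have "m \<bullet> lift v = 0"
    proof (cases "v = 0")
      case True
      then show ?thesis using lift_scale[of 0 v] by simp
    next
      case False
      then obtain x k where "k \<noteq> 0" "boundary_vec x = k *\<^sub>R v" using boundary_vec_surj by metis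
      then have "lift v \<in> \<xi> x" using \<xi>_eq by (simp add: span_base)
      then show ?thesis using m(2) span_base[of "lift v" "\<Union>x. \<xi> x"] by auto
    qed
    then show ?thesis by (simp add: lift_def inner_vec_def sum_4 sum_2 m'_def)
  qed
  have m4: "m$4 = 0"
  proof (rule ccontr)
    assume nz: "m$4 \<noteq> 0"
    define l where "l = m' v* P \<gamma> - m' + m$3 *\<^sub>R a \<gamma> + m$4 *\<^sub>R b \<gamma>"
    have "f v = (- (1 / (m$4 * c \<gamma>)) *\<^sub>R l) \<bullet> v" for v
    proof -
      have "l \<bullet> v + m$4 * c \<gamma> * f v = 0"
        using van[of v] van[of "P \<gamma> *v v"] f_equiv[OF \<gamma>(1), of v] h_equiv[OF \<gamma>(1), of v]
        by (simp add: l_def inner_add_left inner_diff_left dot_lmul_matrix algebra_simps)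
      then have "m$4 * c \<gamma> * f v = - (l \<bullet> v)" by linarith
      then show ?thesis using nz \<gamma>(2) by (simp add: field_simps)
    qed
    then show False using nonlinear by blast
  qed
  have m3: "m$3 = 0"
  proof (rule ccontr)
    assume nz: "m$3 \<noteq> 0"
    have "f v = (- (1 / m$3) *\<^sub>R m') \<bullet> v" for v
    proof -
      have "m$3 * f v = - (m' \<bullet> v)" using van[of v] m4 by simp
      then show ?thesis using nz by (simp add: field_simps)
    qed
    then show False using nonlinear by blast
  qed
  have "m' \<bullet> m' = 0" using van[of m'] m3 m4 by simp
  then have "m' = 0" by simp
  then have "m$1 = 0" "m$2 = 0" by (simp_all add: m'_def vec_eq_iff forall_2)
  then have "m = 0" using m3 m4 by (simp add: vec4_eq_iff)
  then show False using m(1) by simp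
qed

text \<open>Along \<open>\<gamma>\<^sup>n v \<rightarrow> \<gamma>\<^sup>+\<close> the visual distance to \<open>\<gamma>\<^sup>+\<close> decays like \<open>l\<^bsup>-2n\<^esup>\<close>, while the unipotent
  block \<open>c (\<gamma>\<^sup>n) = n c \<gamma>\<close> makes the projective distance decay only like \<open>n l\<^bsup>-n\<^esup>\<close>.\<close>

lemma \<xi>_not_Hoelder:
  assumes x0: "x0 \<in> hyp_plane" and nonlinear: "\<And>l. \<exists>v. f v \<noteq> l \<bullet> v"
    and \<gamma>: "\<gamma> \<in> carrier G" "c \<gamma> \<noteq> 0"
  shows "\<not> is_Hoelder (visual_dist x0) proj_dist (1 / 2) \<xi>"
proof
  assume "is_Hoelder (visual_dist x0) proj_dist (1 / 2) \<xi>"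
  then obtain C where C: "C > 0" "\<And>x y. proj_dist (\<xi> x) (\<xi> y) \<le> C * sqrt (visual_dist x0 x y)"
    using visual_dist_nonneg[OF x0] by (auto simp: is_Hoelder_def powr_half_sqrt)
  have i0: "Im x0 > 0" using x0 by (simp add: hyp_plane_def)
  obtain V l where V: "V \<noteq> 0" "P \<gamma> *v V = l *\<^sub>R V" "\<bar>l\<bar> > 1"
    using hyperbolic_eigenvector[OF P_det[OF \<gamma>(1)] hom_real_nonzero_hyperbolic[OF c_hom \<gamma>]] .
  obtain w where w: "det2 V w = 1" "P \<gamma> *v w = (1 / l) *\<^sub>R w"
    using transverse_eigenvector[OF P_det[OF \<gamma>(1)] V(2,1,3)] .
  have w0: "w \<noteq> 0" using w(1) by (auto simp: det2_def)
  \<comment> \<open>The linear functional that agrees with f at V and at w, by Cramer's rule with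
    \<open>det2 V w\<close> = 1; v is a vector where f deviates from it.\<close>
  define u :: "real^2" where "u = vector [w$2 * f V - V$2 * f w, V$1 * f w - w$1 * f V]"
  obtain v where v: "f v \<noteq> u \<bullet> v" using nonlinear by blast
  define \<alpha> \<beta> where "\<alpha> = det2 v w" and "\<beta> = det2 V v"
  have vab: "v = \<alpha> *\<^sub>R V + \<beta> *\<^sub>R w" using det2_decomposition[of V w v] w(1) by (simp add: \<alpha>_def \<beta>_def)
  define \<Delta>f \<Delta>h where "\<Delta>f = f v - \<alpha> * f V - \<beta> * f w" and "\<Delta>h = h v - \<alpha> * h V - \<beta> * h w"
  have "u \<bullet> v = \<alpha> * f V + \<beta> * f w"
    by (simp add: u_def \<alpha>_def \<beta>_def det2_def inner_vec_def sum_2 algebra_simps)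
  then have \<Delta>f: "\<Delta>f \<noteq> 0" using v by (simp add: \<Delta>f_def)
  have \<alpha>: "\<alpha> \<noteq> 0"
  proof
    assume "\<alpha> = 0"
    then have "v = \<beta> *\<^sub>R w" using vab by simp
    then show False using \<Delta>f \<open>\<alpha> = 0\<close> by (simp add: \<Delta>f_def f_scale)
  qed
  \<comment> \<open>A coordinate in which V does not vanish. Paired with the fourth coordinate it
    gives a minor of \<open>lift y\<close> and \<open>lift V\<close> that detects h.\<close>
  obtain i where i: "V$i \<noteq> 0" using V(1) by (auto simp: vec_eq_iff)
  define j :: 4 where "j = (if i = 1 then 1 else 2)"
  have lift_j: "lift y $ j = y $ i" for y
    using exhaust_2[of i] by (auto simp: lift_def j_def)
  obtain x where x: "\<exists>k. k \<noteq> 0 \<and> boundary_vec x = k *\<^sub>R V" using boundary_vec_surj[OF V(1)] by metis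
  then have \<xi>x: "\<xi> x = span {lift V}" using \<xi>_eq by blast
  define L where "L = \<bar>l\<bar>"
  have L: "L > 1" using V(3) by (simp add: L_def)
  define M0 where "M0 = \<bar>\<Delta>h\<bar> * \<bar>V$i\<bar> + \<bar>\<beta>\<bar> * (\<bar>h V\<bar> * \<bar>w$i\<bar> + \<bar>h w\<bar> * \<bar>V$i\<bar>)"
  define M1 where "M1 = (1 + 2 * K) * (\<bar>\<alpha>\<bar> * norm V + \<bar>\<beta>\<bar> * norm w)"
  define M2 where "M2 = \<bar>\<beta>\<bar> * based_norm x0 w / (\<bar>\<alpha>\<bar> * based_norm x0 V)"
  define M where "M = M0 + 2 * C * sqrt M2 * M1 * norm (lift V)"
  have M1: "M1 > 0"
    unfolding M1_def using K_nonneg \<alpha> V(1) by (intro mult_pos_pos add_pos_nonneg) auto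
  have bound: "real n * (\<bar>c \<gamma>\<bar> * \<bar>\<Delta>f\<bar> * \<bar>V$i\<bar>) \<le> M" for n :: nat
  proof -
    define g where "g = \<gamma> [^] n"
    have g: "g \<in> carrier G" using \<gamma> by (simp add: g_def)
    have Ln: "L ^ n \<ge> 1" using L by (simp add: one_le_power)
    have l0: "l ^ n \<noteq> 0" using V(3) by auto
    have al: "\<bar>l ^ n\<bar> = L ^ n" "\<bar>(1 / l) ^ n\<bar> = 1 / L ^ n"
      by (simp_all add: L_def power_abs power_one_over)
    have gV: "P g *v V = (l ^ n) *\<^sub>R V" unfolding g_def by (rule P_pow_eigenvector[OF \<gamma>(1) V(2)])
    have gw: "P g *v w = ((1 / l) ^ n) *\<^sub>R w" unfolding g_def by (rule P_pow_eigenvector[OF \<gamma>(1) w(2)])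
    define y where "y = P g *v v"
    have y: "y = (\<alpha> * l ^ n) *\<^sub>R V + (\<beta> * (1 / l) ^ n) *\<^sub>R w"
      unfolding y_def vab by (simp only: matrix_vector_right_distrib matrix_vector_mult_scaleR gV gw scaleR_scaleR)
    have cg: "c g = real n * c \<gamma>" by (simp add: g_def c_pow \<gamma>)
    \<comment> \<open>Equivariance on the two eigenvectors expresses the cocycle \<open>b g\<close>
      through h and f, so \<open>h y\<close> becomes explicit.\<close>
    have bV: "b g \<bullet> V = l ^ n * h V - h V - c g * f V" using h_equiv[OF g, of V] by (simp add: gV h_scale)
    have bw: "b g \<bullet> w = (1 / l) ^ n * h w - h w - c g * f w" using h_equiv[OF g, of w] by (simp add: gw h_scale)
    have "h y = h v + c g * f v + b g \<bullet> v" unfolding y_def by (rule h_equiv[OF g])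
    also have "b g \<bullet> v = \<alpha> * (b g \<bullet> V) + \<beta> * (b g \<bullet> w)" by (simp add: vab inner_add_right)
    finally have hy: "h y = \<alpha> * l ^ n * h V + \<beta> * (1 / l) ^ n * h w + \<Delta>h + c g * \<Delta>f"
      unfolding bV bw \<Delta>h_def \<Delta>f_def by (simp add: algebra_simps)
    \<comment> \<open>The terms of order l^n cancel in the minor because the V-component of y
      contributes a multiple of \<open>lift V\<close>; what grows is n times
      \<open>c \<gamma>\<close> times the nonzero defect \<Delta>f.\<close>
    have "lift V $ 4 * lift y $ j - lift y $ 4 * lift V $ j = h V * y$i - h y * V$i"
      by (simp add: lift_j) (simp add: lift_def)
    also have "y$i = \<alpha> * l ^ n * V$i + \<beta> * (1 / l) ^ n * w$i" by (simp add: y)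
    also have "h V * (\<alpha> * l ^ n * V$i + \<beta> * (1 / l) ^ n * w$i) - h y * V$i
        = \<beta> * (1 / l) ^ n * (h V * w$i - h w * V$i) - \<Delta>h * V$i - c g * \<Delta>f * V$i"
      unfolding hy by (simp add: algebra_simps)
    finally have minor: "lift V $ 4 * lift y $ j - lift y $ 4 * lift V $ j
      = \<beta> * (1 / l) ^ n * (h V * w$i - h w * V$i) - \<Delta>h * V$i - c g * \<Delta>f * V$i" .
    have tri: "\<bar>r\<bar> \<le> \<bar>p - q - r\<bar> + \<bar>q\<bar> + \<bar>p\<bar>" for p q r :: real by linarith
    have t1: "\<bar>\<beta> * (1 / l) ^ n * (h V * w$i - h w * V$i)\<bar> \<le> \<bar>\<beta>\<bar> * (\<bar>h V\<bar> * \<bar>w$i\<bar> + \<bar>h w\<bar> * \<bar>V$i\<bar>)"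
    proof -
      have "\<bar>h V * w$i - h w * V$i\<bar> \<le> \<bar>h V\<bar> * \<bar>w$i\<bar> + \<bar>h w\<bar> * \<bar>V$i\<bar>"
        using abs_triangle_ineq4[of "h V * w$i" "h w * V$i"] by (simp add: abs_mult)
      moreover have "\<bar>(1 / l) ^ n\<bar> \<le> 1" unfolding al using Ln by (simp add: divide_le_eq_1)
      ultimately have "\<bar>(1 / l) ^ n\<bar> * \<bar>h V * w$i - h w * V$i\<bar> \<le> 1 * (\<bar>h V\<bar> * \<bar>w$i\<bar> + \<bar>h w\<bar> * \<bar>V$i\<bar>)"
        by (intro mult_mono) auto
      then show ?thesis unfolding abs_mult by (simp only: mult.assoc mult_1) (rule mult_left_mono, auto)
    qed
    have "\<bar>c g * \<Delta>f * V$i\<bar> \<le> \<bar>lift V $ 4 * lift y $ j - lift y $ 4 * lift V $ j\<bar> + M0"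
      unfolding minor M0_def
      using tri[of "c g * \<Delta>f * V$i" "\<beta> * (1 / l) ^ n * (h V * w$i - h w * V$i)" "\<Delta>h * V$i"] t1
      by (simp add: abs_mult[of \<Delta>h])
    also have "\<dots> \<le> 2 * wedge_norm (lift y) (lift V) + M0"
      using minor_le_wedge_norm[of "lift V" 4 "lift y" j] by simp
    finally have low: "real n * (\<bar>c \<gamma>\<bar> * \<bar>\<Delta>f\<bar> * \<bar>V$i\<bar>) \<le> 2 * wedge_norm (lift y) (lift V) + M0"
      by (simp add: cg abs_mult mult.assoc)
    have dyV: "det2 y V = - (\<beta> * (1 / l) ^ n)" "det2 y w = \<alpha> * l ^ n"
    proof -
      have "det2 z z = 0" for z by (simp add: det2_def)
      moreover have "det2 w V = - 1" using w(1) det2_antisym[of w V] by simp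
      ultimately show "det2 y V = - (\<beta> * (1 / l) ^ n)" "det2 y w = \<alpha> * l ^ n"
        unfolding y using w(1) by (simp_all add: det2_add)
    qed
    have y0: "y \<noteq> 0" using dyV(2) \<alpha> l0 by (auto simp: det2_def)
    obtain x' k where x': "k \<noteq> 0" "boundary_vec x' = k *\<^sub>R y" using boundary_vec_surj[OF y0] by metis
    obtain kx where kx: "kx \<noteq> 0" "boundary_vec x = kx *\<^sub>R V" using x by blast
    have \<xi>x': "\<xi> x' = span {lift y}" by (rule \<xi>_eq[OF x'(2,1)])
    have NV: "based_norm x0 V > 0" "based_norm x0 w > 0" "based_norm x0 y > 0"
      using based_norm_pos[OF x0] V(1) w0 y0 by auto
    have "visual_dist x0 x' x \<le> M2 / (L ^ n)\<^sup>2"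
    proof -
      \<comment> \<open>\<open>det2 y w\<close> bounds the based norm of y below by a multiple of
        L^n. Together with the factor L^-n in \<open>det2 y V\<close> this gives visual distance
        O(L^(-2n)).\<close>
      have ny: "Im x0 * (\<bar>\<alpha>\<bar> * L ^ n) / based_norm x0 w \<le> based_norm x0 y"
        using det2_le_based_norm[OF x0, of y w] NV unfolding dyV abs_mult al
        by (simp add: pos_divide_le_eq)
      have "visual_dist x0 x' x = Im x0 * (\<bar>\<beta>\<bar> * (1 / L ^ n)) / (based_norm x0 y * based_norm x0 V)"
        using visual_dist_vec[OF x0 x'(2) kx(2) x'(1) kx(1)] unfolding dyV abs_minus_cancel abs_mult al .
      also have "\<dots> \<le> Im x0 * (\<bar>\<beta>\<bar> * (1 / L ^ n)) / ((Im x0 * (\<bar>\<alpha>\<bar> * L ^ n) / based_norm x0 w) * based_norm x0 V)"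
        using ny NV i0 \<alpha> L by (intro divide_left_mono mult_right_mono mult_nonneg_nonneg mult_pos_pos divide_pos_pos) auto
      also have "\<dots> = M2 / (L ^ n)\<^sup>2"
        using NV i0 \<alpha> L by (simp add: M2_def power2_eq_square field_simps)
      finally show ?thesis .
    qed
    then have "sqrt (visual_dist x0 x' x) \<le> sqrt (M2 / (L ^ n)\<^sup>2)"
      by (rule real_sqrt_le_mono)
    also have "\<dots> = sqrt M2 / L ^ n"
      using L by (simp add: real_sqrt_divide)
    finally have "sqrt (visual_dist x0 x' x) \<le> sqrt M2 / L ^ n" .
    then have "C * sqrt (visual_dist x0 x' x) \<le> C * (sqrt M2 / L ^ n)"
      using C(1) by (intro mult_left_mono) auto
    then have pd: "wedge_norm (lift y) (lift V) / (norm (lift y) * norm (lift V)) \<le> C * (sqrt M2 / L ^ n)"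
      using C(2)[of x' x] proj_dist_bounds(1)[OF lift_nz[OF y0] lift_nz[OF V(1)]]
      unfolding \<xi>x \<xi>x' by linarith
    have nly: "norm (lift y) \<le> M1 * L ^ n"
    proof -
      have "norm y \<le> \<bar>\<alpha>\<bar> * L ^ n * norm V + \<bar>\<beta>\<bar> * (1 / L ^ n) * norm w"
        unfolding y by (rule order_trans[OF norm_triangle_ineq]) (simp add: abs_mult al)
      also have "\<dots> \<le> \<bar>\<alpha>\<bar> * L ^ n * norm V + \<bar>\<beta>\<bar> * L ^ n * norm w"
      proof (intro add_left_mono mult_right_mono mult_left_mono)
        have "1 / L ^ n \<le> 1 / 1" using Ln by (intro divide_left_mono) auto
        then show "1 / L ^ n \<le> L ^ n" using Ln by linarith
      qed auto
      finally have "(1 + 2 * K) * norm y \<le> (1 + 2 * K) * (\<bar>\<alpha>\<bar> * L ^ n * norm V + \<bar>\<beta>\<bar> * L ^ n * norm w)"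
        using K_nonneg by (intro mult_left_mono) auto
      also have "\<dots> = M1 * L ^ n" by (simp add: M1_def algebra_simps)
      finally show ?thesis using norm_lift_bounds(2)[of y] by linarith
    qed
    have nl: "norm (lift y) > 0" "norm (lift V) > 0" using lift_nz y0 V(1) by auto
    have "wedge_norm (lift y) (lift V) \<le> C * (sqrt M2 / L ^ n) * (norm (lift y) * norm (lift V))"
      using pd nl by (simp add: pos_divide_le_eq)
    also have "\<dots> \<le> C * (sqrt M2 / L ^ n) * (M1 * L ^ n * norm (lift V))"
    proof (intro mult_left_mono mult_right_mono nly)
      have "M2 \<ge> 0" using NV by (simp add: M2_def)
      then show "0 \<le> C * (sqrt M2 / L ^ n)" using C(1) Ln by simp
    qed auto
    also have "\<dots> = C * sqrt M2 * M1 * norm (lift V)" using L by (simp add: field_simps)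
    finally show ?thesis using low unfolding M_def by linarith
  qed
  have "\<bar>c \<gamma>\<bar> * \<bar>\<Delta>f\<bar> * \<bar>V$i\<bar> > 0" using \<gamma>(2) \<Delta>f i by simp
  then obtain n :: nat where "M < real n * (\<bar>c \<gamma>\<bar> * \<bar>\<Delta>f\<bar> * \<bar>V$i\<bar>)"
    using reals_Archimedean3 by blast
  with bound[of n] show False by linarith
qed

text \<open>Visual distances are at most 1, so a Hoelder bound with exponent above 1/2 would imply
  one with exponent 1/2; below 1/2 every positive exponent is attained by
  \<open>\<xi>_Hoelder\<close>.\<close>

lemma \<xi>_Hoelder_exponent:
  assumes x0: "x0 \<in> hyp_plane" and not_half: "\<not> is_Hoelder (visual_dist x0) proj_dist (1 / 2) \<xi>"
  shows "Hoelder_exponent (visual_dist x0) proj_dist \<xi> = ereal (1 / 2)"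
  unfolding Hoelder_exponent_def
proof (rule antisym)
  show "Sup (ereal ` {\<alpha>. 0 < \<alpha> \<and> is_Hoelder (visual_dist x0) proj_dist \<alpha> \<xi>}) \<le> ereal (1 / 2)"
  proof (rule Sup_least)
    fix z assume "z \<in> ereal ` {\<alpha>. 0 < \<alpha> \<and> is_Hoelder (visual_dist x0) proj_dist \<alpha> \<xi>}"
    then obtain \<alpha> C where \<alpha>: "z = ereal \<alpha>" "\<alpha> > 0" and C: "C > 0"
      "\<And>x y. proj_dist (\<xi> x) (\<xi> y) \<le> C * visual_dist x0 x y powr \<alpha>"
      by (auto simp: is_Hoelder_def)
    have "\<alpha> \<le> 1 / 2"
    proof (rule ccontr)
      assume gt: "\<not> \<alpha> \<le> 1 / 2"
      have "proj_dist (\<xi> x) (\<xi> y) \<le> C * visual_dist x0 x y powr (1 / 2)" for x y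
      proof -
        have "visual_dist x0 x y powr \<alpha> \<le> visual_dist x0 x y powr (1 / 2)"
          using gt visual_dist_nonneg[OF x0, of x y] visual_dist_le_1[OF x0, of x y] by (intro powr_mono') auto
        then show ?thesis using C(2)[of x y] mult_left_mono[of _ _ C] C(1) by (meson less_imp_le order_trans)
      qed
      then show False using not_half C(1) unfolding is_Hoelder_def by blast
    qed
    then show "z \<le> ereal (1 / 2)" using \<alpha> by simp
  qed
  show "ereal (1 / 2) \<le> Sup (ereal ` {\<alpha>. 0 < \<alpha> \<and> is_Hoelder (visual_dist x0) proj_dist \<alpha> \<xi>})"
  proof (rule dense_le_bounded[of 0])
    fix z assume z: "(0 :: ereal) < z" "z < ereal (1 / 2)"
    then obtain \<alpha> where \<alpha>: "z = ereal \<alpha>" by (cases z) auto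
    then have "is_Hoelder (visual_dist x0) proj_dist \<alpha> \<xi>"
      using z by (intro \<xi>_Hoelder[OF x0]) auto
    then show "z \<le> Sup (ereal ` {\<alpha>. 0 < \<alpha> \<and> is_Hoelder (visual_dist x0) proj_dist \<alpha> \<xi>})"
      using \<alpha> z by (intro Sup_upper) auto
  qed simp
qed

end

section \<open>The family of representations\<close>

lemma continuous_on_block_mat:
  assumes "continuous_on S a" "continuous_on S b" "continuous_on S c"
  shows "continuous_on S (\<lambda>p. block_mat P (a p) (b p) (c p))"
proof -
  have "continuous_on S (\<lambda>p. block_mat P (a p) (b p) (c p) $ i $ j)" for i j
    using exhaust_4[of i] exhaust_4[of j] assms
    by (elim disjE) (simp_all add: continuous_on_component)
  then have "continuous_on S (\<lambda>p. \<chi> i j. block_mat P (a p) (b p) (c p) $ i $ j)"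
    by (intro continuous_on_vec_lambda)
  then show ?thesis by (simp add: vec_lambda_eta)
qed

text \<open>\<open>section_exists\<close> is used twice: for a, and then for the function c f + b,
  which is a cocycle precisely because f is equivariant and b is a primitive of the product of c and
  a.\<close>

lemma matrix_lattice_sections_exist:
  assumes "matrix_lattice G P" and c: "c \<in> hom G real_add"
    and a: "\<And>\<gamma> \<delta>. \<gamma> \<in> carrier G \<Longrightarrow> \<delta> \<in> carrier G \<Longrightarrow> a (\<gamma> \<otimes>\<^bsub>G\<^esub> \<delta>) = a \<delta> + a \<gamma> v* P \<delta>"
    and b: "\<And>\<gamma> \<delta>. \<gamma> \<in> carrier G \<Longrightarrow> \<delta> \<in> carrier G \<Longrightarrow>
      b (\<gamma> \<otimes>\<^bsub>G\<^esub> \<delta>) = b \<delta> + c \<gamma> *\<^sub>R a \<delta> + b \<gamma> v* P \<delta>"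
  obtains f h K where "lattice_section G P a b c f h K"
proof -
  interpret matrix_lattice G P by fact
  obtain f Cf where f: "Cf \<ge> 0" "\<And>v. \<bar>f v\<bar> \<le> Cf * norm v" "\<And>k v. f (k *\<^sub>R v) = k * f v"
    "\<And>\<gamma> v. \<gamma> \<in> carrier G \<Longrightarrow> f (P \<gamma> *v v) = f v + a \<gamma> \<bullet> v"
  proof (rule section_exists[of "\<lambda>\<gamma> v. a \<gamma> \<bullet> v"])
    show "\<exists>C. \<forall>v. \<bar>a \<gamma> \<bullet> v\<bar> \<le> C * norm v" for \<gamma>
      using Cauchy_Schwarz_ineq2 by blast
  qed (auto simp: a inner_add_left dot_lmul_matrix)
  obtain h Ch where h: "Ch \<ge> 0" "\<And>v. \<bar>h v\<bar> \<le> Ch * norm v" "\<And>k v. h (k *\<^sub>R v) = k * h v"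
    "\<And>\<gamma> v. \<gamma> \<in> carrier G \<Longrightarrow> h (P \<gamma> *v v) = h v + (c \<gamma> * f v + b \<gamma> \<bullet> v)"
  proof (rule section_exists[of "\<lambda>\<gamma> v. c \<gamma> * f v + b \<gamma> \<bullet> v"])
    show "\<exists>C. \<forall>v. \<bar>c \<gamma> * f v + b \<gamma> \<bullet> v\<bar> \<le> C * norm v" for \<gamma>
    proof (intro exI allI)
      fix v
      have "\<bar>c \<gamma> * f v\<bar> \<le> \<bar>c \<gamma>\<bar> * (Cf * norm v)" unfolding abs_mult by (intro mult_left_mono f) auto
      then show "\<bar>c \<gamma> * f v + b \<gamma> \<bullet> v\<bar> \<le> (\<bar>c \<gamma>\<bar> * Cf + norm (b \<gamma>)) * norm v"
        using Cauchy_Schwarz_ineq2[of "b \<gamma>" v] by (simp add: distrib_right mult.assoc)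
    qed
  next
    fix \<gamma> \<delta> v assume "\<gamma> \<in> carrier G" "\<delta> \<in> carrier G"
    moreover have "c (\<gamma> \<otimes>\<^bsub>G\<^esub> \<delta>) = c \<gamma> + c \<delta>" using c calculation by (simp add: hom_def)
    ultimately show "c (\<gamma> \<otimes>\<^bsub>G\<^esub> \<delta>) * f v + b (\<gamma> \<otimes>\<^bsub>G\<^esub> \<delta>) \<bullet> v
        = c \<gamma> * f (P \<delta> *v v) + b \<gamma> \<bullet> (P \<delta> *v v) + (c \<delta> * f v + b \<delta> \<bullet> v)"
      by (simp add: b f(4) inner_add_left dot_lmul_matrix algebra_simps)
  qed (auto simp: f(3) algebra_simps)
  have "lattice_section G P a b c f h (Cf + Ch)"
  proof (unfold_locales)
    show "\<bar>f v\<bar> \<le> (Cf + Ch) * norm v" for v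
      using f(2)[of v] mult_nonneg_nonneg[OF h(1) norm_ge_zero[of v]] unfolding distrib_right by linarith
    show "\<bar>h v\<bar> \<le> (Cf + Ch) * norm v" for v
      using h(2)[of v] mult_nonneg_nonneg[OF f(1) norm_ge_zero[of v]] unfolding distrib_right by linarith
  qed (simp_all add: c f(3,4) h(3,4))
  then show thesis by (rule that)
qed

text \<open>For nonzero s and t this is conjugation by the diagonal matrix with entries 1, 1, s, s
  t. The formulas persist at s = 0 or t = 0 because the identity for b is bilinear in c and
  a.\<close>

lemma (in lattice_section) scaled_section:
  "lattice_section G P (\<lambda>\<gamma>. s *\<^sub>R a \<gamma>) (\<lambda>\<gamma>. (s * t) *\<^sub>R b \<gamma>) (\<lambda>\<gamma>. t * c \<gamma>)
     (\<lambda>v. s * f v) (\<lambda>v. (s * t) * h v) ((\<bar>s\<bar> + \<bar>s * t\<bar>) * K)"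
proof (unfold_locales)
  show "(\<lambda>\<gamma>. t * c \<gamma>) \<in> hom G real_add" by (auto simp: hom_def c_mult distrib_left)
  fix v :: "real^2"
  have nn: "0 \<le> \<bar>r\<bar> * (K * norm v)" for r using K_nonneg by simp
  have "\<bar>s * f v\<bar> \<le> \<bar>s\<bar> * (K * norm v)" "\<bar>(s * t) * h v\<bar> \<le> \<bar>s * t\<bar> * (K * norm v)"
    unfolding abs_mult[of s "f v"] abs_mult[of "s * t" "h v"]
    by (intro mult_left_mono f_bound h_bound abs_ge_zero)+
  then show "\<bar>s * f v\<bar> \<le> (\<bar>s\<bar> + \<bar>s * t\<bar>) * K * norm v" "\<bar>(s * t) * h v\<bar> \<le> (\<bar>s\<bar> + \<bar>s * t\<bar>) * K * norm v"
    using nn[of s] nn[of "s * t"] unfolding distrib_right mult.assoc[of _ K "norm v"] by linarith+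
qed (auto simp: f_scale h_scale f_equiv h_equiv algebra_simps)

lemma det_minus_one_nonzero:
  fixes A :: "real^2^2"
  assumes "det A = 1" "\<bar>A$1$1 + A$2$2\<bar> > 2"
  shows "det (A - mat 1) \<noteq> 0"
proof -
  have "det (A - mat 1) = det A + 1 - (A$1$1 + A$2$2)"
    by (simp add: det_2 mat_def algebra_simps)
  then show ?thesis using assms by auto
qed

theorem theorem1p6:
  fixes g :: nat and x0 :: complex
    and \<rho>\<^sub>1 :: "surface_gen word set \<Rightarrow> real^2^2"
  assumes "g \<ge> 2"
    and "x0 \<in> hyp_plane"
    and "model_rep (surface_group g) \<rho>\<^sub>1"
  shows "\<exists>\<epsilon>>0. \<exists>\<rho> :: real \<times> real \<Rightarrow> surface_gen word set \<Rightarrow> real^4^4.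
    (\<forall>\<gamma>\<in>carrier (surface_group g). continuous_on (UNIV \<times> {-\<epsilon><..<\<epsilon>}) (\<lambda>p. \<rho> p \<gamma>)) \<and>
    (\<forall>p\<in>UNIV \<times> {-\<epsilon><..<\<epsilon>}.
       \<rho> p \<in> hom (surface_group g) SL \<and> one_Anosov x0 (surface_group g) \<rho>\<^sub>1 (\<rho> p)) \<and>
    (\<forall>s t. (s, t) \<in> UNIV \<times> {-\<epsilon><..<\<epsilon>} \<and> s \<noteq> 0 \<and> t \<noteq> 0 \<longrightarrow>
       (\<exists>\<xi>. Anosov_limit_map x0 (surface_group g) \<rho>\<^sub>1 (\<rho> (s, t)) \<xi> \<and>
          span (\<Union>x. \<xi> x) = UNIV \<and>
          Hoelder_exponent (visual_dist x0) proj_dist \<xi> = ereal (1 / 2) \<and>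
          \<not> is_Hoelder (visual_dist x0) proj_dist (1 / 2) \<xi>))"
proof -
  let ?G = "surface_group g"
  let ?cls = "gen_class (surface_gens g) {surface_relator g}"
  have group: "group ?G" unfolding surface_group_def by (rule group_presented_group)
  have lattice: "matrix_lattice ?G \<rho>\<^sub>1" by (rule model_rep_matrix_lattice[OF group assms(3)])
  interpret L: matrix_lattice ?G \<rho>\<^sub>1 by (rule lattice)
  have gens: "?cls y \<in> carrier ?G" if "y \<in> surface_gens g" for y
    using word_class_closed[of "[(y, False)]"] that by (simp add: surface_group_def)
  have g: "GenA 0 \<in> surface_gens g" "GenA 1 \<in> surface_gens g" "GenB 0 \<in> surface_gens g"
    using \<open>g \<ge> 2\<close> by auto
  let ?B = "\<rho>\<^sub>1 (?cls (GenB 0))"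
  \<comment> \<open>The exponent sum of \<open>GenB 0\<close> is a homomorphism nonzero on it, so
    its image is hyperbolic and has no eigenvalue 1.\<close>
  have detB: "det (?B - mat 1) \<noteq> 0"
  proof -
    obtain e where "e \<in> hom ?G real_add" "e (?cls (GenB 0)) = 1"
      using exponent_sum_hom[of g "GenB 0"] g by metis
    then show ?thesis
      using L.hom_real_nonzero_hyperbolic[of e "?cls (GenB 0)"] gens[OF g(3)]
      by (intro det_minus_one_nonzero) auto
  qed
  obtain a b c where c: "c \<in> hom ?G real_add"
    and a: "\<And>\<gamma> \<delta>. \<gamma> \<in> carrier ?G \<Longrightarrow> \<delta> \<in> carrier ?G \<Longrightarrow> a (\<gamma> \<otimes>\<^bsub>?G\<^esub> \<delta>) = a \<delta> + a \<gamma> v* \<rho>\<^sub>1 \<delta>"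
    and b: "\<And>\<gamma> \<delta>. \<gamma> \<in> carrier ?G \<Longrightarrow> \<delta> \<in> carrier ?G \<Longrightarrow>
      b (\<gamma> \<otimes>\<^bsub>?G\<^esub> \<delta>) = b \<delta> + c \<gamma> *\<^sub>R a \<delta> + b \<gamma> v* \<rho>\<^sub>1 \<delta>"
    and gen: "c (?cls (GenA 0)) = 1" "a (?cls (GenB 0)) = 0" "a (?cls (GenA 1)) \<noteq> 0"
    by (rule surface_cocycle_exists[OF \<open>g \<ge> 2\<close> L.hom detB]) (rule that)
  obtain f h K where fh: "lattice_section ?G \<rho>\<^sub>1 a b c f h K"
    using matrix_lattice_sections_exist[OF lattice c a b] .
  interpret S: lattice_section ?G \<rho>\<^sub>1 a b c f h K by (rule fh)
  \<comment> \<open>A linear f would exhibit a as the coboundary of l; at \<open>GenB 0\<close>,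
    where a vanishes, invertibility gives l = 0, contradicting the value at
    \<open>GenA 1\<close>.\<close>
  have nonlinear: "\<exists>v. f v \<noteq> l \<bullet> v" for l
  proof (rule ccontr)
    assume "\<nexists>v. f v \<noteq> l \<bullet> v"
    then have fl: "f v = l \<bullet> v" for v by blast
    have "(l v* (?B - mat 1)) \<bullet> v = 0" for v
      using S.f_equiv[OF gens[OF g(3)], of v]
      by (simp add: fl gen dot_lmul_matrix matrix_vector_mult_diff_rdistrib inner_diff_right)
    then have "l v* (?B - mat 1) = 0" by (metis inner_eq_zero_iff)
    moreover obtain C where "(?B - mat 1) ** C = mat 1"
      using detB unfolding invertible_det_nz[symmetric] invertible_def by blast
    then have "(l v* (?B - mat 1)) v* C = l" by (simp add: vector_matrix_mul_assoc)
    ultimately have "l = 0" by simp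
    then have "a (?cls (GenA 1)) \<bullet> v = 0" for v
      using S.f_equiv[OF gens[OF g(2)], of v] by (simp add: fl)
    then show False using gen(3) by (metis inner_eq_zero_iff)
  qed
  define \<rho> where "\<rho> p \<gamma> = block_mat (\<rho>\<^sub>1 \<gamma>) (fst p *\<^sub>R a \<gamma>) ((fst p * snd p) *\<^sub>R b \<gamma>) (snd p * c \<gamma>)"
    for p :: "real \<times> real" and \<gamma>
  have sec: "lattice_section ?G \<rho>\<^sub>1 (\<lambda>\<gamma>. fst p *\<^sub>R a \<gamma>) (\<lambda>\<gamma>. (fst p * snd p) *\<^sub>R b \<gamma>) (\<lambda>\<gamma>. snd p * c \<gamma>)
      (\<lambda>v. fst p * f v) (\<lambda>v. (fst p * snd p) * h v) ((\<bar>fst p\<bar> + \<bar>fst p * snd p\<bar>) * K)" for p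
    by (rule S.scaled_section)
  have \<rho>_eq: "lattice_section.\<rho> \<rho>\<^sub>1 (\<lambda>\<gamma>. fst p *\<^sub>R a \<gamma>) (\<lambda>\<gamma>. (fst p * snd p) *\<^sub>R b \<gamma>) (\<lambda>\<gamma>. snd p * c \<gamma>) = \<rho> p" for p
    by (intro ext) (simp add: lattice_section.\<rho>_def[OF sec] \<rho>_def)
  \<comment> \<open>The estimates hold for all real s and t, so \<epsilon> = 1 is an arbitrary
    choice.\<close>
  have cont: "continuous_on (UNIV \<times> {-1<..<1}) (\<lambda>p. \<rho> p \<gamma>)" for \<gamma>
    unfolding \<rho>_def by (intro continuous_on_block_mat continuous_intros)
  have reps: "\<rho> p \<in> hom ?G SL" "one_Anosov x0 ?G \<rho>\<^sub>1 (\<rho> p)" for p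
    using lattice_section.\<rho>_hom(1)[OF sec] lattice_section.\<rho>_Anosov[OF sec assms(2)]
    by (simp_all add: \<rho>_eq)
  have main: "\<exists>\<xi>. Anosov_limit_map x0 ?G \<rho>\<^sub>1 (\<rho> (s, t)) \<xi> \<and> span (\<Union>x. \<xi> x) = UNIV \<and>
      Hoelder_exponent (visual_dist x0) proj_dist \<xi> = ereal (1 / 2) \<and>
      \<not> is_Hoelder (visual_dist x0) proj_dist (1 / 2) \<xi>" if st: "s \<noteq> 0" "t \<noteq> 0" for s t
  proof -
    interpret T: lattice_section ?G \<rho>\<^sub>1 "\<lambda>\<gamma>. s *\<^sub>R a \<gamma>" "\<lambda>\<gamma>. (s * t) *\<^sub>R b \<gamma>" "\<lambda>\<gamma>. t * c \<gamma>"
      "\<lambda>v. s * f v" "\<lambda>v. (s * t) * h v" "(\<bar>s\<bar> + \<bar>s * t\<bar>) * K"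
      by (rule S.scaled_section)
    have nl: "\<exists>v. s * f v \<noteq> l \<bullet> v" for l
    proof -
      obtain v where "f v \<noteq> ((1 / s) *\<^sub>R l) \<bullet> v" using nonlinear by blast
      then show ?thesis using st by (intro exI[of _ v]) (auto simp: field_simps)
    qed
    have c0: "t * c (?cls (GenA 0)) \<noteq> 0" using st gen by simp
    have half: "\<not> is_Hoelder (visual_dist x0) proj_dist (1 / 2) T.\<xi>"
      by (rule T.\<xi>_not_Hoelder[OF assms(2) nl gens[OF g(1)] c0])
    have "Anosov_limit_map x0 ?G \<rho>\<^sub>1 (\<rho> (s, t)) T.\<xi>"
      using T.\<xi>_limit_map[OF assms(2)] \<rho>_eq[of "(s, t)"] by simp
    then show ?thesis
      using T.\<xi>_spanning[OF nl gens[OF g(1)] c0] T.\<xi>_Hoelder_exponent[OF assms(2) half] half by blast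
  qed
  show ?thesis
    by (intro exI[of _ 1] exI[of _ \<rho>] conjI ballI allI impI zero_less_one cont reps main) auto
qed

end
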